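(* Let $u_0\in\mathcal P_2(\mathbb R)$ and let $u$ be the solution of the Dyson equation $\partial_t u+\partial_x(uH[u])=0$ in $(0,+\infty)\times\mathbb R$ with initial condition $u_0$. Then for every $T\ge t>0$, $$\int_t^{T}\|u(s,\cdot)\|_{C^{1/3}}^3\,ds<+\infty .$$ In particular, for almost every $s>0$, $u(s,\cdot)\in C^{1/3}$.
   Context: $\mathcal P(\mathbb R)$ is the set of Borel probability measures on $\mathbb R$ with the topology of weak convergence (test functions continuous and bounded); $\mathcal P_2(\mathbb R)$ is the subset of those with finite second moment. The Hilbert transform is $H[u](x)=\frac1\pi\,\mathrm{p.v.}\int_{\mathbb R}\frac{u(y)-u(x)}{x-y}\,dy$ (Fourier multiplier $-i\,\mathrm{sign}(\xi)$). Hölder seminorm: for $0<\alpha<1$, $\|f\|_{C^\alpha}:=\sup_{x\neq y}\frac{|f(x)-f(y)|}{|x-y|^\alpha}\in[0,+\infty]$, and $f\in C^\alpha$ means that this is finite (for a function defined almost everywhere: that it has a representative for which this is finite). Notion of solution (viscosity solutions of the integrated equation). For bounded smooth $\varphi$ with bounded derivatives, $(-\Delta)^{1/2}\varphi(x)=\frac1\pi\,\mathrm{p.v.}\int_{\mathbb R}\frac{\varphi(x)-\varphi(y)}{(x-y)^2}\,dy=H[\partial_x\varphi](x)$. The solution of the Dyson equation with initial condition $u_0\in\mathcal P(\mathbb R)$ is the unique $u\in C([0,+\infty),\mathcal P(\mathbb R))$ with $u(0)=u_0$ whose distribution function is a viscosity solution of $\partial_tF+\partial_xF\,(-\Delta)^{1/2}F=0$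 in $(0,+\infty)\times\mathbb R$. That is, with $F^*(t,x)=u(t)((-\infty,x])$ and $F_*(t,x)=u(t)((-\infty,x))$: for every smooth function $\varphi$ on $(0,+\infty)\times\mathbb R$, bounded with bounded derivatives, at every global strict maximum point $(t_0,x_0)$ of $F^*-\varphi$ one has $\partial_t\varphi+\partial_x\varphi\,(-\Delta)^{1/2}\varphi\le 0$ at $(t_0,x_0)$, and at every global strict minimum point of $F_*-\varphi$ one has $\partial_t\varphi+\partial_x\varphi\,(-\Delta)^{1/2}\varphi\ge 0$. It is known that such a solution exists and is unique, and that for every $t>0$ the measure $u(t)$ has a bounded density, denoted $u(t,\cdot)$, with $\|u(t,\cdot)\|_{L^\infty}\le C/\sqrt t$ for a universal constant $C$. *)

theory Defs
  imports "HOL-Probability.Probability"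
begin

text \<open>
  \<open>\<P>(\<real>)\<close> is rendered by the library predicate \<^const>\<open>real_distribution\<close>
  (probability measures on the Borel sets of the reals).
\<close>

definition finite_second_moment :: "real measure \<Rightarrow> bool" where
  "finite_second_moment \<mu> \<longleftrightarrow> integrable \<mu> (\<lambda>x. x\<^sup>2)"

text \<open>
  Elements of \<open>C([0,\<infinity>), \<P>(\<real>))\<close> for the topology of weak convergence, that is, the initial
  topology of the maps \<open>\<mu> \<mapsto> \<integral> f d\<mu>\<close> with \<open>f\<close> bounded and continuous.
  Values at negative times are irrelevant.
\<close>

definition weakly_continuous_curve :: "(real \<Rightarrow> real measure) \<Rightarrow> bool" where
  "weakly_continuous_curve u \<longleftrightarrow>
     (\<forall>t\<ge>0. real_distribution (u t)) \<and>
     (\<forall>f :: real \<Rightarrow> real. continuous_on UNIV f \<and> bounded (range f) \<longrightarrow>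
        continuous_on {0..} (\<lambda>t. \<integral>x. f x \<partial>(u t)))"

text \<open>
  Functions of class \<open>C\<^sup>k\<close> on an open set \<open>S\<close> that are bounded on \<open>S\<close> together with all their
  derivatives up to order \<open>k\<close>; derivatives of order \<open>k\<close> are taken one direction at a time.
\<close>

primrec bounded_Ck_on ::
  "nat \<Rightarrow> 'a::real_normed_vector set \<Rightarrow> ('a \<Rightarrow> 'b::real_normed_vector) \<Rightarrow> bool" where
  "bounded_Ck_on 0 S f \<longleftrightarrow> continuous_on S f \<and> bounded (f ` S)"
| "bounded_Ck_on (Suc k) S f \<longleftrightarrow>
     continuous_on S f \<and> bounded (f ` S) \<and> (\<forall>x\<in>S. f differentiable (at x)) \<and>
     (\<forall>v. bounded_Ck_on k S (\<lambda>x. frechet_derivative f (at x) v))"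

definition bounded_smooth_on ::
  "'a::real_normed_vector set \<Rightarrow> ('a \<Rightarrow> 'b::real_normed_vector) \<Rightarrow> bool" where
  "bounded_smooth_on S f \<longleftrightarrow> (\<forall>k. bounded_Ck_on k S f)"

text \<open>
  \<open>(-\<Delta>)\<^bsup>1/2\<^esup>\<close>; the limit defining the principal value exists for bounded smooth functions with
  bounded derivatives, the only ones to which the operator is applied.
\<close>

definition half_laplacian :: "(real \<Rightarrow> real) \<Rightarrow> real \<Rightarrow> real" where
  "half_laplacian \<psi> x =
     1 / pi * Lim (at_right 0) (\<lambda>\<epsilon>. LBINT y:{y. \<epsilon> < \<bar>x - y\<bar>}. (\<psi> x - \<psi> y) / (x - y)\<^sup>2)"

text \<open>The left-hand side \<open>\<partial>\<^sub>t\<phi> + \<partial>\<^sub>x\<phi> (-\<Delta>)\<^bsup>1/2\<^esup>\<phi>\<close> of the integrated equation.\<close>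

definition integrated_dyson_operator :: "(real \<times> real \<Rightarrow> real) \<Rightarrow> real \<Rightarrow> real \<Rightarrow> real" where
  "integrated_dyson_operator \<phi> t x =
     deriv (\<lambda>s. \<phi> (s, x)) t + deriv (\<lambda>y. \<phi> (t, y)) x * half_laplacian (\<lambda>y. \<phi> (t, y)) x"

definition strict_global_max_on :: "'a set \<Rightarrow> ('a \<Rightarrow> real) \<Rightarrow> 'a \<Rightarrow> bool" where
  "strict_global_max_on S g p \<longleftrightarrow> p \<in> S \<and> (\<forall>q\<in>S. q \<noteq> p \<longrightarrow> g q < g p)"

definition strict_global_min_on :: "'a set \<Rightarrow> ('a \<Rightarrow> real) \<Rightarrow> 'a \<Rightarrow> bool" where
  "strict_global_min_on S g p \<longleftrightarrow> p \<in> S \<and> (\<forall>q\<in>S. q \<noteq> p \<longrightarrow> g p < g q)"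

definition upper_cdf :: "(real \<Rightarrow> real measure) \<Rightarrow> real \<times> real \<Rightarrow> real" where
  "upper_cdf u = (\<lambda>(t, x). measure (u t) {..x})"

definition lower_cdf :: "(real \<Rightarrow> real measure) \<Rightarrow> real \<times> real \<Rightarrow> real" where
  "lower_cdf u = (\<lambda>(t, x). measure (u t) {..<x})"

definition cdf_viscosity_solution :: "(real \<Rightarrow> real measure) \<Rightarrow> bool" where
  "cdf_viscosity_solution u \<longleftrightarrow>
     (\<forall>\<phi> :: real \<times> real \<Rightarrow> real. bounded_smooth_on ({0<..} \<times> UNIV) \<phi> \<longrightarrow>
        (\<forall>t x. strict_global_max_on ({0<..} \<times> UNIV) (\<lambda>p. upper_cdf u p - \<phi> p) (t, x) \<longrightarrow>
           integrated_dyson_operator \<phi> t x \<le> 0) \<and>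
        (\<forall>t x. strict_global_min_on ({0<..} \<times> UNIV) (\<lambda>p. lower_cdf u p - \<phi> p) (t, x) \<longrightarrow>
           integrated_dyson_operator \<phi> t x \<ge> 0))"

text \<open>
  A predicate rather than a function of \<open>u\<^sub>0\<close>: the solution is unique only as a curve on \<open>[0,\<infinity>)\<close>.
\<close>

definition dyson_solution :: "real measure \<Rightarrow> (real \<Rightarrow> real measure) \<Rightarrow> bool" where
  "dyson_solution u\<^sub>0 u \<longleftrightarrow>
     weakly_continuous_curve u \<and> u 0 = u\<^sub>0 \<and> cdf_viscosity_solution u"

definition holder_seminorm :: "real \<Rightarrow> (real \<Rightarrow> real) \<Rightarrow> ennreal" where
  "holder_seminorm \<alpha> f =
     (SUP (x, y)\<in>{(x, y). x \<noteq> y}. ennreal (\<bar>f x - f y\<bar> / \<bar>x - y\<bar> powr \<alpha>))"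

text \<open>
  \<open>f\<close> is a representative of the (almost everywhere defined) density of \<open>\<mu>\<close>.
\<close>

definition is_lebesgue_density :: "real measure \<Rightarrow> (real \<Rightarrow> real) \<Rightarrow> bool" where
  "is_lebesgue_density \<mu> f \<longleftrightarrow>
     f \<in> borel_measurable borel \<and> (AE x in lborel. 0 \<le> f x) \<and>
     \<mu> = density lborel (\<lambda>x. ennreal (f x))"

text \<open>
  The Hoelder seminorm of the density of \<open>\<mu>\<close>. At most one representative is continuous, so the
  infimum is the seminorm of that representative if it is Hoelder continuous and \<open>\<infinity>\<close> otherwise.
  It is also \<open>\<infinity>\<close> if \<open>\<mu>\<close> has no density.
\<close>

definition density_holder_seminorm :: "real \<Rightarrow> real measure \<Rightarrow> ennreal" where
  "density_holder_seminorm \<alpha> \<mu> = (INF f\<in>{f. is_lebesgue_density \<mu> f}. holder_seminorm \<alpha> f)"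

definition density_in_holder :: "real \<Rightarrow> real measure \<Rightarrow> bool" where
  "density_in_holder \<alpha> \<mu> \<longleftrightarrow> (\<exists>f. is_lebesgue_density \<mu> f \<and> holder_seminorm \<alpha> f < \<infinity>)"

end

theory Submission
  imports Defs "HOL-Complex_Analysis.Complex_Analysis"
begin

text \<open>
  The Dyson equation is a complex Burgers equation in disguise: if \<open>G\<close> is the Cauchy transform
  \<open>G(t,z) = \<integral> u(t)(dy) / (z - y)\<close>, then \<open>\<partial>\<^sub>tG + (1/\<pi>) G \<partial>\<^sub>zG = 0\<close> in the upper half plane. Along
  characteristics \<open>G\<close> is constant, so \<open>G(t,z) = A(w)\<close> where \<open>A\<close> is the Cauchy transform of \<open>u\<^sub>0\<close> and
  \<open>w = subord t z\<close> is the point of the upper half plane with \<open>w + (t/\<pi>) A(w) = z\<close>. (In the language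
  of free probability, \<open>u(t)\<close> is the free convolution of \<open>u\<^sub>0\<close> with a semicircular law.) Existence of
  \<open>w\<close> is Brouwer's theorem, because \<open>Im A < 0\<close> makes \<open>w \<mapsto> z - (t/\<pi>) A(w)\<close> map a compact convex part
  of \<open>{Im w \<ge> Im z}\<close> to itself; uniqueness and smooth dependence come from a Cauchy-Schwarz estimate.

  Translating by \<open>i\<epsilon>\<close> keeps the equation, so \<open>x \<mapsto> G(t, x + i\<epsilon>)\<close> belongs to a smooth solution, whose
  initial value is \<open>u\<^sub>0\<close> convolved with a Cauchy law of width \<open>\<epsilon>\<close>. Its distribution function
  \<open>profile \<epsilon> t\<close> is explicit, as the imaginary part of a logarithmic potential, and it is a classical
  solution of the integrated equation because \<open>(-\<Delta>)\<^sup>1\<^sup>/\<^sup>2\<close> of the boundary value of \<open>Im W\<close>, for \<open>W\<close>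
  holomorphic in the upper half plane, is \<open>- Re W'\<close> (\<open>half_laplacian_boundary_value\<close>).

  The regularity is an estimate of Biane. With \<open>w = subord t (x + i\<epsilon>)\<close> the density of the smooth
  solution is \<open>\<rho> = (Im w - \<epsilon>) / t\<close>, hence \<open>|\<partial>\<^sub>x\<rho>| \<le> 1 / (t |J|)\<close> with \<open>J = \<partial>z/\<partial>w\<close>, and Jensen's inequality
  gives \<open>Re J \<ge> 2\<pi>t\<rho>\<^sup>2\<close>. Therefore \<open>|\<partial>\<^sub>x(\<rho>\<^sup>3)| \<le> 3 / (2\<pi>t\<^sup>2)\<close>: the cube of the density is Lipschitz, so the
  density is \<open>1/3\<close>-Hoelder, uniformly in \<open>\<epsilon>\<close> (\<open>profile_density_cube_lipschitz\<close>).

  It remains to see that the viscosity solution is the limit of these smooth solutions. A small shift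
  in space and a small additive constant put the smooth solution above (or below) the given one at time
  \<open>0\<close>, and the comparison principle \<open>profile_comparison\<close> propagates this order: the smooth
  solution, slightly perturbed into a strict supersolution with controlled behaviour at infinity, is
  an admissible test function, which contradicts the viscosity inequality at a point of contact.
  As \<open>\<epsilon> \<rightarrow> 0\<close> the distribution functions converge and the uniform Hoelder bound passes to the limit, so
  for every \<open>t > 0\<close> the density of \<open>u(t)\<close> has \<open>C\<^sup>1\<^sup>/\<^sup>3\<close> seminorm at most \<open>(3 / (2\<pi>t\<^sup>2))\<^sup>1\<^sup>/\<^sup>3\<close>.
\<close>

section \<open>Functions with bounded derivatives\<close>

lemma bounded_Ck_on_cong:
  assumes "open S" "\<And>x. x \<in> S \<Longrightarrow> f x = g x"
  shows "bounded_Ck_on k S f \<longleftrightarrow> bounded_Ck_on k S g"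
  using assms(2)
proof (induction k arbitrary: f g)
  case 0
  then show ?case by (simp cong: continuous_on_cong image_cong)
next
  case (Suc k)
  have der: "(f has_derivative D) (at x) \<longleftrightarrow> (g has_derivative D) (at x)" if "x \<in> S" for x D
    using has_derivative_transform_within_open[OF _ assms(1) that] Suc.prems by metis
  have "f differentiable (at x) \<longleftrightarrow> g differentiable (at x)" if "x \<in> S" for x
    using der[OF that] by (auto simp: differentiable_def)
  moreover have "frechet_derivative f (at x) = frechet_derivative g (at x)" if "x \<in> S" for x
    using der[OF that] by (simp add: frechet_derivative_def)
  then have "bounded_Ck_on k S (\<lambda>x. frechet_derivative f (at x) v) \<longleftrightarrow>
      bounded_Ck_on k S (\<lambda>x. frechet_derivative g (at x) v)" for v
    by (intro Suc.IH) auto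
  ultimately show ?case
    using Suc.prems by (simp cong: continuous_on_cong image_cong)
qed

text \<open>
  The form in which bounded smoothness is verified below: only the values of the Frechet derivative on
  \<open>S\<close> matter, so an explicit formula may replace it.
\<close>

lemma bounded_Ck_on_SucI:
  assumes "open S" "bounded (f ` S)" "\<And>x. x \<in> S \<Longrightarrow> (f has_derivative f' x) (at x)"
    "\<And>v. bounded_Ck_on k S (\<lambda>x. f' x v)"
  shows "bounded_Ck_on (Suc k) S f"
proof -
  have "continuous_on S f"
    using assms(3) by (blast intro: continuous_at_imp_continuous_on has_derivative_continuous)
  moreover have "bounded_Ck_on k S (\<lambda>x. frechet_derivative f (at x) v)" for v
  proof (subst bounded_Ck_on_cong[OF assms(1)])
    show "frechet_derivative f (at x) v = f' x v" if "x \<in> S" for x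
      using frechet_derivative_at[OF assms(3)[OF that]] by simp
  qed (rule assms(4))
  ultimately show ?thesis
    using assms(2,3) by (auto simp: differentiable_def)
qed

lemma bounded_Ck_on_SucD:
  assumes "bounded_Ck_on (Suc k) S f"
  shows "bounded (f ` S)" "\<And>x. x \<in> S \<Longrightarrow> (f has_derivative frechet_derivative f (at x)) (at x)"
    "\<And>v. bounded_Ck_on k S (\<lambda>x. frechet_derivative f (at x) v)"
  using assms by (auto simp: frechet_derivative_works)

lemma bounded_Ck_on_imp_bounded: "bounded_Ck_on k S f \<Longrightarrow> bounded (f ` S)"
  by (cases k) auto

lemma bounded_Ck_on_decr: "bounded_Ck_on (Suc k) S f \<Longrightarrow> bounded_Ck_on k S f"
  by (induction k arbitrary: f) (auto)

lemma bounded_Ck_on_const: "open S \<Longrightarrow> bounded_Ck_on k S (\<lambda>x. c)"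
proof (induction k arbitrary: c)
  case (Suc k)
  show ?case
    by (rule bounded_Ck_on_SucI[where f' = "\<lambda>_ _. 0"]) (use Suc in \<open>auto simp: image_constant_conv\<close>)
qed (auto simp: image_constant_conv)

lemma bounded_Ck_on_linear_compose:
  assumes "open S" "bounded_linear L"
  shows "bounded_Ck_on k S f \<Longrightarrow> bounded_Ck_on k S (\<lambda>x. L (f x))"
proof (induction k arbitrary: f)
  case 0
  have "bounded (L ` (f ` S))"
    using 0 assms(2) by (intro bounded_linear_image[of "f ` S" L]) auto
  moreover have "continuous_on S (\<lambda>x. L (f x))"
    using 0 by (intro bounded_linear.continuous_on[OF assms(2)]) auto
  ultimately show ?case
    by (simp add: image_image)
next
  case (Suc k)
  note d = bounded_Ck_on_SucD[OF Suc.prems]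
  have "bounded (L ` (f ` S))"
    using d(1) assms(2) by (intro bounded_linear_image[of "f ` S" L]) auto
  then show ?case
    by (intro bounded_Ck_on_SucI[where f' = "\<lambda>x v. L (frechet_derivative f (at x) v)"] assms(1))
      (auto simp: image_image intro!: Suc.IH d bounded_linear.has_derivative[OF assms(2)])
qed

lemma bounded_Ck_on_add:
  assumes "open S"
  shows "bounded_Ck_on k S f \<Longrightarrow> bounded_Ck_on k S g \<Longrightarrow> bounded_Ck_on k S (\<lambda>x. f x + g x)"
proof (induction k arbitrary: f g)
  case 0
  then show ?case
    by (auto intro: continuous_on_add bounded_plus_comp)
next
  case (Suc k)
  note d = bounded_Ck_on_SucD[OF Suc.prems(1)] bounded_Ck_on_SucD[OF Suc.prems(2)]
  show ?case
    by (intro bounded_Ck_on_SucI[where f' = "\<lambda>x v. frechet_derivative f (at x) v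
        + frechet_derivative g (at x) v"] assms(1) bounded_plus_comp d Suc.IH has_derivative_add)
qed

lemma bounded_Ck_on_diff:
  assumes "open S" "bounded_Ck_on k S f" "bounded_Ck_on k S g"
  shows "bounded_Ck_on k S (\<lambda>x. f x - g x)"
  using bounded_Ck_on_add[OF assms(1,2)
      bounded_Ck_on_linear_compose[OF assms(1) bounded_linear_minus[OF bounded_linear_ident] assms(3)]]
  by simp

lemma bounded_mult_image:
  fixes f g :: "'a \<Rightarrow> 'b::real_normed_algebra"
  assumes "bounded (f ` S)" "bounded (g ` S)"
  shows "bounded ((\<lambda>x. f x * g x) ` S)"
proof -
  obtain a b where ab: "\<And>x. x \<in> S \<Longrightarrow> norm (f x) \<le> a" "\<And>x. x \<in> S \<Longrightarrow> norm (g x) \<le> b"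
    using assms by (auto simp: bounded_iff)
  have "norm (f x * g x) \<le> a * b" if "x \<in> S" for x
    by (meson ab that norm_mult_ineq mult_mono norm_ge_zero order_trans)
  then show ?thesis
    by (auto simp: bounded_iff)
qed

lemma bounded_Ck_on_mult:
  fixes f g :: "'a::real_normed_vector \<Rightarrow> 'b::real_normed_algebra"
  assumes "open S"
  shows "bounded_Ck_on k S f \<Longrightarrow> bounded_Ck_on k S g \<Longrightarrow> bounded_Ck_on k S (\<lambda>x. f x * g x)"
proof (induction k arbitrary: f g)
  case 0
  then show ?case
    by (auto intro: continuous_on_mult bounded_mult_image)
next
  case (Suc k)
  note d = bounded_Ck_on_SucD[OF Suc.prems(1)] bounded_Ck_on_SucD[OF Suc.prems(2)]
  show ?case
    by (intro bounded_Ck_on_SucI[where f' = "\<lambda>x v. f x * frechet_derivative g (at x) v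
        + frechet_derivative f (at x) v * g x"] assms(1) bounded_mult_image d Suc.IH
        bounded_Ck_on_add bounded_Ck_on_decr[OF Suc.prems(1)] bounded_Ck_on_decr[OF Suc.prems(2)]
        has_derivative_mult)
qed

lemma bounded_Ck_on_power:
  fixes f :: "'a::real_normed_vector \<Rightarrow> 'b::real_normed_algebra_1"
  assumes "open S" "bounded_Ck_on k S f"
  shows "bounded_Ck_on k S (\<lambda>x. f x ^ n)"
  by (induction n) (auto intro!: bounded_Ck_on_mult bounded_Ck_on_const assms)

text \<open>By the equation every derivative of \<open>f\<close> is a polynomial in \<open>f\<close> with constant coefficients.\<close>

lemma bounded_Ck_on_riccati:
  fixes f :: "'a::real_normed_vector \<Rightarrow> 'b::real_normed_algebra_1"
  assumes "open S" "bounded (f ` S)"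
    "\<And>x. x \<in> S \<Longrightarrow> (f has_derivative (\<lambda>v. L v * (f x)\<^sup>2)) (at x)"
  shows "bounded_Ck_on k S f"
proof (induction k)
  case 0
  then show ?case
    using assms(2,3) by (auto intro!: continuous_at_imp_continuous_on has_derivative_continuous)
next
  case (Suc k)
  show ?case
    by (rule bounded_Ck_on_SucI[OF assms(1,2)])
      (auto intro!: assms(3) bounded_Ck_on_mult bounded_Ck_on_power bounded_Ck_on_const assms(1) Suc)
qed

text \<open>
  The mean value inequality bounds the difference quotients by \<open>C\<close>, which is integrable because the
  measure is finite; dominated convergence does the rest.
\<close>

lemma has_field_derivative_integral_dominated:
  fixes f f' :: "complex \<Rightarrow> 'a \<Rightarrow> complex"
  assumes M: "finite_measure M" and S: "convex S" "open S" "w \<in> S"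
    and int: "\<And>z. z \<in> S \<Longrightarrow> integrable M (f z)"
    and meas: "f' w \<in> borel_measurable M"
    and der: "\<And>z y. z \<in> S \<Longrightarrow> y \<in> space M \<Longrightarrow> ((\<lambda>z. f z y) has_field_derivative f' z y) (at z)"
    and bd: "\<And>z y. z \<in> S \<Longrightarrow> y \<in> space M \<Longrightarrow> norm (f' z y) \<le> C"
  shows "((\<lambda>z. \<integral>y. f z y \<partial>M) has_field_derivative (\<integral>y. f' w y \<partial>M)) (at w)"
proof -
  have lim: "(\<lambda>n. ((\<integral>y. f (X n) y \<partial>M) - (\<integral>y. f w y \<partial>M)) / (X n - w)) \<longlonglongrightarrow> (\<integral>y. f' w y \<partial>M)"
    if X: "X \<longlonglongrightarrow> w" "\<And>n. X n \<in> S" "\<And>n. X n \<noteq> w" for X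
  proof -
    have "(\<lambda>n. \<integral>y. (f (X n) y - f w y) / (X n - w) \<partial>M) \<longlonglongrightarrow> (\<integral>y. f' w y \<partial>M)"
    proof (rule integral_dominated_convergence[where w = "\<lambda>_. C"])
      show "integrable M (\<lambda>_. C)"
        using M by (simp add: finite_measure.integrable_const)
      show "(\<lambda>y. (f (X n) y - f w y) / (X n - w)) \<in> borel_measurable M" for n
        using borel_measurable_integrable[OF int[OF X(2)]] borel_measurable_integrable[OF int[OF S(3)]]
        by auto
      show "AE y in M. (\<lambda>n. (f (X n) y - f w y) / (X n - w)) \<longlonglongrightarrow> f' w y"
      proof (rule AE_I2)
        fix y assume "y \<in> space M"
        have "((\<lambda>z. (f z y - f w y) / (z - w)) \<longlongrightarrow> f' w y) (at w)"
          using der[OF S(3) \<open>y \<in> space M\<close>] by (simp add: has_field_derivative_iff)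
        moreover have "filterlim X (at w) sequentially"
          using X by (auto simp: filterlim_at)
        ultimately show "(\<lambda>n. (f (X n) y - f w y) / (X n - w)) \<longlonglongrightarrow> f' w y"
          by (rule filterlim_compose)
      qed
      show "AE y in M. norm ((f (X n) y - f w y) / (X n - w)) \<le> C" for n
      proof (rule AE_I2)
        fix y assume y: "y \<in> space M"
        have "norm (f (X n) y - f w y) \<le> C * norm (X n - w)"
          by (rule field_differentiable_bound[OF S(1) _ bd])
            (use der S X y in \<open>auto intro: has_field_derivative_at_within\<close>)
        then show "norm ((f (X n) y - f w y) / (X n - w)) \<le> C"
          using X(3)[of n] by (simp add: norm_divide divide_le_eq)
      qed
    qed (use meas in auto)
    moreover have "(\<integral>y. (f (X n) y - f w y) / (X n - w) \<partial>M)
        = ((\<integral>y. f (X n) y \<partial>M) - (\<integral>y. f w y \<partial>M)) / (X n - w)" for n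
      using Bochner_Integration.integral_diff[OF int[OF X(2)] int[OF S(3)]] by simp
    ultimately show ?thesis
      by (simp only:)
  qed
  have "((\<lambda>z. ((\<integral>y. f z y \<partial>M) - (\<integral>y. f w y \<partial>M)) / (z - w)) \<longlongrightarrow> (\<integral>y. f' w y \<partial>M)) (at w within S)"
    unfolding tendsto_at_iff_sequentially comp_def
    using lim by blast
  then show ?thesis
    by (simp add: has_field_derivative_iff at_within_open[OF S(3,2)])
qed

text \<open>
  Upper semicontinuity is spelled out with neighbourhood filters; the maximum is found as the limit of a
  convergent subsequence of a maximising sequence.
\<close>

lemma usc_attains_max:
  fixes f :: "'a::metric_space \<Rightarrow> real"
  assumes "compact Q" "Q \<noteq> {}"
    and usc: "\<And>p e. p \<in> Q \<Longrightarrow> 0 < e \<Longrightarrow> eventually (\<lambda>q. f q < f p + e) (at p within Q)"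
    and bdd: "\<And>p. p \<in> Q \<Longrightarrow> f p \<le> B"
  obtains p where "p \<in> Q" "\<And>q. q \<in> Q \<Longrightarrow> f q \<le> f p"
proof -
  define m where "m = (SUP p\<in>Q. f p)"
  have bd: "bdd_above (f ` Q)" using bdd by (auto simp: bdd_above_def)
  have "\<exists>p\<in>Q. m - 1 / Suc n < f p" for n
  proof -
    have "m - 1 / Suc n < m" by simp
    then show ?thesis
      unfolding m_def using less_cSUP_iff[OF assms(2) bd] by blast
  qed
  then obtain X where X: "\<And>n. X n \<in> Q" "\<And>n. m - 1 / Suc n < f (X n)"
    by metis
  obtain p \<rho> where p: "p \<in> Q" "strict_mono (\<rho> :: nat \<Rightarrow> nat)" "(X \<circ> \<rho>) \<longlonglongrightarrow> p"
    using assms(1) X(1) unfolding compact_def by blast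
  have "m \<le> f p + e" if "0 < e" for e
  proof -
    have "eventually (\<lambda>q. q \<in> Q \<longrightarrow> f q < f p + e) (nhds p)"
      using usc[OF p(1) that] unfolding eventually_at_filter
      by eventually_elim (use that in auto)
    then have "eventually (\<lambda>n. f (X (\<rho> n)) < f p + e) sequentially"
      using p(3) X(1) by (auto simp: filterlim_iff elim: eventually_mono)
    moreover have "eventually (\<lambda>n. m - 1 / Suc n < f (X (\<rho> n))) sequentially"
    proof (rule always_eventually, rule allI)
      fix n
      have "m - 1 / Suc n \<le> m - 1 / Suc (\<rho> n)"
        using seq_suble[OF p(2), of n] by (simp add: field_simps)
      then show "m - 1 / Suc n < f (X (\<rho> n))"
        using X(2)[of "\<rho> n"] by linarith
    qed
    ultimately have "eventually (\<lambda>n. m - 1 / Suc n \<le> f p + e) sequentially"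
      by eventually_elim linarith
    moreover have "(\<lambda>n. m - 1 / Suc n) \<longlonglongrightarrow> m - 0"
      by (intro tendsto_intros LIMSEQ_Suc[OF lim_1_over_n])
    ultimately show ?thesis
      using tendsto_upperbound[of "\<lambda>n. m - 1 / Suc n" m sequentially] by auto
  qed
  then have "m \<le> f p" by (rule field_le_epsilon)
  then show ?thesis
    using that[OF p(1)] cSUP_upper[OF _ bd] m_def by fastforce
qed

section \<open>The half-Laplacian of a harmonic boundary value\<close>

lemma integrable_one_over_one_plus_square:
  "integrable lborel (\<lambda>y::real. 1 / (1 + (y - x)\<^sup>2))"
proof -
  have "integrable lborel (\<lambda>y::real. 1 / (1 + y\<^sup>2))"
    using integrable_inverse_1_plus_square
    by (simp add: set_integrable_def einterval_def inverse_eq_divide)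
  from lborel_integrable_real_affine[OF this, of 1 "-x"] show ?thesis
    by (simp add: algebra_simps)
qed

text \<open>
  The half-Laplacian is \<open>H \<circ> \<partial>\<^sub>x\<close>, and the Hilbert transform turns the imaginary part of the boundary
  value of \<open>W'\<close> into minus its real part. For the proof, subtract from \<open>W\<close> the multiple
  \<open>W'(x) q\<close> of \<open>q(z) = i(z - x) / (z - x + i)\<close>, which vanishes to first order at \<open>x\<close> with slope \<open>1\<close>. The
  rest, divided by \<open>(z - x)\<^sup>2\<close>, is a holomorphic function \<open>h\<close> whose integrals over large half circles
  tend to \<open>0\<close>, so that its principal value integral over the line vanishes by Cauchy's theorem. The
  contribution of \<open>q\<close> is elementary: on the line \<open>q(x + s) / s\<^sup>2\<close> is the sum of an odd function and
  \<open>i / (1 + s\<^sup>2)\<close>. All integrals are evaluated with the primitive \<open>T\<close>.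
\<close>

lemma half_laplacian_boundary_value:
  fixes W :: "complex \<Rightarrow> complex"
  assumes e: "0 < e" and hol: "W holomorphic_on {z. - e < Im z}"
    and grow: "\<And>z. 0 \<le> Im z \<Longrightarrow> norm (W z) \<le> C * (1 + sqrt (norm z))"
    and bdd: "\<And>y. \<bar>Im (W (of_real y))\<bar> \<le> B"
  shows "half_laplacian (\<lambda>y. Im (W (of_real y))) x = - Re (deriv W (of_real x))"
proof -
  define \<psi> where "\<psi> y = Im (W (of_real y))" for y
  define a where "a = complex_of_real x"
  define d where "d = deriv W a"
  define S where "S = {z. - min e 1 < Im z}"
  have oS: "open S" and cS: "convex S"
    unfolding S_def by (auto intro: open_halfspace_Im_gt convex_halfspace_Im_gt)
  have aS: "of_real y \<in> S" for y using e by (auto simp: S_def)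
  have up: "z \<in> S" if "0 \<le> Im z" for z using e that by (auto simp: S_def)
  have holW: "W holomorphic_on S"
    by (rule holomorphic_on_subset[OF hol]) (auto simp: S_def)
  \<comment> \<open>The domain \<open>S\<close> stays above the pole \<open>a - \<i>\<close> of \<open>q\<close>.\<close>
  define q where "q z = \<i> * (z - a) / (z - a + \<i>)" for z
  have nz: "z - a + \<i> \<noteq> 0" if "z \<in> S" for z
    using that by (auto simp: S_def a_def complex_eq_iff)
  define f1 where "f1 z = W z - d * q z" for z
  have hol1: "f1 holomorphic_on S"
    unfolding f1_def q_def by (intro holomorphic_intros holW) (use nz in auto)
  have f1a: "f1 a = W a" by (simp add: f1_def q_def)
  have dW: "(W has_field_derivative d) (at a)"
    unfolding d_def using holomorphic_derivI[OF holW oS] aS a_def by simp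
  have "(q has_field_derivative 1) (at a)"
    unfolding q_def by (auto intro!: derivative_eq_intros simp: field_simps power2_eq_square)
  then have "(f1 has_field_derivative d - d * 1) (at a)"
    unfolding f1_def by (intro derivative_intros dW) (auto intro!: derivative_eq_intros)
  then have df1: "deriv f1 a = 0" by (auto dest: DERIV_imp_deriv)
  define f2 where "f2 z = (if z = a then deriv f1 a else (f1 z - f1 a) / (z - a))" for z
  have hol2: "f2 holomorphic_on S"
    unfolding f2_def by (rule pole_lemma_open[OF hol1 oS])
  define h where "h z = (if z = a then deriv f2 a else (f2 z - f2 a) / (z - a))" for z
  have holh: "h holomorphic_on S"
    unfolding h_def by (rule pole_lemma_open[OF hol2 oS])
  have h_eq: "h z = (W z - W a - d * q z) / (z - a)\<^sup>2" if "z \<noteq> a" for z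
    using that by (simp add: h_def f2_def df1 f1a power2_eq_square) (simp add: f1_def algebra_simps)
  obtain P where P0: "\<And>z. z \<in> S \<Longrightarrow> (P has_field_derivative h z) (at z within S)"
    using holomorphic_convex_primitive'[OF cS oS holh] by blast
  then have P: "(P has_field_derivative h z) (at z)" if "z \<in> S" for z
    using that oS by (metis at_within_open)
  define p where "p y = Im (P (of_real y))" for y
  have arc: "norm (P (of_real (x + R)) - P (of_real (x - R)))
      \<le> pi * (\<bar>C\<bar> * (1 + sqrt (\<bar>x\<bar> + R)) + norm (W a) + norm d) / R" if R: "0 < R" for R
  proof -
    define g where "g = part_circlepath a R 0 pi"
    define K where "K = \<bar>C\<bar> * (1 + sqrt (\<bar>x\<bar> + R)) + norm (W a) + norm d"
    have pi_g: "Im z \<ge> 0 \<and> norm (z - a) = R" if z: "z \<in> path_image g" for z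
    proof -
      obtain \<theta> where th: "0 \<le> \<theta>" "\<theta> \<le> pi" "z = a + of_real R * exp (\<i> * of_real \<theta>)"
        using z R by (auto simp: g_def path_image_part_circlepath)
      have "Im z = R * sin \<theta>" by (simp add: th(3) a_def Im_exp)
      then show ?thesis
        using R th sin_ge_zero[of \<theta>] by (simp add: th(3) norm_mult)
    qed
    have ci: "(h has_contour_integral (P (pathfinish g) - P (pathstart g))) g"
      by (rule contour_integral_primitive[OF P0]) (use pi_g up in \<open>auto simp: g_def\<close>)
    have "norm (P (pathfinish g) - P (pathstart g)) \<le> (K / R\<^sup>2) * R * (pi - 0)"
      unfolding g_def
    proof (rule has_contour_integral_bound_part_circlepath[OF ci[unfolded g_def] _ R])
      show "0 \<le> K / R\<^sup>2" using R by (auto simp: K_def)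
      fix z assume "z \<in> path_image (part_circlepath a R 0 pi)"
      then have z: "Im z \<ge> 0" "norm (z - a) = R" using pi_g by (auto simp: g_def)
      then have "z \<noteq> a" using R by auto
      have "norm z \<le> \<bar>x\<bar> + R"
        using norm_triangle_ineq[of a "z - a"] z by (simp add: a_def)
      then have "C * (1 + sqrt (norm z)) \<le> \<bar>C\<bar> * (1 + sqrt (\<bar>x\<bar> + R))"
        by (intro mult_mono) auto
      then have 1: "norm (W z) \<le> \<bar>C\<bar> * (1 + sqrt (\<bar>x\<bar> + R))"
        using grow[OF z(1)] by linarith
      have "norm (z - a) \<le> norm (z - a + \<i>)"
        using z(1) by (auto simp: cmod_def a_def power2_eq_square algebra_simps)
      then have "norm (q z) \<le> 1"
        using nz[OF up[OF z(1)]] by (simp add: q_def norm_divide norm_mult)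
      then have "norm d * norm (q z) \<le> norm d * 1"
        by (intro mult_left_mono) auto
      then have "norm (W z - W a - d * q z) \<le> K"
        using norm_triangle_ineq4[of "W z - W a" "d * q z"] norm_triangle_ineq4[of "W z" "W a"] 1
        by (simp add: K_def norm_mult)
      then show "norm (h z) \<le> K / R\<^sup>2"
        using z(2) by (simp add: h_eq[OF \<open>z \<noteq> a\<close>] norm_divide norm_power divide_right_mono)
    qed simp
    moreover have "pathfinish g = of_real (x - R)" "pathstart g = of_real (x + R)"
      by (simp_all add: g_def a_def exp_eq_polar)
    moreover have "K / R\<^sup>2 * R * (pi - 0) = pi * K / R"
      using R by (simp add: power2_eq_square)
    ultimately show ?thesis
      unfolding K_def by (simp only: norm_minus_commute)
  qed
  have "(\<lambda>n. pi * (\<bar>C\<bar> * (1 + sqrt (\<bar>x\<bar> + real n)) + norm (W a) + norm d) / real n) \<longlonglongrightarrow> 0"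
    by real_asymp
  then have "(\<lambda>n. P (of_real (x + real n)) - P (of_real (x - real n))) \<longlonglongrightarrow> 0"
  proof (rule Lim_null_comparison[rotated], intro eventually_mono[OF eventually_gt_at_top[of 0]])
    fix n :: nat assume "0 < n"
    then show "norm (P (of_real (x + real n)) - P (of_real (x - real n)))
        \<le> pi * (\<bar>C\<bar> * (1 + sqrt (\<bar>x\<bar> + real n)) + norm (W a) + norm d) / real n"
      by (intro arc) simp
  qed
  from tendsto_Im[OF this]
  have p_lim: "(\<lambda>n. p (x + real n) - p (x - real n)) \<longlonglongrightarrow> 0"
    by (simp add: p_def)
  define g where "g y = (\<psi> x - \<psi> y) / (x - y)\<^sup>2" for y
  \<comment> \<open>A primitive of \<open>g\<close> away from \<open>x\<close>; its logarithmic part is even about \<open>x\<close> and cancels in \<open>T_sym\<close>.\<close>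
  define T where "T y = - p y - Re d * arctan (y - x)
      - Im d * ((ln ((y - x)\<^sup>2) - ln (1 + (y - x)\<^sup>2)) / 2)" for y
  have T: "(T has_real_derivative g y) (at y)" if "y \<noteq> x" for y
  proof -
    have s0: "(y - x)\<^sup>2 > 0" "1 + (y - x)\<^sup>2 > 0" using that by (auto simp: add_pos_nonneg)
    have "((\<lambda>y. P (of_real y)) has_vector_derivative h (of_real y)) (at y)"
      using P[OF aS] by (rule has_vector_derivative_real_field)
    then have dp: "(p has_real_derivative Im (h (of_real y))) (at y)"
      unfolding p_def by (rule has_field_derivative_Im)
    have "Im (h (of_real y)) =
        - g y - Re d / (1 + (y - x)\<^sup>2) - Im d * (1 / (y - x) - (y - x) / (1 + (y - x)\<^sup>2))"
    proof -
      define s where "s = y - x"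
      have s: "s \<noteq> 0" using that by (simp add: s_def)
      have si: "complex_of_real s + \<i> \<noteq> 0" by (auto simp: complex_eq_iff)
      have ya: "complex_of_real y - a = of_real s" "complex_of_real y \<noteq> a"
        using that by (auto simp: a_def s_def)
      have "\<i> * of_real s / (of_real s + \<i>) = of_real (s / (1 + s\<^sup>2)) + \<i> * of_real (s\<^sup>2 / (1 + s\<^sup>2))"
      proof -
        have "1 + s\<^sup>2 > 0" by (simp add: add_pos_nonneg)
        then have "s / (1 + s\<^sup>2) + s\<^sup>2 / (1 + s\<^sup>2) * s = s"
          unfolding times_divide_eq_left add_divide_distrib[symmetric]
          by (simp add: divide_eq_eq algebra_simps)
        then show ?thesis
          unfolding nonzero_divide_eq_eq[OF si]
          by (intro complex_eqI) (simp_all add: power2_eq_square algebra_simps)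
      qed
      then have "h (of_real y) = (W (of_real y) - W a - d * (of_real (s / (1 + s\<^sup>2)) + \<i> * of_real (s\<^sup>2 / (1 + s\<^sup>2)))) / of_real (s\<^sup>2)"
        using h_eq[OF ya(2)] by (simp add: q_def ya)
      then have "Im (h (of_real y)) = (\<psi> y - \<psi> x - (Im d * (s / (1 + s\<^sup>2)) + Re d * (s\<^sup>2 / (1 + s\<^sup>2)))) / s\<^sup>2"
        by (simp only: Im_divide_of_real) (simp add: \<psi>_def a_def)
      also have "\<dots> = - g y - Re d / (1 + s\<^sup>2) - Im d * (1 / s - s / (1 + s\<^sup>2))"
      proof -
        have "1 + s\<^sup>2 \<noteq> 0" using s0 s_def by simp
        moreover have "g y = (\<psi> x - \<psi> y) / s\<^sup>2"
          by (simp add: g_def s_def power2_commute)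
        ultimately show ?thesis
          using s by (simp add: divide_simps) algebra
      qed
      finally show ?thesis by (simp add: s_def)
    qed
    have darctan: "((\<lambda>y. arctan (y - x)) has_real_derivative 1 / (1 + (y - x)\<^sup>2)) (at y)"
      by (auto intro!: derivative_eq_intros simp: inverse_eq_divide)
    have "((\<lambda>s. (ln (s\<^sup>2) - ln (1 + s\<^sup>2)) / 2) has_real_derivative 1 / s - s / (1 + s\<^sup>2)) (at s)"
      if "s \<noteq> 0" for s :: real
    proof -
      have pos: "1 + s\<^sup>2 > 0" "s\<^sup>2 > 0" using zero_le_power2[of s] that by (linarith, simp)
      have "((\<lambda>s. ln (s\<^sup>2)) has_real_derivative 1 / s\<^sup>2 * (2 * s)) (at s)"
        by (rule DERIV_chain2[where f = ln and g = "\<lambda>s. s\<^sup>2" and x = s, OF DERIV_ln_divide[OF pos(2)]]) (auto intro!: derivative_eq_intros)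
      moreover have "((\<lambda>s. ln (1 + s\<^sup>2)) has_real_derivative 1 / (1 + s\<^sup>2) * (2 * s)) (at s)"
        by (rule DERIV_chain2[where f = ln and g = "\<lambda>s. 1 + s\<^sup>2" and x = s, OF DERIV_ln_divide[OF pos(1)]]) (auto intro!: derivative_eq_intros)
      ultimately have "((\<lambda>s. (ln (s\<^sup>2) - ln (1 + s\<^sup>2)) / 2) has_real_derivative
          (1 / s\<^sup>2 * (2 * s) - 1 / (1 + s\<^sup>2) * (2 * s)) / 2) (at s)"
        by (intro DERIV_diff DERIV_cdivide)
      moreover have "(1 / s\<^sup>2 * (2 * s) - 1 / (1 + s\<^sup>2) * (2 * s)) / 2 = 1 / s - s / (1 + s\<^sup>2)"
      proof -
        have "1 / s\<^sup>2 * (2 * s) = 2 * (1 / s)" using that by (simp add: power2_eq_square)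
        moreover have "1 / (1 + s\<^sup>2) * (2 * s) = 2 * (s / (1 + s\<^sup>2))" by simp
        moreover have "(2 * a - 2 * b) / 2 = a - b" for a b :: real by simp
        ultimately show ?thesis by (simp only:)
      qed
      ultimately show ?thesis
        by (simp only:)
    qed
    from this[of "y - x"]
    have "((\<lambda>s. (ln (s\<^sup>2) - ln (1 + s\<^sup>2)) / 2) has_real_derivative
        1 / (y - x) - (y - x) / (1 + (y - x)\<^sup>2)) (at (y - x))"
      using that by simp
    moreover have "((\<lambda>y. y - x) has_real_derivative 1) (at y)"
      by (auto intro!: derivative_eq_intros)
    ultimately have "((\<lambda>y. (ln ((y - x)\<^sup>2) - ln (1 + (y - x)\<^sup>2)) / 2) has_real_derivative
        (1 / (y - x) - (y - x) / (1 + (y - x)\<^sup>2)) * 1) (at y)"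
      by (rule DERIV_chain2[where g = "\<lambda>y. y - x" and x = y])
    note dln = this[unfolded mult_1_right]
    have "(T has_real_derivative - Im (h (of_real y)) - Re d * (1 / (1 + (y - x)\<^sup>2))
        - Im d * (1 / (y - x) - (y - x) / (1 + (y - x)\<^sup>2))) (at y)"
      unfolding T_def by (intro DERIV_diff DERIV_cmult DERIV_minus dp darctan dln)
    then show ?thesis
      using \<open>Im (h (of_real y)) = _\<close> by simp
  qed
  have g_meas: "g \<in> borel_measurable borel"
  proof -
    have "continuous_on UNIV \<psi>"
      unfolding \<psi>_def
      by (intro continuous_on_Im continuous_on_compose2[OF holomorphic_on_imp_continuous_on[OF holW]]
          continuous_intros) (use aS in auto)
    then have [measurable]: "\<psi> \<in> borel_measurable borel"
      by (rule borel_measurable_continuous_onI)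
    show ?thesis unfolding g_def by measurable
  qed
  define A where "A \<delta> = {y. \<delta> < \<bar>x - y\<bar>}" for \<delta>
  have g_int: "set_integrable lborel (A \<delta>) g" if "0 < \<delta>" for \<delta>
    unfolding set_integrable_def
  proof (rule Bochner_Integration.integrable_bound)
    show "integrable lborel (\<lambda>y. 2 * B * (1 + 1 / \<delta>\<^sup>2) * (1 / (1 + (y - x)\<^sup>2)))"
      by (intro integrable_mult_right integrable_one_over_one_plus_square)
    have "A \<delta> \<in> sets borel" unfolding A_def by measurable
    then show "(\<lambda>y. indicat_real (A \<delta>) y *\<^sub>R g y) \<in> borel_measurable lborel"
      using g_meas by simp
    have "0 \<le> B" using bdd[of 0] by linarith
    have "norm (g y) \<le> 2 * B * (1 + 1 / \<delta>\<^sup>2) * (1 / (1 + (y - x)\<^sup>2))" if y: "\<delta> < \<bar>x - y\<bar>" for y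
    proof -
      have "\<delta>\<^sup>2 < (x - y)\<^sup>2" using y \<open>0 < \<delta>\<close> by (metis abs_le_square_iff abs_of_pos not_less)
      then have "1 / (x - y)\<^sup>2 \<le> (1 + 1 / \<delta>\<^sup>2) * (1 / (1 + (y - x)\<^sup>2))"
        using \<open>0 < \<delta>\<close> by (simp add: divide_simps power2_commute[of y x] add_pos_nonneg) (simp add: algebra_simps)
      moreover have "\<bar>\<psi> x - \<psi> y\<bar> \<le> 2 * B"
        using bdd[of x] bdd[of y] by (simp add: \<psi>_def)
      ultimately have "\<bar>\<psi> x - \<psi> y\<bar> * (1 / (x - y)\<^sup>2) \<le> 2 * B * ((1 + 1 / \<delta>\<^sup>2) * (1 / (1 + (y - x)\<^sup>2)))"
        by (intro mult_mono) auto
      then show ?thesis by (simp add: g_def abs_mult)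
    qed
    then show "AE y in lborel. norm (indicat_real (A \<delta>) y *\<^sub>R g y) \<le> norm (2 * B * (1 + 1 / \<delta>\<^sup>2) * (1 / (1 + (y - x)\<^sup>2)))"
      using \<open>0 \<le> B\<close> by (intro AE_I2) (auto simp: A_def indicator_def intro: order_trans[OF _ abs_ge_self])
  qed
  have T_sym: "T (x + r) - T (x - r) = - (p (x + r) - p (x - r)) - 2 * Re d * arctan r" for r
    by (simp add: T_def arctan_minus)
  have I: "(LBINT y:A \<delta>. g y) = - pi * Re d - (T (x + \<delta>) - T (x - \<delta>))" if \<delta>: "0 < \<delta>" for \<delta>
  proof -
    define E where "E n = A \<delta> \<inter> {y. \<bar>x - y\<bar> \<le> real n}" for n
    have UE: "(\<Union>n. E n) = A \<delta>"
      by (auto simp: E_def intro: real_arch_simple)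
    have E_lim: "(\<lambda>n. LBINT y:E n. g y) \<longlonglongrightarrow> (LBINT y:(\<Union>n. E n). g y)"
    proof (rule set_integral_cont_up)
      show "E n \<in> sets lborel" for n
        unfolding E_def A_def by measurable
      show "incseq E" by (auto simp: E_def incseq_def)
    qed (use g_int[OF \<delta>] UE in simp)
    have "(LBINT y:E n. g y) = (T (x + real n) - T (x - real n)) - (T (x + \<delta>) - T (x - \<delta>))"
      if n: "\<delta> < real n" for n
    proof -
      have "set_integrable lborel (E n) g"
        by (rule set_integrable_subset[OF g_int[OF \<delta>]]) (auto simp: E_def A_def)
      then have "(LBINT y:E n. g y) = integral (E n) g"
        by (rule set_borel_integral_eq_integral)
      moreover have "(g has_integral (T (x + real n) - T (x + \<delta>))) {x + \<delta>..x + real n}"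
        by (rule fundamental_theorem_of_calculus)
          (use n \<delta> in \<open>auto intro!: has_field_derivative_at_within[OF T]
            simp flip: has_real_derivative_iff_has_vector_derivative\<close>)
      moreover have "(g has_integral (T (x - \<delta>) - T (x - real n))) {x - real n..x - \<delta>}"
        by (rule fundamental_theorem_of_calculus)
          (use n \<delta> in \<open>auto intro!: has_field_derivative_at_within[OF T]
            simp flip: has_real_derivative_iff_has_vector_derivative\<close>)
      ultimately have "(g has_integral (T (x + real n) - T (x + \<delta>) + (T (x - \<delta>) - T (x - real n))))
         ({x + \<delta>..x + real n} \<union> {x - real n..x - \<delta>})"
        by (intro has_integral_Un) (use \<delta> in auto)
      then have "(g has_integral (T (x + real n) - T (x + \<delta>) + (T (x - \<delta>) - T (x - real n)))) (E n)"
        by (subst (asm) has_integral_spike_set_eq[of _ "E n"])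
          (rule negligible_subset[of "{x + \<delta>, x - \<delta>}"], use \<delta> n in \<open>auto simp: E_def A_def\<close>)+
      then show ?thesis
        using \<open>(LBINT y:E n. g y) = integral (E n) g\<close> by (simp add: integral_unique)
    qed
    then have "eventually (\<lambda>n. (LBINT y:E n. g y) = (T (x + real n) - T (x - real n)) - (T (x + \<delta>) - T (x - \<delta>))) sequentially"
      by (metis (mono_tags, lifting) eventually_sequentially reals_Archimedean2 of_nat_le_iff order_less_le_trans)
    moreover have "(\<lambda>n. (T (x + real n) - T (x - real n)) - (T (x + \<delta>) - T (x - \<delta>)))
        \<longlonglongrightarrow> (- 0 - 2 * Re d * (pi / 2)) - (T (x + \<delta>) - T (x - \<delta>))"
      unfolding T_sym
      by (intro tendsto_intros p_lim filterlim_compose[OF tendsto_arctan_at_top filterlim_real_sequentially])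
    ultimately have "(\<lambda>n. LBINT y:E n. g y) \<longlonglongrightarrow> (- 0 - 2 * Re d * (pi / 2)) - (T (x + \<delta>) - T (x - \<delta>))"
      by (simp add: tendsto_cong)
    with E_lim have "(LBINT y:(\<Union>n. E n). g y) = (- 0 - 2 * Re d * (pi / 2)) - (T (x + \<delta>) - T (x - \<delta>))"
      by (rule LIMSEQ_unique)
    then show ?thesis
      by (simp add: UE)
  qed
  have "continuous (at a) P"
    using P aS a_def by (metis DERIV_isCont)
  then have "isCont p x"
    unfolding p_def a_def
    by (intro isCont_Im isCont_o2[where f = of_real and g = P] isCont_of_real continuous_ident)
  then have "((\<lambda>\<delta>. p (x + \<delta>)) \<longlongrightarrow> p x) (at_right 0)" "((\<lambda>\<delta>. p (x - \<delta>)) \<longlongrightarrow> p x) (at_right 0)"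
    by (auto intro!: isCont_tendsto_compose[of x p] tendsto_eq_intros)
  then have "((\<lambda>\<delta>. - pi * Re d - (- (p (x + \<delta>) - p (x - \<delta>)) - 2 * Re d * arctan \<delta>))
      \<longlongrightarrow> - pi * Re d - (- (p x - p x) - 2 * Re d * arctan 0)) (at_right 0)"
    by (intro tendsto_intros)
  then have "((\<lambda>\<delta>. LBINT y:A \<delta>. g y) \<longlongrightarrow>
      - pi * Re d - (- (p x - p x) - 2 * Re d * arctan 0)) (at_right 0)"
    by (rule Lim_transform_eventually) (auto simp: eventually_at_filter I T_sym)
  then have "Lim (at_right 0) (\<lambda>\<delta>. LBINT y:A \<delta>. g y) = - pi * Re d - (- (p x - p x) - 2 * Re d * arctan 0)"
    by (intro tendsto_Lim) auto
  then show ?thesis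
    by (simp add: half_laplacian_def A_def g_def \<psi>_def d_def a_def)
qed

section \<open>Cauchy transforms in the upper half plane\<close>

definition cauchy_power :: "real measure \<Rightarrow> nat \<Rightarrow> complex \<Rightarrow> complex" where
  "cauchy_power M k w = (\<integral>y. inverse (w - of_real y) ^ k \<partial>M)"

text \<open>
  By \<open>Im_cauchy_power_1\<close> below this is \<open>- Im (cauchy_power M 1 w) / Im w\<close>.
\<close>

definition inv_dist_square :: "real measure \<Rightarrow> complex \<Rightarrow> real" where
  "inv_dist_square M w = (\<integral>y. inverse (norm (w - of_real y)) ^ 2 \<partial>M)"

locale upper_half_transforms = real_distribution M for M
begin

abbreviation A :: "nat \<Rightarrow> complex \<Rightarrow> complex" where "A \<equiv> cauchy_power M"
abbreviation N :: "complex \<Rightarrow> real" where "N \<equiv> inv_dist_square M"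

lemma borel_meas: "f \<in> borel_measurable borel \<Longrightarrow> f \<in> borel_measurable M"
  by (simp cong: measurable_cong_sets)

lemma norm_inverse_le:
  assumes "0 < Im w"
  shows "norm (inverse (w - complex_of_real y)) \<le> inverse (Im w)"
proof -
  have "Im w \<le> norm (w - complex_of_real y)"
    using abs_Im_le_cmod[of "w - of_real y"] by simp
  then show ?thesis
    using assms by (simp add: norm_inverse le_imp_inverse_le)
qed

lemma diff_ne: "0 < Im w \<Longrightarrow> w - complex_of_real y \<noteq> 0"
  by (auto simp: complex_eq_iff)

lemma integrable_bounded_borel:
  fixes f :: "real \<Rightarrow> 'b::{banach, second_countable_topology}"
  assumes "f \<in> borel_measurable borel" "\<And>y. norm (f y) \<le> B"
  shows "integrable M f"
  by (rule integrable_const_bound[where B = B]) (use assms in \<open>auto intro: borel_meas\<close>)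

lemma integrable_cauchy_power:
  assumes "0 < Im w"
  shows "integrable M (\<lambda>y. inverse (w - complex_of_real y) ^ k)"
  by (rule integrable_bounded_borel[where B = "inverse (Im w) ^ k"])
    (use norm_inverse_le[OF assms] in \<open>auto simp: norm_power intro!: power_mono\<close>)

lemma prob_UNIV [simp]: "prob UNIV = 1"
  using prob_space by simp

lemma norm_integral_le:
  fixes f :: "real \<Rightarrow> 'b::{banach, second_countable_topology}"
  assumes "\<And>y. norm (f y) \<le> B"
  shows "norm (\<integral>y. f y \<partial>M) \<le> B"
proof (cases "integrable M f")
  case True
  have "norm (\<integral>y. f y \<partial>M) \<le> (\<integral>y. norm (f y) \<partial>M)" by (rule integral_norm_bound)
  also have "\<dots> \<le> (\<integral>y. B \<partial>M)" by (rule integral_mono) (use True assms in auto)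
  finally show ?thesis by (simp add: prob_space)
next
  case False
  then show ?thesis using order_trans[OF norm_ge_zero assms] by (simp add: not_integrable_integral_eq)
qed

lemma norm_cauchy_power_le: "0 < Im w \<Longrightarrow> norm (A k w) \<le> inverse (Im w) ^ k"
  unfolding cauchy_power_def
  by (rule norm_integral_le) (auto simp: norm_power intro!: power_mono norm_inverse_le)

lemma has_field_derivative_cauchy_power:
  assumes "0 < Im w"
  shows "(A k has_field_derivative - of_nat k * A (Suc k) w) (at w)"
proof -
  define S where "S = {z. Im w / 2 < Im z}"
  have "((\<lambda>z. \<integral>y. inverse (z - complex_of_real y) ^ k \<partial>M) has_field_derivative
      (\<integral>y. - of_nat k * inverse (w - complex_of_real y) ^ Suc k \<partial>M)) (at w)"
  proof (rule has_field_derivative_integral_dominated[where S = S and C = "real k * inverse (Im w / 2) ^ Suc k"])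
    show "finite_measure M" by (rule finite_measure_axioms)
    show "convex S" unfolding S_def by (rule convex_halfspace_Im_gt)
    show "open S" unfolding S_def by (rule open_halfspace_Im_gt)
    show "w \<in> S" using assms by (simp add: S_def)
    fix z y assume "z \<in> S"
    then have z: "0 < Im z" "Im w / 2 \<le> Im z" using assms by (auto simp: S_def)
    show "integrable M (\<lambda>y. inverse (z - complex_of_real y) ^ k)"
      by (rule integrable_cauchy_power[OF z(1)])
    have "((\<lambda>z. inverse (z - complex_of_real y)) has_field_derivative - (inverse (z - complex_of_real y))\<^sup>2) (at z)"
      using diff_ne[OF z(1), of y] by (auto intro!: derivative_eq_intros simp: power2_eq_square)
    from DERIV_power[OF this, of k]
    have "((\<lambda>z. inverse (z - complex_of_real y) ^ k) has_field_derivative of_nat k *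
        (- (inverse (z - complex_of_real y))\<^sup>2 * inverse (z - complex_of_real y) ^ (k - Suc 0))) (at z)" .
    moreover have "of_nat k * (- (inverse (z - complex_of_real y))\<^sup>2 * inverse (z - complex_of_real y) ^ (k - Suc 0))
        = - of_nat k * inverse (z - complex_of_real y) ^ Suc k"
      by (cases k) (simp_all add: power2_eq_square algebra_simps)
    ultimately show "((\<lambda>z. inverse (z - complex_of_real y) ^ k) has_field_derivative
        - of_nat k * inverse (z - complex_of_real y) ^ Suc k) (at z)"
      by (simp only:)
    have "norm (inverse (z - complex_of_real y)) \<le> inverse (Im w / 2)"
      using norm_inverse_le[OF z(1), of y] le_imp_inverse_le[OF z(2)] assms by linarith
    then have "norm (inverse (z - complex_of_real y)) ^ Suc k \<le> inverse (Im w / 2) ^ Suc k"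
      by (intro power_mono) auto
    then show "norm (- of_nat k * inverse (z - complex_of_real y) ^ Suc k) \<le> real k * inverse (Im w / 2) ^ Suc k"
      by (simp only: norm_mult norm_power norm_minus_cancel norm_of_nat) (intro mult_left_mono, auto)
  qed (auto intro!: borel_meas)
  moreover have "(\<integral>y. - of_nat k * inverse (w - complex_of_real y) ^ Suc k \<partial>M) = - of_nat k * A (Suc k) w"
    unfolding cauchy_power_def by (rule integral_mult_right_zero)
  ultimately show ?thesis
    by (simp add: cauchy_power_def[abs_def])
qed

lemma integrable_inv_dist_square:
  assumes "0 < Im w"
  shows "integrable M (\<lambda>y. inverse (norm (w - complex_of_real y)) ^ 2)"
  using integrable_norm[OF integrable_cauchy_power[OF assms, of 2]]
  by (simp add: norm_power norm_inverse)

lemma inv_dist_square_nonneg: "0 \<le> N w"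
  unfolding inv_dist_square_def by (rule Bochner_Integration.integral_nonneg) auto

lemma Im_cauchy_power_1:
  assumes "0 < Im w"
  shows "Im (A 1 w) = - Im w * N w"
proof -
  have *: "Im (inverse (w - complex_of_real y)) = - Im w * (inverse (norm (w - complex_of_real y)))\<^sup>2" for y
    by (simp add: Im_inverse cmod_power2 power_inverse divide_inverse)
  have "Im (A 1 w) = (\<integral>y. Im (inverse (w - complex_of_real y)) \<partial>M)"
    unfolding cauchy_power_def
    using integral_Im[OF integrable_cauchy_power[OF assms, of 1]] by (simp only: power_one_right)
  then show ?thesis
    unfolding * inv_dist_square_def by simp
qed

lemma norm_cauchy_power_2_le: "norm (A 2 w) \<le> N w"
proof -
  have "norm (A 2 w) \<le> (\<integral>y. norm (inverse (w - complex_of_real y) ^ 2) \<partial>M)"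
    unfolding cauchy_power_def by (rule integral_norm_bound)
  then show ?thesis
    by (simp add: inv_dist_square_def norm_power norm_inverse)
qed

text \<open>Up to sign the difference quotient of \<open>A 1\<close>, see \<open>cauchy_power_1_diff\<close>.\<close>

definition Q where "Q w w' = (\<integral>y. inverse (w - complex_of_real y) * inverse (w' - complex_of_real y) \<partial>M)"

lemma integrable_Q:
  assumes "0 < Im w" "0 < Im w'"
  shows "integrable M (\<lambda>y. inverse (w - complex_of_real y) * inverse (w' - complex_of_real y))"
  by (rule integrable_bounded_borel[where B = "inverse (Im w) * inverse (Im w')"])
    (use assms in \<open>auto simp: norm_mult intro!: mult_mono norm_inverse_le\<close>)

lemma cauchy_power_1_diff:
  assumes "0 < Im w" "0 < Im w'"
  shows "A 1 w' - A 1 w = - (w' - w) * Q w w'"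
proof -
  have "A 1 w' - A 1 w = (\<integral>y. inverse (w' - complex_of_real y) - inverse (w - complex_of_real y) \<partial>M)"
    unfolding cauchy_power_def
    using integrable_cauchy_power[OF assms(1), of 1] integrable_cauchy_power[OF assms(2), of 1] by simp
  also have "\<dots> = (\<integral>y. - (w' - w) * (inverse (w - complex_of_real y) * inverse (w' - complex_of_real y)) \<partial>M)"
    by (intro Bochner_Integration.integral_cong)
      (use diff_ne[OF assms(1)] diff_ne[OF assms(2)] in \<open>auto simp: field_simps\<close>)
  also have "\<dots> = - (w' - w) * Q w w'"
    unfolding Q_def by (rule integral_mult_right_zero)
  finally show ?thesis .
qed

text \<open>
  Cauchy-Schwarz, in the additive form \<open>2ab \<le> a\<^sup>2 + b\<^sup>2\<close>.
\<close>

lemma norm_Q_le: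
  assumes "0 < Im w" "0 < Im w'"
  shows "norm (Q w w') \<le> (N w + N w') / 2"
proof -
  have "norm (Q w w') \<le> (\<integral>y. norm (inverse (w - complex_of_real y) * inverse (w' - complex_of_real y)) \<partial>M)"
    unfolding Q_def by (rule integral_norm_bound)
  also have "\<dots> \<le> (\<integral>y. (inverse (norm (w - complex_of_real y)) ^ 2 + inverse (norm (w' - complex_of_real y)) ^ 2) / 2 \<partial>M)"
  proof (rule integral_mono)
    fix y
    show "norm (inverse (w - complex_of_real y) * inverse (w' - complex_of_real y))
        \<le> (inverse (norm (w - complex_of_real y)) ^ 2 + inverse (norm (w' - complex_of_real y)) ^ 2) / 2"
      using sum_squares_bound[of "inverse (norm (w - complex_of_real y))" "inverse (norm (w' - complex_of_real y))"]
      by (simp add: norm_mult norm_inverse)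
  qed (use assms integrable_Q[OF assms] integrable_inv_dist_square in auto)
  also have "\<dots> = (N w + N w') / 2"
    unfolding inv_dist_square_def using assms integrable_inv_dist_square by simp
  finally show ?thesis .
qed

text \<open>
  Pointwise \<open>|a|\<^sup>-\<^sup>2 - Re (a\<^sup>-\<^sup>2) = 2 (Im a)\<^sup>2 |a|\<^sup>-\<^sup>4\<close>, and Jensen's inequality bounds the integral of
  \<open>|w - y|\<^sup>-\<^sup>4\<close> below by the square of that of \<open>|w - y|\<^sup>-\<^sup>2\<close>. This gap is the source of the
  Hoelder regularity.
\<close>

lemma Re_cauchy_power_2_gap:
  assumes "0 < Im w"
  shows "2 * (Im w)\<^sup>2 * (N w)\<^sup>2 \<le> N w - Re (A 2 w)"
proof -
  define n where "n y = inverse (norm (w - complex_of_real y)) ^ 2" for y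
  have n_int: "integrable M n" unfolding n_def by (rule integrable_inv_dist_square[OF assms])
  have n2_int: "integrable M (\<lambda>y. (n y)\<^sup>2)"
    using integrable_norm[OF integrable_cauchy_power[OF assms, of 4]]
    by (simp add: n_def norm_power norm_inverse flip: power_mult)
  have gap: "n y - Re (inverse (w - complex_of_real y) ^ 2) = 2 * (Im w)\<^sup>2 * (n y)\<^sup>2" for y
  proof -
    define a where "a = w - complex_of_real y"
    have a: "a \<noteq> 0" "Im a = Im w" using diff_ne[OF assms] by (auto simp: a_def)
    have "Re (inverse a ^ 2) = (Re (inverse a))\<^sup>2 - (Im (inverse a))\<^sup>2"
      by (simp add: power2_eq_square)
    also have "\<dots> = (norm (inverse a))\<^sup>2 - 2 * (Im (inverse a))\<^sup>2"
      by (simp add: cmod_power2)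
    also have "Im (inverse a) = - Im w * (inverse (norm a))\<^sup>2"
      using a by (simp add: Im_inverse cmod_power2 power_inverse divide_inverse)
    finally show ?thesis
      by (simp add: n_def norm_inverse a_def power_mult_distrib)
  qed
  have "(N w)\<^sup>2 \<le> (\<integral>y. (n y)\<^sup>2 \<partial>M)"
  proof -
    have "0 \<le> (\<integral>y. (n y - N w)\<^sup>2 \<partial>M)" by (rule Bochner_Integration.integral_nonneg) auto
    also have "\<dots> = (\<integral>y. (n y)\<^sup>2 - 2 * N w * n y + (N w)\<^sup>2 \<partial>M)"
      by (simp add: power2_diff algebra_simps)
    also have "\<dots> = (\<integral>y. (n y)\<^sup>2 \<partial>M) - 2 * N w * (\<integral>y. n y \<partial>M) + (N w)\<^sup>2"
      using n_int n2_int by (simp add: prob_space)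
    also have "(\<integral>y. n y \<partial>M) = N w" by (simp add: n_def inv_dist_square_def)
    finally show ?thesis by (simp add: power2_eq_square)
  qed
  then have "2 * (Im w)\<^sup>2 * (N w)\<^sup>2 \<le> 2 * (Im w)\<^sup>2 * (\<integral>y. (n y)\<^sup>2 \<partial>M)"
    by (intro mult_left_mono) auto
  also have "\<dots> = (\<integral>y. n y - Re (inverse (w - complex_of_real y) ^ 2) \<partial>M)"
    unfolding gap by simp
  also have "\<dots> = N w - Re (A 2 w)"
    unfolding cauchy_power_def integral_Re[OF integrable_cauchy_power[OF assms, of 2], symmetric]
    by (subst Bochner_Integration.integral_diff[OF n_int integrable_Re[OF integrable_cauchy_power[OF assms, of 2]]])
      (simp add: n_def[abs_def] inv_dist_square_def)
  finally show ?thesis .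
qed

end

section \<open>Characteristics of the complex Burgers equation\<close>

context upper_half_transforms
begin

text \<open>
  The foot point of the characteristic that reaches \<open>z\<close> at time \<open>t\<close>.
\<close>

definition subord :: "real \<Rightarrow> complex \<Rightarrow> complex" where
  "subord t z = (SOME w. 0 < Im w \<and> w + of_real (t / pi) * A 1 w = z)"

text \<open>
  The sign of \<open>Im (A 1 w)\<close> and the bound \<open>|A 1 w| \<le> 1 / Im w\<close> make \<open>K\<close> invariant under \<open>f\<close>, so
  Brouwer's theorem applies.
\<close>

lemma subord_exists:
  assumes t: "0 \<le> t" and z: "0 < Im z"
  shows "\<exists>w. 0 < Im w \<and> w + of_real (t / pi) * A 1 w = z"
proof -
  define K where "K = {w. Im z \<le> Im w} \<inter> cball z (t / pi * inverse (Im z))"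
  define f where "f w = z - of_real (t / pi) * A 1 w" for w
  have "closed {w. Im z \<le> Im w}"
    using closed_halfspace_Im_ge[of "Im z"] by simp
  then have "compact K"
    unfolding K_def by (intro closed_Int_compact) auto
  moreover have "convex K"
    unfolding K_def using convex_halfspace_Im_ge[of "Im z"] by (intro convex_Int) auto
  moreover have "z \<in> K" using t z by (auto simp: K_def)
  moreover have "continuous_on K f"
    unfolding f_def using z
    by (intro continuous_intros continuous_at_imp_continuous_on ballI)
      (auto simp: K_def intro!: DERIV_isCont[OF has_field_derivative_cauchy_power])
  moreover have "f w \<in> K" if "w \<in> K" for w
  proof -
    have w: "Im z \<le> Im w" "0 < Im w" using that z by (auto simp: K_def)
    have "norm (A 1 w) \<le> inverse (Im w)" using norm_cauchy_power_le[OF w(2), of 1] by simp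
    also have "\<dots> \<le> inverse (Im z)" using w z by (intro le_imp_inverse_le)
    finally have "t / pi * norm (A 1 w) \<le> t / pi * inverse (Im z)"
      using t by (intro mult_left_mono) auto
    then have "dist z (f w) \<le> t / pi * inverse (Im z)"
      using t by (simp add: f_def dist_norm norm_mult norm_divide)
    moreover have "Im (f w) = Im z + t / pi * (Im w * N w)"
      using Im_cauchy_power_1[OF w(2)] by (simp add: f_def)
    then have "Im z \<le> Im (f w)" using t w inv_dist_square_nonneg by simp
    ultimately show ?thesis by (simp add: K_def)
  qed
  ultimately obtain w where "w \<in> K" "f w = w"
    using brouwer[of K f] by blast
  then show ?thesis
    using z by (intro exI[of _ w]) (auto simp: K_def f_def algebra_simps)
qed

lemma Im_subordination:
  assumes "0 < Im w" "w + of_real (t / pi) * A 1 w = z"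
  shows "Im w - Im z = t / pi * (Im w * N w)"
  using assms Im_cauchy_power_1[OF assms(1)] by auto

text \<open>
  Subtracting the two equations gives \<open>(w' - w)(1 - (m/\<pi>) Q w w') = z' - z - (t' - t)/\<pi> \<cdot> A 1 v\<close>. Here
  \<open>m\<close> is the smaller of the two times, so that \<open>(m/\<pi>) N w\<close> and \<open>(m/\<pi>) N w'\<close> are both bounded by the
  exact values \<open>1 - Im z / Im w\<close> and \<open>1 - Im z' / Im w'\<close>, and
  \<open>(m/\<pi>) |Q w w'|\<close> is at most the average of the two. The estimate yields uniqueness of the foot point and its continuity in \<open>(t, z)\<close>.
\<close>

lemma subordination_dist:
  assumes t: "0 \<le> t" "0 \<le> t'" and z: "0 < Im z" "0 < Im z'"
    and w: "0 < Im w" "w + of_real (t / pi) * A 1 w = z"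
    and w': "0 < Im w'" "w' + of_real (t' / pi) * A 1 w' = z'"
  shows "norm (w' - w) * (Im z / Im w + Im z' / Im w') / 2
    \<le> norm (z' - z) + \<bar>t' - t\<bar> / pi * max (inverse (Im z)) (inverse (Im z'))"
proof -
  \<comment> \<open>With the earlier time in front of \<open>Q\<close>, what is left over is the Cauchy transform at the later one.\<close>
  define m where "m = min t t'"
  define v where "v = (if t \<le> t' then w' else w)"
  have N: "t / pi * N w = 1 - Im z / Im w" "t' / pi * N w' = 1 - Im z' / Im w'"
    using Im_subordination[OF w] Im_subordination[OF w'] w(1) w'(1) by (auto simp: field_simps)
  have "m / pi * N w \<le> t / pi * N w" "m / pi * N w' \<le> t' / pi * N w'"
    by (auto simp: m_def intro!: mult_right_mono divide_right_mono inv_dist_square_nonneg)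
  then have "m / pi * N w + m / pi * N w' \<le> 2 - (Im z / Im w + Im z' / Im w')"
    using N by linarith
  moreover have "m / pi * ((N w + N w') / 2) = (m / pi * N w + m / pi * N w') / 2"
    by (simp add: distrib_left add_divide_distrib)
  moreover have "b \<le> 1 - c / 2" if "a \<le> 2 - c" "b = a / 2" for a b c :: real
    using that by simp
  ultimately have "m / pi * ((N w + N w') / 2) \<le> 1 - (Im z / Im w + Im z' / Im w') / 2"
    by blast
  moreover have "m / pi * norm (Q w w') \<le> m / pi * ((N w + N w') / 2)"
    using t by (intro mult_left_mono norm_Q_le w w') (auto simp: m_def)
  moreover have "norm (of_real (m / pi) * Q w w') = m / pi * norm (Q w w')"
    using t by (simp add: norm_mult norm_divide m_def)
  ultimately have 1: "(Im z / Im w + Im z' / Im w') / 2 \<le> 1 - norm (of_real (m / pi) * Q w w')"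
    by linarith
  also have "\<dots> \<le> norm (1 - of_real (m / pi) * Q w w')"
    using norm_triangle_ineq2[of 1 "of_real (m / pi) * Q w w'"] by simp
  finally have "norm (w' - w) * ((Im z / Im w + Im z' / Im w') / 2)
      \<le> norm ((w' - w) * (1 - of_real (m / pi) * Q w w'))"
    unfolding norm_mult by (rule mult_left_mono) simp
  also have "(w' - w) * (1 - of_real (m / pi) * Q w w') = (w' - w) + of_real (m / pi) * (A 1 w' - A 1 w)"
    unfolding cauchy_power_1_diff[OF w(1) w'(1)] by algebra
  also have "\<dots> = (z' - z) - of_real ((t' - t) / pi) * A 1 v"
    unfolding w(2)[symmetric] w'(2)[symmetric]
    by (cases "t \<le> t'") (simp_all add: m_def v_def algebra_simps diff_divide_distrib)
  also have "norm \<dots> \<le> norm (z' - z) + \<bar>t' - t\<bar> / pi * norm (A 1 v)"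
    using norm_triangle_ineq4[of "z' - z" "of_real ((t' - t) / pi) * A 1 v"] by (simp only: norm_mult norm_of_real) simp
  finally have main: "norm (w' - w) * ((Im z / Im w + Im z' / Im w') / 2)
      \<le> norm (z' - z) + \<bar>t' - t\<bar> / pi * norm (A 1 v)" .
  have "norm (A 1 v) \<le> max (inverse (Im z)) (inverse (Im z'))"
  proof -
    have le: "Im z \<le> Im w" "Im z' \<le> Im w'"
    proof -
      have "0 \<le> t / pi * (Im w * N w)" "0 \<le> t' / pi * (Im w' * N w')"
        using t w(1) w'(1) inv_dist_square_nonneg by simp_all
      then show "Im z \<le> Im w" "Im z' \<le> Im w'"
        using Im_subordination[OF w] Im_subordination[OF w'] by linarith+
    qed
    have "norm (A 1 w) \<le> inverse (Im w)" "norm (A 1 w') \<le> inverse (Im w')"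
      using norm_cauchy_power_le[OF w(1), of 1] norm_cauchy_power_le[OF w'(1), of 1] by simp_all
    moreover have "inverse (Im w) \<le> inverse (Im z)" "inverse (Im w') \<le> inverse (Im z')"
      using le z by (auto intro: le_imp_inverse_le)
    ultimately show ?thesis unfolding v_def by (auto simp: le_max_iff_disj)
  qed
  then have "\<bar>t' - t\<bar> / pi * norm (A 1 v) \<le> \<bar>t' - t\<bar> / pi * max (inverse (Im z)) (inverse (Im z'))"
    by (intro mult_left_mono) auto
  with main show ?thesis
    by linarith
qed

lemma
  assumes t: "0 \<le> t" and z: "0 < Im z"
  shows Im_subord_pos: "0 < Im (subord t z)"
    and subord_eq: "subord t z + of_real (t / pi) * A 1 (subord t z) = z"
  using someI_ex[OF subord_exists[OF t z]] by (simp_all add: subord_def)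

lemma subord_unique:
  assumes "0 \<le> t" "0 < Im z" "0 < Im w" "w + of_real (t / pi) * A 1 w = z"
  shows "subord t z = w"
proof -
  have "0 < Im z / Im (subord t z) + Im z / Im w"
    using assms Im_subord_pos[OF assms(1,2)] by (intro add_pos_pos) auto
  moreover have "norm (w - subord t z) * (Im z / Im (subord t z) + Im z / Im w) / 2 \<le> 0"
    using subordination_dist[OF assms(1,1,2,2) Im_subord_pos[OF assms(1,2)] subord_eq[OF assms(1,2)] assms(3,4)]
    by simp
  ultimately have "norm (w - subord t z) \<le> 0"
    by (simp add: mult_le_0_iff)
  then show ?thesis by simp
qed

lemma subord_0: "0 < Im z \<Longrightarrow> subord 0 z = z"
  by (rule subord_unique) auto

lemma
  assumes t: "0 \<le> t" and z: "0 < Im z"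
  shows Im_subord_ge: "Im z \<le> Im (subord t z)"
    and subord_inv_dist_square: "t / pi * N (subord t z) = 1 - Im z / Im (subord t z)"
proof -
  note w = Im_subord_pos[OF t z] subord_eq[OF t z]
  have "0 \<le> t / pi * (Im (subord t z) * N (subord t z))"
    using t w inv_dist_square_nonneg by simp
  then show "Im z \<le> Im (subord t z)"
    using Im_subordination[OF w] by simp
  show "t / pi * N (subord t z) = 1 - Im z / Im (subord t z)"
    using Im_subordination[OF w] w(1) by (simp add: field_simps)
qed

lemma norm_A_subord_le:
  assumes "0 \<le> t" "0 < Im z"
  shows "norm (A k (subord t z)) \<le> inverse (Im z) ^ k"
proof -
  have "norm (A k (subord t z)) \<le> inverse (Im (subord t z)) ^ k"
    by (rule norm_cauchy_power_le[OF Im_subord_pos[OF assms]])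
  also have "\<dots> \<le> inverse (Im z) ^ k"
    using Im_subord_ge[OF assms] assms(2) Im_subord_pos[OF assms]
    by (intro power_mono le_imp_inverse_le) auto
  finally show ?thesis .
qed

lemma norm_subord_diff_le:
  assumes "0 \<le> t" "0 < Im z"
  shows "norm (subord t z - z) \<le> t / (pi * Im z)"
proof -
  have "subord t z - z = - of_real (t / pi) * A 1 (subord t z)"
    using subord_eq[OF assms] by (simp add: algebra_simps)
  then have "norm (subord t z - z) = t / pi * norm (A 1 (subord t z))"
    using assms by (simp add: norm_mult norm_divide)
  also have "\<dots> \<le> t / pi * inverse (Im z)"
    using norm_A_subord_le[OF assms, of 1] assms by (intro mult_left_mono) auto
  finally show ?thesis by (simp add: field_simps)
qed

text \<open>The derivative of \<open>w \<mapsto> w + (t/\<pi>) A 1 w\<close>, the inverse of \<open>subord t\<close>.\<close>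

definition J where "J t w = 1 - of_real (t / pi) * A 2 w"

lemma Re_J_ge:
  assumes "0 \<le> t" "0 < Im z"
  shows "Im z / Im (subord t z) \<le> Re (J t (subord t z))"
proof -
  have "t / pi * Re (A 2 (subord t z)) \<le> t / pi * N (subord t z)"
    using order_trans[OF complex_Re_le_cmod norm_cauchy_power_2_le] assms by (intro mult_left_mono) auto
  then show ?thesis
    using subord_inv_dist_square[OF assms] by (simp add: J_def)
qed

lemma J_nonzero: "0 \<le> t \<Longrightarrow> 0 < Im z \<Longrightarrow> J t (subord t z) \<noteq> 0"
  using Re_J_ge[of t z] Im_subord_pos[of t z] by (metis divide_pos_pos not_less zero_complex.sel(1))

lemma continuous_subord:
  assumes t: "0 \<le> t" and z: "0 < Im z"
  shows "continuous (at (t, z) within {0..} \<times> {z. 0 < Im z}) (\<lambda>p. subord (fst p) (snd p))"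
proof -
  define F where "F = (at (t, z) within {0..} \<times> {z. 0 < Im z})"
  define c where "c = Im z / Im (subord t z) / 2"
  have c: "0 < c" using Im_subord_pos[OF t z] z by (simp add: c_def)
  have bd: "norm (subord (fst p) (snd p) - subord t z) * c \<le>
      norm (snd p - z) + \<bar>fst p - t\<bar> / pi * max (inverse (Im z)) (inverse (Im (snd p)))"
    if "p \<in> {0..} \<times> {z. 0 < Im z}" for p
  proof -
    define t' z' where "t' = fst p" and "z' = snd p"
    then have p: "p = (t', z')" "0 \<le> t'" "0 < Im z'" using that by auto
    have "norm (subord t' z' - subord t z) * c \<le>
        norm (subord t' z' - subord t z) * (Im z / Im (subord t z) + Im z' / Im (subord t' z')) / 2"
      unfolding times_divide_eq_right[symmetric]
      using Im_subord_pos[OF p(2,3)] p by (intro mult_left_mono) (auto simp: c_def)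
    also have "\<dots> \<le> norm (z' - z) + \<bar>t' - t\<bar> / pi * max (inverse (Im z)) (inverse (Im z'))"
      by (rule subordination_dist) (use t z p Im_subord_pos subord_eq in auto)
    finally show ?thesis by (simp add: p)
  qed
  have "((\<lambda>p. (norm (snd p - z) + \<bar>fst p - t\<bar> / pi * max (inverse (Im z)) (inverse (Im (snd p)))) / c)
      \<longlongrightarrow> (norm (z - z) + \<bar>t - t\<bar> / pi * max (inverse (Im z)) (inverse (Im z))) / c) F"
  proof -
    have "(snd \<longlongrightarrow> z) F" "(fst \<longlongrightarrow> t) F"
      unfolding F_def by (auto intro!: tendsto_eq_intros tendsto_ident_at)
    then show ?thesis
      using z c by (intro tendsto_intros tendsto_max) auto
  qed
  then have "((\<lambda>p. (norm (snd p - z) + \<bar>fst p - t\<bar> / pi * max (inverse (Im z)) (inverse (Im (snd p)))) / c)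
      \<longlongrightarrow> 0) F"
    by (rule tendsto_eq_rhs) simp
  then have "((\<lambda>p. subord (fst p) (snd p) - subord t z) \<longlongrightarrow> 0) F"
  proof (rule Lim_null_comparison[rotated])
    show "eventually (\<lambda>p. norm (subord (fst p) (snd p) - subord t z) \<le>
        (norm (snd p - z) + \<bar>fst p - t\<bar> / pi * max (inverse (Im z)) (inverse (Im (snd p)))) / c) F"
      unfolding F_def eventually_at_filter
      by (rule always_eventually) (metis bd c pos_le_divide_eq)
  qed
  then have "((\<lambda>p. subord (fst p) (snd p)) \<longlongrightarrow> subord t z) F"
    by (rule LIM_zero_cancel)
  then show ?thesis
    by (simp only: continuous_within F_def fst_conv snd_conv)
qed

text \<open>
  The inverse function theorem for \<open>(t, w) \<mapsto> (t, w + (t/\<pi>) A 1 w)\<close>, whose inverse is already known to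
  exist and to be continuous.
\<close>

lemma has_derivative_subord:
  assumes t: "0 < t" and z: "0 < Im z"
  shows "((\<lambda>p. subord (fst p) (snd p)) has_derivative
     (\<lambda>v. (snd v - of_real (fst v / pi) * A 1 (subord t z)) / J t (subord t z))) (at (t, z))"
proof -
  define w where "w = subord t z"
  define T :: "(real \<times> complex) set" where "T = {0<..} \<times> {z. 0 < Im z}"
  have oT: "open T"
    unfolding T_def by (intro open_Times open_greaterThan open_halfspace_Im_gt)
  have w: "0 < Im w" "J t w \<noteq> 0"
    using Im_subord_pos[of t z] J_nonzero[of t z] t z by (auto simp: w_def)
  define f where "f p = (fst p, snd p + of_real (fst p / pi) * A 1 (snd p))" for p :: "real \<times> complex"
  define g where "g p = (fst p, subord (fst p) (snd p))" for p
  define f' where "f' v = (fst v, snd v * J t w + of_real (fst v / pi) * A 1 w)" for v :: "real \<times> complex"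
  define g' where "g' v = (fst v, (snd v - of_real (fst v / pi) * A 1 w) / J t w)" for v :: "real \<times> complex"
  have "(A 1 has_derivative (*) (- of_nat 1 * A (Suc 1) w)) (at w)"
    using has_field_derivative_cauchy_power[OF w(1), of 1] unfolding has_field_derivative_def .
  moreover have "(*) (- of_nat 1 * A (Suc 1) w) = (\<lambda>h. h * (- 1 * A 2 w))"
    by (simp add: fun_eq_iff numeral_2_eq_2)
  ultimately have "(A 1 has_derivative (\<lambda>h. h * (- 1 * A 2 w))) (at (snd (t, w)))"
    by (simp only: snd_conv)
  from has_derivative_compose[OF has_derivative_snd[OF has_derivative_ident], of "A 1" _ "(t, w)" UNIV, OF this]
  have dA: "((\<lambda>p. A 1 (snd p)) has_derivative (\<lambda>v. snd v * (- 1 * A 2 w))) (at (t, w))"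
    by simp
  have df: "(f has_derivative f') (at (g (t, z)))"
    unfolding f_def g_def fst_conv snd_conv w_def[symmetric]
  proof (rule has_derivative_eq_rhs)
    have "bounded_linear (\<lambda>v :: real \<times> complex. complex_of_real (fst v / pi))"
      by (intro bounded_linear_compose[OF bounded_linear_of_real] bounded_linear_compose[OF bounded_linear_divide]
          bounded_linear_fst)
    then have dF: "((\<lambda>p. complex_of_real (fst p / pi)) has_derivative (\<lambda>v. of_real (fst v / pi))) (at (t, w))"
      by (rule bounded_linear_imp_has_derivative)
    show "((\<lambda>p. (fst p, snd p + of_real (fst p / pi) * A 1 (snd p))) has_derivative
        (\<lambda>v. (fst v, snd v + (complex_of_real (fst (t, w) / pi) * (snd v * (- 1 * A 2 w))
          + of_real (fst v / pi) * A 1 (snd (t, w)))))) (at (t, w))"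
      by (intro has_derivative_Pair has_derivative_add has_derivative_mult[OF dF dA]
          has_derivative_fst has_derivative_snd has_derivative_ident)
  qed (auto simp: f'_def J_def fun_eq_iff algebra_simps)
  have lin: "bounded_linear g'"
    unfolding g'_def
    by (intro bounded_linear_Pair bounded_linear_fst bounded_linear_snd bounded_linear_sub
        bounded_linear_compose[OF bounded_linear_divide[where y = "J t w"]]
        bounded_linear_compose[OF bounded_linear_mult_left[where y = "A 1 w"]]
        bounded_linear_compose[OF bounded_linear_of_real] bounded_linear_compose[OF bounded_linear_divide])
  have inv: "g' \<circ> f' = id"
    using w by (auto simp: g'_def f'_def fun_eq_iff)
  have cont: "continuous (at (t, z)) g"
  proof -
    have *: "at (t, z) within {0..} \<times> {z. 0 < Im z} = at (t, z)"
      using t z oT by (intro at_within_interior interiorI[of T]) (auto simp: T_def)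
    have "continuous (at (t, z)) (\<lambda>p. subord (fst p) (snd p))"
      using continuous_subord[OF less_imp_le[OF t] z] unfolding * .
    then show ?thesis
      unfolding g_def by (intro continuous_intros)
  qed
  have fg: "f (g p) = p" if "p \<in> T" for p
    using that subord_eq by (auto simp: f_def g_def T_def prod_eq_iff)
  have "(t, z) \<in> T" using t z by (simp add: T_def)
  from has_derivative_inverse_basic[OF df lin inv cont oT this fg]
  have "(g has_derivative g') (at (t, z))" .
  then have "((\<lambda>p. snd (g p)) has_derivative (\<lambda>v. snd (g' v))) (at (t, z))"
    by (rule has_derivative_snd)
  then show ?thesis
    by (simp add: g_def g'_def w_def)
qed

end

section \<open>The smoothed distribution function\<close>

text \<open>
  Integrability of \<open>sqrt |y|\<close> is a convenient condition for the existence of the logarithmic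
  potential, and gives it the growth that \<open>half_laplacian_boundary_value\<close> asks for.
\<close>

locale sqrt_integrable_transforms = upper_half_transforms +
  assumes sqrt_integrable: "integrable M (\<lambda>y. sqrt \<bar>y\<bar>)"
begin

definition log_potential where "log_potential w = (\<integral>y. Ln (w - complex_of_real y) \<partial>M)"

lemma diff_nonpos_Reals: "0 < Im w \<Longrightarrow> w - complex_of_real y \<notin> \<real>\<^sub>\<le>\<^sub>0"
  by (auto simp: complex_nonpos_Reals_iff)

lemma norm_Ln_diff_le:
  assumes "0 < Im w"
  shows "norm (Ln (w - complex_of_real y)) \<le> 2 * sqrt (norm w) + 2 * sqrt \<bar>y\<bar> + inverse (Im w) + pi"
proof -
  define r where "r = norm (w - complex_of_real y)"
  have r: "Im w \<le> r" "0 < r"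
    using abs_Im_le_cmod[of "w - of_real y"] assms by (auto simp: r_def)
  have "ln r = 2 * ln (sqrt r)" using r by (simp add: ln_sqrt)
  also have "\<dots> \<le> 2 * sqrt r" using ln_less_self[of "sqrt r"] r by (simp add: less_imp_le)
  also have "sqrt r \<le> sqrt (norm w + \<bar>y\<bar>)"
    unfolding r_def using norm_triangle_ineq4[of w "of_real y"] by simp
  also have "sqrt (norm w + \<bar>y\<bar>) \<le> sqrt (norm w) + sqrt \<bar>y\<bar>"
    by (rule sqrt_add_le_add_sqrt) auto
  finally have 1: "ln r \<le> 2 * sqrt (norm w) + 2 * sqrt \<bar>y\<bar>" by simp
  have "- ln r = ln (inverse r)" using r by (simp add: ln_inverse)
  also have "\<dots> \<le> inverse r" using r ln_less_self[of "inverse r"] by (simp add: less_imp_le)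
  also have "\<dots> \<le> inverse (Im w)" using r assms by (intro le_imp_inverse_le)
  finally have 2: "- ln r \<le> inverse (Im w)" .
  have "\<bar>ln r\<bar> \<le> 2 * sqrt (norm w) + 2 * sqrt \<bar>y\<bar> + inverse (Im w)"
  proof (rule abs_leI)
    have "0 \<le> 2 * sqrt (norm w) + 2 * sqrt \<bar>y\<bar>" "0 \<le> inverse (Im w)" using assms by auto
    then show "ln r \<le> 2 * sqrt (norm w) + 2 * sqrt \<bar>y\<bar> + inverse (Im w)"
      "- ln r \<le> 2 * sqrt (norm w) + 2 * sqrt \<bar>y\<bar> + inverse (Im w)" using 1 2 by linarith+
  qed
  moreover have "norm (Ln (w - complex_of_real y)) \<le> \<bar>ln r\<bar> + pi"
  proof -
    have "norm (Ln (w - complex_of_real y)) \<le> \<bar>Re (Ln (w - of_real y))\<bar> + \<bar>Im (Ln (w - of_real y))\<bar>"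
      by (rule cmod_le)
    moreover have "\<bar>Im (Ln (w - of_real y))\<bar> \<le> pi"
      using diff_ne[OF assms] Im_Ln_le_pi mpi_less_Im_Ln by (simp add: abs_le_iff less_imp_le minus_le_iff)
    ultimately show ?thesis
      using diff_ne[OF assms] by (simp add: r_def)
  qed
  ultimately show ?thesis by linarith
qed

lemma integrable_Ln_diff:
  assumes "0 < Im w"
  shows "integrable M (\<lambda>y. Ln (w - complex_of_real y))"
proof (rule Bochner_Integration.integrable_bound)
  show "integrable M (\<lambda>y. 2 * sqrt (norm w) + 2 * sqrt \<bar>y\<bar> + inverse (Im w) + pi)"
    using sqrt_integrable by simp
  have "continuous_on UNIV (\<lambda>y. Ln (w - complex_of_real y))"
    by (intro continuous_intros) (use diff_nonpos_Reals[OF assms] in auto)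
  then show "(\<lambda>y. Ln (w - complex_of_real y)) \<in> borel_measurable M"
    by (intro borel_meas borel_measurable_continuous_onI)
  have "0 \<le> 2 * sqrt (norm w) + 2 * sqrt \<bar>y\<bar> + inverse (Im w) + pi" for y
    using assms by (intro add_nonneg_nonneg) auto
  then show "AE y in M. norm (Ln (w - complex_of_real y)) \<le> norm (2 * sqrt (norm w) + 2 * sqrt \<bar>y\<bar> + inverse (Im w) + pi)"
    by (intro AE_I2) (simp add: norm_Ln_diff_le[OF assms])
qed

lemma norm_log_potential_le:
  assumes "0 < Im w"
  shows "norm (log_potential w) \<le> 2 * sqrt (norm w) + 2 * (\<integral>y. sqrt \<bar>y\<bar> \<partial>M) + inverse (Im w) + pi"
proof -
  have "norm (log_potential w) \<le> (\<integral>y. norm (Ln (w - complex_of_real y)) \<partial>M)"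
    unfolding log_potential_def by (rule integral_norm_bound)
  also have "\<dots> \<le> (\<integral>y. 2 * sqrt (norm w) + 2 * sqrt \<bar>y\<bar> + inverse (Im w) + pi \<partial>M)"
    by (rule integral_mono) (use integrable_Ln_diff[OF assms] sqrt_integrable norm_Ln_diff_le[OF assms] in auto)
  also have "\<dots> = 2 * sqrt (norm w) + 2 * (\<integral>y. sqrt \<bar>y\<bar> \<partial>M) + inverse (Im w) + pi"
    using sqrt_integrable by simp
  finally show ?thesis .
qed

lemma has_field_derivative_log_potential:
  assumes "0 < Im w"
  shows "(log_potential has_field_derivative A 1 w) (at w)"
proof -
  define S where "S = {z. Im w / 2 < Im z}"
  have "((\<lambda>z. \<integral>y. Ln (z - complex_of_real y) \<partial>M) has_field_derivative
      (\<integral>y. inverse (w - complex_of_real y) \<partial>M)) (at w)"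
  proof (rule has_field_derivative_integral_dominated[where S = S and C = "inverse (Im w / 2)"])
    show "finite_measure M" by (rule finite_measure_axioms)
    show "convex S" unfolding S_def by (rule convex_halfspace_Im_gt)
    show "open S" unfolding S_def by (rule open_halfspace_Im_gt)
    show "w \<in> S" using assms by (simp add: S_def)
    fix z y assume "z \<in> S"
    then have z: "0 < Im z" "Im w / 2 \<le> Im z" using assms by (auto simp: S_def)
    show "integrable M (\<lambda>y. Ln (z - complex_of_real y))"
      by (rule integrable_Ln_diff[OF z(1)])
    show "((\<lambda>z. Ln (z - complex_of_real y)) has_field_derivative inverse (z - complex_of_real y)) (at z)"
      using diff_nonpos_Reals[OF z(1), of y] by (auto intro!: derivative_eq_intros simp: field_simps)
    show "norm (inverse (z - complex_of_real y)) \<le> inverse (Im w / 2)"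
      using norm_inverse_le[OF z(1), of y] le_imp_inverse_le[OF z(2)] assms by linarith
  qed (auto intro!: borel_meas)
  then show ?thesis
    by (simp add: log_potential_def[abs_def] cauchy_power_def)
qed

text \<open>
  A primitive of \<open>G(t, \<cdot>) = A 1 (subord t \<cdot>)\<close>. The second summand is the correction along
  characteristics that turns \<open>\<partial>\<^sub>tG + (1/\<pi>) G \<partial>\<^sub>zG = 0\<close> into \<open>\<partial>\<^sub>t potential = - G\<^sup>2 / (2\<pi>)\<close>.
\<close>

definition potential where
  "potential t z = log_potential (subord t z) + of_real (t / (2 * pi)) * (A 1 (subord t z))\<^sup>2"

lemma has_derivative_potential:
  assumes t: "0 < t" and z: "0 < Im z"
  shows "((\<lambda>p. potential (fst p) (snd p)) has_derivative
    (\<lambda>v. A 1 (subord t z) * snd v - of_real (fst v / (2 * pi)) * (A 1 (subord t z))\<^sup>2)) (at (t, z))"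
proof -
  define w where "w = subord t z"
  define a where "a = A 1 w"
  define b where "b = A 2 w"
  have w: "0 < Im w" "J t w \<noteq> 0"
    using Im_subord_pos[of t z] J_nonzero[of t z] t z by (auto simp: w_def)
  define D where "D v = (snd v - of_real (fst v / pi) * a) / J t w" for v :: "real \<times> complex"
  have dw: "((\<lambda>p. subord (fst p) (snd p)) has_derivative D) (at (t, z))"
    using has_derivative_subord[OF t z] by (simp add: D_def[abs_def] w_def a_def)
  have comp: "((\<lambda>p. F (subord (fst p) (snd p))) has_derivative (\<lambda>v. F' * D v)) (at (t, z))"
    if "(F has_field_derivative F') (at w)" for F F'
    using has_derivative_compose[OF dw, of F "(*) F'"] that
    by (simp add: has_field_derivative_def w_def)
  have dL: "((\<lambda>p. log_potential (subord (fst p) (snd p))) has_derivative (\<lambda>v. a * D v)) (at (t, z))"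
    unfolding a_def by (rule comp[OF has_field_derivative_log_potential[OF w(1)]])
  have "((\<lambda>w. (A 1 w)\<^sup>2) has_field_derivative 2 * a * (- b)) (at w)"
    using has_field_derivative_cauchy_power[OF w(1), of 1]
    by (auto intro!: derivative_eq_intros simp: a_def b_def numeral_2_eq_2)
  note dA = comp[OF this]
  have "bounded_linear (\<lambda>v :: real \<times> complex. complex_of_real (fst v / (2 * pi)))"
    by (intro bounded_linear_compose[OF bounded_linear_of_real] bounded_linear_compose[OF bounded_linear_divide]
        bounded_linear_fst)
  then have dT: "((\<lambda>p. complex_of_real (fst p / (2 * pi))) has_derivative (\<lambda>v. of_real (fst v / (2 * pi)))) (at (t, z))"
    by (rule bounded_linear_imp_has_derivative)
  show ?thesis
    unfolding potential_def
  proof (rule has_derivative_eq_rhs)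
    show "((\<lambda>p. log_potential (subord (fst p) (snd p)) + complex_of_real (fst p / (2 * pi)) * (A 1 (subord (fst p) (snd p)))\<^sup>2)
      has_derivative (\<lambda>v. a * D v + (complex_of_real (fst (t, z) / (2 * pi)) * (2 * a * (- b) * D v)
          + of_real (fst v / (2 * pi)) * (A 1 (subord (fst (t, z)) (snd (t, z))))\<^sup>2))) (at (t, z))"
      by (intro has_derivative_add dL has_derivative_mult[OF dT dA])
    show "(\<lambda>v. a * D v + (complex_of_real (fst (t, z) / (2 * pi)) * (2 * a * (- b) * D v)
          + of_real (fst v / (2 * pi)) * (A 1 (subord (fst (t, z)) (snd (t, z))))\<^sup>2))
      = (\<lambda>v. A 1 (subord t z) * snd v - of_real (fst v / (2 * pi)) * (A 1 (subord t z))\<^sup>2)"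
    proof
      fix v :: "real \<times> complex"
      have "a * D v + complex_of_real (t / (2 * pi)) * (2 * a * (- b) * D v) = a * (J t w * D v)"
        by (simp add: J_def b_def algebra_simps)
      also have "J t w * D v = snd v - of_real (fst v / pi) * a"
        using w by (simp add: D_def)
      finally show "a * D v + (complex_of_real (fst (t, z) / (2 * pi)) * (2 * a * (- b) * D v)
          + of_real (fst v / (2 * pi)) * (A 1 (subord (fst (t, z)) (snd (t, z))))\<^sup>2)
        = A 1 (subord t z) * snd v - of_real (fst v / (2 * pi)) * (A 1 (subord t z))\<^sup>2"
        unfolding fst_conv snd_conv w_def[symmetric] a_def[symmetric]
        by (simp add: algebra_simps power2_eq_square)
    qed
  qed
qed

lemma has_field_derivative_potential:
  assumes t: "0 < t" and z: "0 < Im z"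
  shows "(potential t has_field_derivative A 1 (subord t z)) (at z)"
proof -
  have "((\<lambda>z. (t, z)) has_derivative (\<lambda>v. (0, v))) (at z)"
    by (auto intro!: derivative_eq_intros)
  from has_derivative_compose[OF this has_derivative_potential[OF t z]]
  show ?thesis
    by (simp add: has_field_derivative_def)
qed

lemma continuous_on_potential:
  "continuous_on ({0..} \<times> {z. 0 < Im z}) (\<lambda>p. potential (fst p) (snd p))"
proof -
  have s: "continuous_on ({0..} \<times> {z. 0 < Im z}) (\<lambda>p. subord (fst p) (snd p))"
    using continuous_subord by (auto simp: continuous_on_eq_continuous_within)
  have "continuous_on {w. 0 < Im w} log_potential" "continuous_on {w. 0 < Im w} (A 1)"
    by (auto intro!: continuous_at_imp_continuous_on DERIV_isCont has_field_derivative_log_potential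
        has_field_derivative_cauchy_power)
  moreover have "(\<lambda>p. subord (fst p) (snd p)) ` ({0..} \<times> {z. 0 < Im z}) \<subseteq> {w. 0 < Im w}"
    by (auto intro: Im_subord_pos)
  ultimately show ?thesis
    unfolding potential_def
    by (intro continuous_intros continuous_on_compose2[OF _ s, of _ log_potential]
        continuous_on_compose2[OF _ s, of _ "A 1"]) auto
qed

lemma norm_cauchy_power_1_square_le:
  assumes "0 < Im w"
  shows "(norm (A 1 w))\<^sup>2 \<le> N w"
proof -
  define n where "n y = inverse (norm (w - complex_of_real y))" for y
  have n_int: "integrable M n"
    using integrable_norm[OF integrable_cauchy_power[OF assms, of 1]]
    by (simp add: n_def[abs_def] norm_inverse)
  have n2_int: "integrable M (\<lambda>y. (n y)\<^sup>2)" unfolding n_def by (rule integrable_inv_dist_square[OF assms])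
  define c where "c = (\<integral>y. n y \<partial>M)"
  have "norm (A 1 w) \<le> c"
    unfolding c_def n_def cauchy_power_def
    using integral_norm_bound[of M "\<lambda>y. inverse (w - complex_of_real y)"] by (simp add: norm_inverse)
  then have "(norm (A 1 w))\<^sup>2 \<le> c\<^sup>2" by (simp add: power_mono)
  also have "c\<^sup>2 \<le> N w"
  proof -
    have "0 \<le> (\<integral>y. (n y - c)\<^sup>2 \<partial>M)" by (rule Bochner_Integration.integral_nonneg) auto
    also have "\<dots> = (\<integral>y. (n y)\<^sup>2 - 2 * c * n y + c\<^sup>2 \<partial>M)"
      by (simp add: power2_diff algebra_simps)
    also have "\<dots> = (\<integral>y. (n y)\<^sup>2 \<partial>M) - 2 * c * c + c\<^sup>2"
      using n_int n2_int by (simp add: c_def)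
    also have "(\<integral>y. (n y)\<^sup>2 \<partial>M) = N w" by (simp add: n_def inv_dist_square_def)
    finally show ?thesis by (simp add: power2_eq_square)
  qed
  finally show ?thesis .
qed

lemma Im_Ln_diff:
  assumes "0 < Im w"
  shows "Im (Ln (w - complex_of_real y)) = pi / 2 - arctan ((Re w - y) / Im w)"
proof -
  have "Arg2pi (w - complex_of_real y) = pi / 2 - arctan ((Re w - y) / Im w)"
    using Arg2pi_arctan_upperhalf[of "w - complex_of_real y"] assms by simp
  moreover have "Arg2pi (w - complex_of_real y) = Im (Ln (w - complex_of_real y))"
    using Arg2pi_Ln[of "w - complex_of_real y"] Arg2pi_lt_pi[of "w - complex_of_real y"]
      Ln_minus[OF diff_ne[OF assms, of y]] assms by simp
  ultimately show ?thesis by simp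
qed

lemma Im_log_potential:
  assumes "0 < Im w"
  shows "Im (log_potential w) = (\<integral>y. pi / 2 - arctan ((Re w - y) / Im w) \<partial>M)"
  unfolding log_potential_def using integral_Im[OF integrable_Ln_diff[OF assms]]
  by (simp only: Im_Ln_diff[OF assms])

lemma integrable_arctan:
  "integrable M (\<lambda>y. arctan ((a - y) / b))"
proof (rule integrable_bounded_borel[where B = "pi / 2"])
  show "norm (arctan ((a - y) / b)) \<le> pi / 2" for y
    using arctan_bounded[of "(a - y) / b"] by (simp only: real_norm_def abs_le_iff) linarith
qed measurable

text \<open>
  For \<open>t = 0\<close> an average of angles; in general the distribution function of \<open>u(t)\<close> convolved with the
  Cauchy law of width \<open>e\<close>.
\<close>

definition profile where "profile e t x = 1 - Im (potential t (Complex x e)) / pi"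

text \<open>
  The first summand of the potential averages angles in \<open>[0, \<pi>]\<close>; the second one is bounded since
  \<open>(t/\<pi>) |A 1 w|\<^sup>2 \<le> (t/\<pi>) N w \<le> 1\<close>. The bound does not depend on \<open>t\<close>, which is what the comparison
  principle needs.
\<close>

lemma abs_Im_potential_le:
  assumes "0 \<le> t" "0 < Im z"
  shows "- (1 / 2) \<le> Im (potential t z)" "Im (potential t z) \<le> pi + 1 / 2"
proof -
  define w where "w = subord t z"
  have w: "0 < Im w" using Im_subord_pos[OF assms] by (simp add: w_def)
  have "t / pi * (norm (A 1 w))\<^sup>2 \<le> t / pi * N w"
    using assms by (intro mult_left_mono norm_cauchy_power_1_square_le w) auto
  also have "\<dots> \<le> 1"
    unfolding w_def subord_inv_dist_square[OF assms] using Im_subord_pos[OF assms] assms by simp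
  finally have "norm (of_real (t / (2 * pi)) * (A 1 w)\<^sup>2) \<le> 1 / 2"
    using assms by (simp add: norm_mult norm_power norm_divide)
  then have "\<bar>Im (of_real (t / (2 * pi)) * (A 1 w)\<^sup>2)\<bar> \<le> 1 / 2"
    using abs_Im_le_cmod order_trans by blast
  moreover have "0 \<le> Im (log_potential w)" "Im (log_potential w) \<le> pi"
  proof -
    have b: "0 \<le> pi / 2 - arctan s" "pi / 2 - arctan s \<le> pi" for s
      using arctan_bounded[of s] by auto
    have i: "integrable M (\<lambda>y. pi / 2 - arctan ((Re w - y) / Im w))"
      using integrable_arctan by simp
    show "0 \<le> Im (log_potential w)"
      unfolding Im_log_potential[OF w] by (rule Bochner_Integration.integral_nonneg) (use b in auto)
    have "(\<integral>y. pi / 2 - arctan ((Re w - y) / Im w) \<partial>M) \<le> (\<integral>y. pi \<partial>M)"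
      by (rule integral_mono) (use b i in auto)
    then show "Im (log_potential w) \<le> pi"
      unfolding Im_log_potential[OF w] by simp
  qed
  ultimately show "- (1 / 2) \<le> Im (potential t z)" "Im (potential t z) \<le> pi + 1 / 2"
    unfolding potential_def w_def[symmetric] plus_complex.sel by linarith+
qed

lemma profile_bounds:
  assumes "0 \<le> t" "0 < e"
  shows "-1 \<le> profile e t x" "profile e t x \<le> 2"
proof -
  have b: "- (1 / 2) \<le> Im (potential t (Complex x e))" "Im (potential t (Complex x e)) \<le> pi + 1 / 2"
    using abs_Im_potential_le[of t "Complex x e"] assms by auto
  have p: "1 \<le> pi" using pi_gt3 by linarith
  have "Im (potential t (Complex x e)) \<le> 2 * pi" "- pi \<le> Im (potential t (Complex x e))"
    using b p by linarith+
  then show "-1 \<le> profile e t x" "profile e t x \<le> 2"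
    by (simp_all add: profile_def divide_le_eq le_divide_eq)
qed

lemma profile_0: 
  assumes "0 < e"
  shows "profile e 0 x = (\<integral>y. 1 / 2 + arctan ((x - y) / e) / pi \<partial>M)"
proof -
  have "profile e 0 x = 1 - (\<integral>y. pi / 2 - arctan ((x - y) / e) \<partial>M) / pi"
    using assms by (simp add: profile_def potential_def subord_0 Im_log_potential)
  then show ?thesis
    using integrable_arctan[of x e] by (simp add: diff_divide_distrib)
qed

text \<open>
  The Cauchy law of width \<open>e\<close> puts mass \<open>1/2 - arctan (a/e) / \<pi>\<close> on \<open>[a, \<infinity>)\<close>, so after a shift by
  \<open>a\<close> this is all that smoothing can spoil in the order of the distribution functions.
\<close>

lemma
  assumes e: "0 < e" and a: "0 < a"
  shows cdf_le_profile_0: "measure M {..x} \<le> profile e 0 (x + a) + (1 / 2 - arctan (a / e) / pi)"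
    and profile_0_le_cdf: "profile e 0 (x - a) - (1 / 2 - arctan (a / e) / pi) \<le> measure M {..<x}"
proof -
  define b where "b = 1 / 2 - arctan (a / e) / pi"
  have b: "0 \<le> b" using arctan_bounded[of "a / e"] by (simp add: b_def field_simps)
  have bd: "0 \<le> 1 / 2 + arctan s / pi" "1 / 2 + arctan s / pi \<le> 1" for s
    using arctan_bounded[of s] by (simp_all add: field_simps)
  have i: "integrable M (\<lambda>y. 1 / 2 + arctan ((c - y) / e) / pi)" for c
    using integrable_arctan by simp
  have ind: "(\<integral>y. indicator S y \<partial>M) = measure M S" "integrable M (indicat_real S)" if "S \<in> sets borel" for S
    using that by (auto simp: emeasure_eq_measure)
  have "measure M {..x} = (\<integral>y. indicator {..x} y \<partial>M)"
    using ind by simp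
  also have "\<dots> \<le> (\<integral>y. (1 / 2 + arctan ((x + a - y) / e) / pi) + b \<partial>M)"
  proof (rule integral_mono)
    fix y
    show "indicat_real {..x} y \<le> (1 / 2 + arctan ((x + a - y) / e) / pi) + b"
    proof (cases "y \<le> x")
      case True
      then have "arctan (a / e) \<le> arctan ((x + a - y) / e)"
        using e by (simp add: arctan_le_iff divide_right_mono)
      then have "arctan (a / e) / pi \<le> arctan ((x + a - y) / e) / pi"
        by (rule divide_right_mono) simp
      then show ?thesis using True by (simp add: b_def)
    next
      case False
      then show ?thesis using bd(1)[of "(x + a - y) / e"] b by simp
    qed
  qed (use i ind in auto)
  also have "\<dots> = profile e 0 (x + a) + b"
    using i by (simp add: profile_0[OF e])
  finally show "measure M {..x} \<le> profile e 0 (x + a) + (1 / 2 - arctan (a / e) / pi)"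
    by (simp add: b_def)
  have "profile e 0 (x - a) = (\<integral>y. 1 / 2 + arctan ((x - a - y) / e) / pi \<partial>M)"
    by (rule profile_0[OF e])
  also have "\<dots> \<le> (\<integral>y. indicator {..<x} y + b \<partial>M)"
  proof (rule integral_mono)
    fix y
    show "1 / 2 + arctan ((x - a - y) / e) / pi \<le> indicat_real {..<x} y + b"
    proof (cases "y < x")
      case True
      then show ?thesis using bd(2)[of "(x - a - y) / e"] b by simp
    next
      case False
      then have "(x - a - y) / e \<le> - (a / e)"
        using e by (simp add: field_simps)
      then have "arctan ((x - a - y) / e) \<le> arctan (- (a / e))"
        by (simp only: arctan_le_iff)
      then have "arctan ((x - a - y) / e) / pi \<le> - arctan (a / e) / pi"
        unfolding arctan_minus by (rule divide_right_mono) simp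
      then show ?thesis using False by (simp add: b_def)
    qed
  qed (use i ind in auto)
  also have "\<dots> = measure M {..<x} + b"
    using ind by simp
  finally show "profile e 0 (x - a) - (1 / 2 - arctan (a / e) / pi) \<le> measure M {..<x}"
    by (simp add: b_def)
qed

section \<open>Regularity of the smooth solutions\<close>

definition profile_density where "profile_density e t x = - Im (A 1 (subord t (Complex x e))) / pi"

lemma profile_has_derivative:
  assumes "0 < t" "0 < e"
  shows "(profile e t has_real_derivative profile_density e t x) (at x)"
proof -
  have "((\<lambda>z. potential t (z + \<i> * of_real e)) has_field_derivative A 1 (subord t (of_real x + \<i> * of_real e))) (at (of_real x))"
    using has_field_derivative_potential[of t "of_real x + \<i> * of_real e"] assms
    by (auto simp: DERIV_shift)
  then have "((\<lambda>x. potential t (Complex x e)) has_vector_derivative A 1 (subord t (Complex x e))) (at x)"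
    unfolding Complex_eq by (rule has_vector_derivative_real_field)
  then show ?thesis
    unfolding profile_def profile_density_def
    by (auto intro!: derivative_eq_intros has_field_derivative_Im)
qed

lemma profile_density_eq:
  assumes "0 < t" "0 < e"
  shows "profile_density e t x = (Im (subord t (Complex x e)) - e) / t"
proof -
  have "Im (subord t (Complex x e)) + t / pi * Im (A 1 (subord t (Complex x e))) = e"
    using arg_cong[OF subord_eq[of t "Complex x e"], of Im] assms by simp
  then show ?thesis using assms by (simp add: profile_density_def field_simps)
qed

lemma profile_density_nonneg: "0 < t \<Longrightarrow> 0 < e \<Longrightarrow> 0 \<le> profile_density e t x"
  using Im_subord_ge[of t "Complex x e"] by (simp add: profile_density_eq)

text \<open>
  With \<open>h = Im w\<close>, the equation for \<open>w\<close> gives \<open>h - e = (t/\<pi>) |Im (A 1 w)| \<le> (t/\<pi>) / h\<close>, hence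
  \<open>(h - e)\<^sup>2 \<le> t/\<pi>\<close>.
\<close>

lemma profile_density_le:
  assumes "0 < t" "0 < e"
  shows "profile_density e t x \<le> 1 / sqrt (pi * t)"
proof -
  define w where "w = subord t (Complex x e)"
  have w: "0 < Im w" "e \<le> Im w"
    using Im_subord_pos[of t "Complex x e"] Im_subord_ge[of t "Complex x e"] assms by (auto simp: w_def)
  have "Im w * N w \<le> inverse (Im w)"
    using abs_Im_le_cmod[of "A 1 w"] Im_cauchy_power_1[OF w(1)] norm_cauchy_power_le[OF w(1), of 1] by simp
  then have "t / pi * (Im w * N w) \<le> t / pi * inverse (Im w)"
    using assms by (intro mult_left_mono) auto
  then have "Im w - e \<le> t / pi * inverse (Im w)"
    using Im_subordination[of w t "Complex x e"] w subord_eq[of t "Complex x e"] assms by (simp add: w_def)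
  then have "(Im w - e) * Im w \<le> t / pi"
    using w(1) by (simp add: field_simps)
  moreover have "(Im w - e) * (Im w - e) \<le> (Im w - e) * Im w"
    using w assms by (intro mult_left_mono) auto
  ultimately have "(Im w - e)\<^sup>2 \<le> t / pi"
    by (simp add: power2_eq_square)
  then have "(Im w - e)\<^sup>2 / t\<^sup>2 \<le> t / pi / t\<^sup>2"
    by (intro divide_right_mono) auto
  then have "(profile_density e t x)\<^sup>2 \<le> 1 / (pi * t)"
    using assms by (simp add: profile_density_eq w_def power_divide power2_eq_square)
  then have "profile_density e t x \<le> sqrt (1 / (pi * t))"
    by (rule real_le_rsqrt)
  then show ?thesis by (simp add: real_sqrt_divide)
qed

text \<open>
  Since \<open>(t/\<pi>) N w \<le> 1\<close>, the real part of \<open>J\<close> is at least \<open>t/\<pi>\<close> times the Jensen gap, and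
  \<open>t \<rho> = (t/\<pi>) Im w \<cdot> N w\<close>.
\<close>

lemma Re_J_ge_density:
  assumes "0 < t" "0 < e"
  shows "2 * pi * t * (profile_density e t x)\<^sup>2 \<le> Re (J t (subord t (Complex x e)))"
proof -
  define w where "w = subord t (Complex x e)"
  have w: "0 < Im w" "e \<le> Im w"
    using Im_subord_pos[of t "Complex x e"] Im_subord_ge[of t "Complex x e"] assms by (auto simp: w_def)
  have n: "t / pi * N w = 1 - e / Im w"
    using subord_inv_dist_square[of t "Complex x e"] assms by (simp add: w_def)
  have "t * profile_density e t x = Im w - e"
    using assms by (simp add: profile_density_eq w_def)
  then have r: "t * profile_density e t x = t / pi * (Im w * N w)"
    using Im_subordination[of w t "Complex x e"] w subord_eq[of t "Complex x e"] assms by (simp add: w_def)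
  have "2 * pi * t * (profile_density e t x)\<^sup>2 = 2 * pi / t * (t * profile_density e t x)\<^sup>2"
    using assms by (simp add: power2_eq_square)
  also have "\<dots> = t / pi * (2 * (Im w)\<^sup>2 * (N w)\<^sup>2)"
    unfolding r using assms by (simp add: power2_eq_square)
  also have "\<dots> \<le> t / pi * (N w - Re (A 2 w))"
    using assms by (intro mult_left_mono Re_cauchy_power_2_gap w) auto
  also have "\<dots> = (1 - e / Im w) - t / pi * Re (A 2 w)"
    using n by (simp add: right_diff_distrib)
  also have "\<dots> \<le> 1 - t / pi * Re (A 2 w)"
    using w assms by simp
  finally show ?thesis
    by (simp add: J_def w_def)
qed

text \<open>
  The derivative of \<open>\<rho>\<^sup>3\<close> is \<open>3 \<rho>\<^sup>2 Im (1/J) / t\<close>; the factor \<open>\<rho>\<^sup>2\<close> cancels the degeneracy of the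
  lower bound \<open>Re J \<ge> 2\<pi>t\<rho>\<^sup>2\<close> where the density vanishes.
\<close>

lemma profile_density_cube_lipschitz:
  assumes "0 < t" "0 < e"
  shows "\<bar>profile_density e t x ^ 3 - profile_density e t y ^ 3\<bar> \<le> 3 / (2 * pi * t\<^sup>2) * \<bar>x - y\<bar>"
proof -
  define j where "j x = J t (subord t (Complex x e))" for x
  have der: "(profile_density e t has_real_derivative Im (1 / j x) / t) (at x)" for x
  proof -
    define z where "z = of_real x + \<i> * of_real e"
    have z: "0 < Im z" using assms by (simp add: z_def)
    have "((\<lambda>z. (t, z)) has_derivative (\<lambda>v. (0, v))) (at z)"
      by (auto intro!: derivative_eq_intros)
    from has_derivative_compose[OF this has_derivative_subord[OF assms(1) z]]
    have "(subord t has_field_derivative 1 / J t (subord t z)) (at z)"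
      by (simp add: has_field_derivative_def fun_eq_iff) (erule has_derivative_eq_rhs, simp add: fun_eq_iff)
    then have "((\<lambda>z. subord t (z + \<i> * of_real e)) has_field_derivative 1 / J t (subord t z)) (at (of_real x))"
      by (simp add: DERIV_shift z_def)
    then have "((\<lambda>x. subord t (Complex x e)) has_vector_derivative 1 / j x) (at x)"
      unfolding Complex_eq j_def z_def by (rule has_vector_derivative_real_field)
    from DERIV_cdivide[OF DERIV_diff[OF has_field_derivative_Im[OF this] DERIV_const[of e]], of t]
    show ?thesis
      unfolding profile_density_eq[OF assms, abs_def] by simp
  qed
  have "norm (profile_density e t x ^ 3 - profile_density e t y ^ 3) \<le> 3 / (2 * pi * t\<^sup>2) * norm (x - y)"
  proof (rule field_differentiable_bound[where S = UNIV])
    fix x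
    show "((\<lambda>x. profile_density e t x ^ 3) has_field_derivative 3 * (profile_density e t x)\<^sup>2 * (Im (1 / j x) / t)) (at x within UNIV)"
      using DERIV_power[OF der[of x], of 3] by (simp add: mult_ac)
    have jx: "2 * pi * t * (profile_density e t x)\<^sup>2 \<le> norm (j x)"
      using Re_J_ge_density[OF assms, of x] complex_Re_le_cmod[of "j x"] by (simp add: j_def)
    have "j x \<noteq> 0" using J_nonzero[of t "Complex x e"] assms by (simp add: j_def)
    then have jp: "0 < norm (j x)" by simp
    have "norm (3 * (profile_density e t x)\<^sup>2 * (Im (1 / j x) / t)) = 3 * (profile_density e t x)\<^sup>2 * \<bar>Im (1 / j x)\<bar> / t"
      using assms by (simp add: abs_mult)
    also have "\<dots> \<le> 3 * (profile_density e t x)\<^sup>2 * (1 / norm (j x)) / t"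
      using abs_Im_le_cmod[of "1 / j x"] assms
      by (intro divide_right_mono mult_left_mono) (auto simp: norm_divide)
    also have "\<dots> = 3 / t * ((profile_density e t x)\<^sup>2 / norm (j x))"
      by simp
    also have "\<dots> \<le> 3 / t * (1 / (2 * pi * t))"
      using jx jp assms by (intro mult_left_mono) (auto simp: field_simps)
    also have "\<dots> = 3 / (2 * pi * t\<^sup>2)"
      by (simp add: power2_eq_square)
    finally show "norm (3 * (profile_density e t x)\<^sup>2 * (Im (1 / j x) / t)) \<le> 3 / (2 * pi * t\<^sup>2)" .
  qed auto
  then show ?thesis by simp
qed

end

section \<open>Penalisations and bounded time\<close>

text \<open>
  The penalisation used to localise maxima. It is the boundary value of the imaginary part of a
  holomorphic function (\<open>bump_eq_Im\<close>), so that its half-Laplacian is covered by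
  \<open>half_laplacian_boundary_value\<close> too.
\<close>

definition bump :: "real \<Rightarrow> real" where "bump s = 1 - 1 / (1 + s\<^sup>2)"

lemma bump_pos: "0 < 1 + (s::real)\<^sup>2"
  by (simp add: add_pos_nonneg)

lemma bump_nonneg: "0 \<le> bump s"
  and bump_0: "bump 0 = 0"
  and bump_eq_0_iff: "bump s = 0 \<longleftrightarrow> s = 0"
  using bump_pos[of s] by (auto simp: bump_def divide_le_eq field_simps)

lemma bump_ge_half: "1 \<le> \<bar>s\<bar> \<Longrightarrow> 1 / 2 \<le> bump s"
  using bump_pos[of s] power_mono[of 1 "\<bar>s\<bar>" 2] by (simp add: bump_def field_simps)

lemma bump_le: "bump s \<le> s\<^sup>2"
proof -
  have "1 \<le> (1 + s\<^sup>2) * (1 + s\<^sup>2)"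
    using mult_mono[of 1 "1 + s\<^sup>2" 1 "1 + s\<^sup>2"] by simp
  then show ?thesis
    using bump_pos[of s] by (simp add: bump_def field_simps)
qed

lemma bump_has_derivative: "(bump has_real_derivative 2 * s / (1 + s\<^sup>2)\<^sup>2) (at s)"
  unfolding bump_def using bump_pos[of s]
  by (auto intro!: derivative_eq_intros simp: power2_eq_square)

lemma bump_deriv_le: "\<bar>2 * s / (1 + s\<^sup>2)\<^sup>2\<bar> \<le> (1::real)"
proof -
  have "2 * \<bar>s\<bar> \<le> 1 + s\<^sup>2"
    using sum_squares_bound[of 1 "\<bar>s\<bar>"] by simp
  also have "\<dots> \<le> (1 + s\<^sup>2)\<^sup>2"
    using self_le_power[of "1 + s\<^sup>2" 2] by simp
  finally have "2 * \<bar>s\<bar> \<le> (1 + s\<^sup>2)\<^sup>2" .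
  moreover have "0 < (1 + s\<^sup>2)\<^sup>2" using bump_pos[of s] by simp
  ultimately show ?thesis
    by (simp add: abs_mult pos_divide_le_eq)
qed

lemma bump_eq_Im: "bump s = 1 + Im (1 / (of_real s + \<i>))"
  by (simp add: bump_def Im_divide)

lemma continuous_on_bump [continuous_intros]:
  "continuous_on S f \<Longrightarrow> continuous_on S (\<lambda>x. bump (f x))"
  unfolding bump_def using bump_pos by (intro continuous_intros) (auto simp: less_le)

abbreviation spacetime :: "(real \<times> real) set" where "spacetime \<equiv> {0<..} \<times> UNIV"

lemma open_spacetime: "open spacetime"
  by (intro open_Times) auto

lemma bounded_Ck_on_bump:
  "bounded_Ck_on k spacetime (\<lambda>p. bump (\<alpha> * fst p + \<beta> * snd p + \<gamma>))"
proof -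
  define f where "f p = 1 / (of_real (\<alpha> * fst p + \<beta> * snd p + \<gamma>) + \<i>)" for p :: "real \<times> real"
  have nz: "complex_of_real s + \<i> \<noteq> 0" for s by (auto simp: complex_eq_iff)
  have "bounded_Ck_on k spacetime f"
  proof (rule bounded_Ck_on_riccati[OF open_spacetime])
    have "norm (f p) \<le> 1" for p
    proof -
      define s where "s = complex_of_real (\<alpha> * fst p + \<beta> * snd p + \<gamma>) + \<i>"
      have "1 \<le> norm s"
        using abs_Im_le_cmod[of s] by (simp add: s_def)
      moreover from this have "0 < norm s" by linarith
      ultimately show ?thesis unfolding f_def s_def[symmetric] by (simp add: norm_divide pos_divide_le_eq)
    qed
    then show "bounded (f ` spacetime)" by (auto simp: bounded_iff)
    fix p
    have "((\<lambda>p. \<alpha> * fst p + \<beta> * snd p + \<gamma>) has_derivative (\<lambda>v. \<alpha> * fst v + \<beta> * snd v)) (at p)"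
      by (auto intro!: derivative_eq_intros)
    note 1 = has_derivative_of_real[OF this, where 'a = complex]
    have "((\<lambda>z. 1 / (z + \<i>)) has_field_derivative - (1 / (of_real (\<alpha> * fst p + \<beta> * snd p + \<gamma>) + \<i>))\<^sup>2)
        (at (of_real (\<alpha> * fst p + \<beta> * snd p + \<gamma>)))"
      using nz[of "\<alpha> * fst p + \<beta> * snd p + \<gamma>"]
      by (auto intro!: derivative_eq_intros simp: power2_eq_square)
    from has_derivative_compose[OF 1 this[unfolded has_field_derivative_def]]
    have "(f has_derivative (\<lambda>v. - (f p)\<^sup>2 * of_real (\<alpha> * fst v + \<beta> * snd v))) (at p)"
      unfolding f_def[abs_def] .
    then show "(f has_derivative (\<lambda>v. - of_real (\<alpha> * fst v + \<beta> * snd v) * (f p)\<^sup>2)) (at p)"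
      by (rule has_derivative_eq_rhs) (simp add: fun_eq_iff algebra_simps)
  qed
  then have "bounded_Ck_on k spacetime (\<lambda>p. 1 + Im (f p))"
    by (intro bounded_Ck_on_add bounded_Ck_on_const bounded_Ck_on_linear_compose[OF open_spacetime bounded_linear_Im]
        open_spacetime)
  then show ?thesis
    by (simp only: bump_eq_Im f_def)
qed

text \<open>
  Test functions must have bounded derivatives of all orders on \<open>(0,\<infinity>) \<times> \<real>\<close>, whereas the available
  bounds for the derivatives of \<open>profile\<close> grow with \<open>t\<close>. Running the profile with the clock \<open>bounded_time r\<close>, which stays
  below \<open>1/r\<close>, repairs this at the price of an error in the equation that vanishes as \<open>r \<rightarrow> 0\<close>.
  The speed of this clock is \<open>(slowdown r)\<^sup>2\<close>.
\<close>

definition slowdown :: "real \<Rightarrow> real \<Rightarrow> real" where "slowdown r t = 1 / (1 + r * t)"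
definition bounded_time :: "real \<Rightarrow> real \<Rightarrow> real" where "bounded_time r t = t / (1 + r * t)"

lemma slowdown_bounds:
  assumes "0 < r" "0 \<le> t"
  shows "0 < slowdown r t" "slowdown r t \<le> 1"
proof -
  have "0 \<le> r * t" using assms by simp
  then have "1 \<le> 1 + r * t" "0 < 1 + r * t" by linarith+
  then show "0 < slowdown r t" "slowdown r t \<le> 1" by (simp_all add: slowdown_def)
qed

lemma slowdown_has_derivative:
  assumes "0 < r" "0 \<le> t"
  shows "(slowdown r has_real_derivative - r * (slowdown r t)\<^sup>2) (at t)"
proof -
  have "1 + r * t \<noteq> 0" using slowdown_bounds[OF assms] by (auto simp: slowdown_def)
  then show ?thesis
    unfolding slowdown_def by (auto intro!: derivative_eq_intros simp: power2_eq_square)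
qed

lemma bounded_time_eq:
  assumes "0 < r" "0 \<le> t"
  shows "bounded_time r t = (1 - slowdown r t) / r"
proof -
  have "1 + r * t \<noteq> 0" using slowdown_bounds[OF assms] by (auto simp: slowdown_def)
  then have "1 - slowdown r t = r * bounded_time r t"
    by (simp add: slowdown_def bounded_time_def field_simps)
  then show ?thesis
    using assms by simp
qed

lemma bounded_time_has_derivative:
  assumes "0 < r" "0 \<le> t"
  shows "(bounded_time r has_real_derivative (slowdown r t)\<^sup>2) (at t)"
proof -
  have "1 + r * t \<noteq> 0" using slowdown_bounds[OF assms] by (auto simp: slowdown_def)
  then show ?thesis
    unfolding slowdown_def bounded_time_def
    by (auto intro!: derivative_eq_intros simp: power2_eq_square field_simps)
qed

lemma bounded_time_bounds:
  assumes "0 < r" "0 \<le> t"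
  shows "0 \<le> bounded_time r t" "bounded_time r t \<le> 1 / r" "0 < t \<Longrightarrow> 0 < bounded_time r t"
  using slowdown_bounds[OF assms] assms
  by (auto simp: bounded_time_eq[OF assms] divide_right_mono slowdown_def)

lemma bounded_Ck_on_slowdown:
  assumes "0 < r"
  shows "bounded_Ck_on k spacetime (\<lambda>p. slowdown r (fst p))"
proof (rule bounded_Ck_on_riccati[OF open_spacetime])
  show "bounded ((\<lambda>p. slowdown r (fst p)) ` spacetime)"
    using slowdown_bounds[OF assms] by (intro boundedI[where B = 1]) (auto simp: less_imp_le)
  fix p :: "real \<times> real" assume "p \<in> spacetime"
  then have "0 \<le> fst p" by auto
  from has_derivative_compose[OF has_derivative_fst[OF has_derivative_ident]
      slowdown_has_derivative[OF assms this, unfolded has_field_derivative_def]]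
  show "((\<lambda>p. slowdown r (fst p)) has_derivative (\<lambda>v. - r * fst v * (slowdown r (fst p))\<^sup>2)) (at p)"
    by (simp add: mult_ac)
qed

context sqrt_integrable_transforms
begin

lemma Im_subord_le:
  assumes "0 \<le> t" "0 < Im z"
  shows "Im (subord t z) \<le> Im z + t / (pi * Im z)"
  using norm_subord_diff_le[OF assms] abs_Im_le_cmod[of "subord t z - z"] by simp

context
  fixes r e c :: real
  assumes r: "0 < r" and e: "0 < e"
begin

private definition point where "point p = (bounded_time r (fst p), Complex (snd p + c) e)"
private definition w where "w p = subord (fst (point p)) (snd (point p))"
private definition a where "a k p = A k (w p)"
private definition d where "d p = 1 / J (bounded_time r (fst p)) (w p)"
private definition \<sigma> where "\<sigma> p = complex_of_real (slowdown r (fst p))"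

private lemma point_in: "p \<in> spacetime \<Longrightarrow> 0 < fst (point p) \<and> 0 < Im (snd (point p))"
  using bounded_time_bounds[OF r, of "fst p"] e by (auto simp: point_def)

private lemma point_has_derivative:
  assumes "p \<in> spacetime"
  shows "(point has_derivative (\<lambda>v. ((slowdown r (fst p))\<^sup>2 * fst v, of_real (snd v)))) (at p)"
proof -
  have "((\<lambda>p. bounded_time r (fst p)) has_derivative (\<lambda>v. (slowdown r (fst p))\<^sup>2 * fst v)) (at p)"
    using has_derivative_compose[OF has_derivative_fst[OF has_derivative_ident]
      bounded_time_has_derivative[OF r, of "fst p", unfolded has_field_derivative_def]] assms
    by auto
  moreover have "((\<lambda>p. Complex (snd p + c) e) has_derivative (\<lambda>v. of_real (snd v))) (at p)"
    unfolding Complex_eq by (auto intro!: derivative_eq_intros)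
  ultimately show ?thesis
    unfolding point_def[abs_def] by (rule has_derivative_Pair)
qed

private lemma w_has_derivative:
  assumes "p \<in> spacetime"
  shows "(w has_derivative (\<lambda>v. (of_real (snd v) - of_real (fst v / pi) * (\<sigma> p)\<^sup>2 * a 1 p) * d p)) (at p)"
proof -
  have "((\<lambda>q. subord (fst q) (snd q)) has_derivative
     (\<lambda>v. (snd v - of_real (fst v / pi) * A 1 (w p)) / J (fst (point p)) (w p))) (at (point p))"
    using has_derivative_subord[of "fst (point p)" "snd (point p)"] point_in[OF assms] by (simp add: w_def)
  from has_derivative_compose[OF point_has_derivative[OF assms] this] show ?thesis
    unfolding w_def[abs_def, symmetric]
    by (rule has_derivative_eq_rhs) (simp add: fun_eq_iff a_def d_def \<sigma>_def point_def field_simps)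
qed

private lemma Im_w: "p \<in> spacetime \<Longrightarrow> 0 < Im (w p)"
  using Im_subord_pos[of "fst (point p)" "snd (point p)"] point_in[of p] by (auto simp: w_def)

private lemma a_has_derivative:
  assumes "p \<in> spacetime"
  shows "(a k has_derivative (\<lambda>v. - of_nat k * a (Suc k) p *
    ((of_real (snd v) - of_real (fst v / pi) * (\<sigma> p)\<^sup>2 * a 1 p) * d p))) (at p)"
  using has_derivative_compose[OF w_has_derivative[OF assms]
      has_field_derivative_cauchy_power[OF Im_w[OF assms], of k, unfolded has_field_derivative_def]]
  by (simp add: a_def[abs_def])

private lemma J_ne: "p \<in> spacetime \<Longrightarrow> J (bounded_time r (fst p)) (w p) \<noteq> 0"
  using J_nonzero[of "fst (point p)" "snd (point p)"] point_in[of p] by (auto simp: w_def point_def)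

private lemma d_has_derivative:
  assumes "p \<in> spacetime"
  shows "(d has_derivative (\<lambda>v. (of_real (fst v / pi) * (\<sigma> p)\<^sup>2 * a 2 p
    + of_real (1 / (r * pi)) * (1 - \<sigma> p) * (- 2 * a 3 p *
      ((of_real (snd v) - of_real (fst v / pi) * (\<sigma> p)\<^sup>2 * a 1 p) * d p))) * (d p)\<^sup>2)) (at p)"
proof -
  define a2' where "a2' v = - of_nat 2 * a (Suc 2) p *
    ((of_real (snd v) - of_real (fst v / pi) * (\<sigma> p)\<^sup>2 * a 1 p) * d p)" for v
  have da: "(a 2 has_derivative a2') (at p)"
    unfolding a2'_def[abs_def] by (rule a_has_derivative[OF assms])
  have "((\<lambda>p. bounded_time r (fst p) / pi) has_derivative (\<lambda>v. (slowdown r (fst p))\<^sup>2 * fst v / pi)) (at p)"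
    using has_derivative_fst[OF point_has_derivative[OF assms]]
    by (auto intro!: derivative_eq_intros simp: point_def)
  note dt = has_derivative_of_real[OF this, where 'a = complex]
  have dJ: "((\<lambda>p. J (bounded_time r (fst p)) (w p)) has_derivative
      (\<lambda>v. 0 - (of_real (bounded_time r (fst p) / pi) * a2' v + of_real ((slowdown r (fst p))\<^sup>2 * fst v / pi) * a 2 p))) (at p)"
    unfolding J_def a_def[symmetric]
    by (intro has_derivative_diff has_derivative_const has_derivative_mult[OF dt da])
  have inv: "((\<lambda>z. 1 / z) has_field_derivative - (d p)\<^sup>2) (at (J (bounded_time r (fst p)) (w p)))"
    using J_ne[OF assms] by (auto intro!: derivative_eq_intros simp: d_def power2_eq_square)
  have gen: "- D * (0 - (T * X + U * B)) = (U * B + T * X) * D" for D T X U B :: complex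
    by (simp add: algebra_simps)
  have "bounded_time r (fst p) / pi = 1 / (r * pi) * (1 - slowdown r (fst p))"
    using bounded_time_eq[OF r, of "fst p"] assms by auto
  then have e1: "complex_of_real (bounded_time r (fst p) / pi) = of_real (1 / (r * pi)) * (1 - \<sigma> p)"
    by (simp only:) (simp add: \<sigma>_def)
  have e2: "complex_of_real ((slowdown r (fst p))\<^sup>2 * fst v / pi) = of_real (fst v / pi) * (\<sigma> p)\<^sup>2"
    for v :: "real \<times> real"
    by (simp add: \<sigma>_def)
  have e3: "- of_nat 2 * a (Suc 2) p = - 2 * a 3 p" by (simp add: numeral_3_eq_3 numeral_2_eq_2)
  from has_derivative_compose[OF dJ inv[unfolded has_field_derivative_def]]
  show ?thesis
    unfolding d_def[abs_def, symmetric] gen e1 e2 a2'_def e3 .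
qed

private lemma bounded_a: "bounded (a k ` spacetime)"
proof (rule boundedI)
  fix y assume "y \<in> a k ` spacetime"
  then obtain p where p: "p \<in> spacetime" "y = a k p" by auto
  show "norm y \<le> inverse e ^ k"
    using norm_A_subord_le[of "fst (point p)" "snd (point p)" k] point_in[OF p(1)]
    by (simp add: p(2) a_def w_def) (simp add: point_def)
qed

private lemma bounded_d: "bounded (d ` spacetime)"
proof (rule boundedI)
  fix y assume "y \<in> d ` spacetime"
  then obtain p where p: "p \<in> spacetime" "y = d p" by auto
  define t where "t = bounded_time r (fst p)"
  have t: "0 < t" "t \<le> 1 / r"
    using bounded_time_bounds[OF r, of "fst p"] p by (auto simp: t_def)
  have w: "w p = subord t (Complex (snd p + c) e)" by (simp add: w_def point_def t_def)
  have "Im (w p) \<le> e + t / (pi * e)"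
    using Im_subord_le[of t "Complex (snd p + c) e"] t e by (simp add: w)
  also have "\<dots> \<le> e + (1 / r) / (pi * e)"
    using t e by (intro add_left_mono divide_right_mono) auto
  finally have h: "Im (w p) \<le> e + (1 / r) / (pi * e)" .
  have "e / Im (w p) \<le> norm (J t (w p))"
    using Re_J_ge[of t "Complex (snd p + c) e"] complex_Re_le_cmod[of "J t (w p)"] t e by (simp add: w)
  then have "1 / norm (J t (w p)) \<le> Im (w p) / e"
    using Im_w[OF p(1)] e J_ne[OF p(1)] by (simp add: t_def[symmetric] field_simps)
  also have "\<dots> \<le> (e + (1 / r) / (pi * e)) / e"
    using h e by (intro divide_right_mono) auto
  finally show "norm y \<le> (e + (1 / r) / (pi * e)) / e"
    by (simp add: p(2) d_def norm_divide t_def)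
qed

private lemma bounded_Ck_on_sigma: "bounded_Ck_on k spacetime \<sigma>"
  unfolding \<sigma>_def[abs_def]
  by (intro bounded_Ck_on_linear_compose[OF open_spacetime bounded_linear_of_real] bounded_Ck_on_slowdown[OF r])

text \<open>
  The functions \<open>a k\<close>, \<open>d\<close> and \<open>\<sigma>\<close> are bounded, and their derivatives are polynomials in them.
  This closes the induction on the order of differentiation.
\<close>

private lemma bounded_Ck_on_a_d: "(\<forall>m. bounded_Ck_on k spacetime (a m)) \<and> bounded_Ck_on k spacetime d"
proof (induction k)
  case 0
  then show ?case
    using bounded_a bounded_d a_has_derivative d_has_derivative
    by (auto intro!: continuous_at_imp_continuous_on has_derivative_continuous)
next
  case (Suc k)
  note rules = bounded_Ck_on_diff[OF open_spacetime] bounded_Ck_on_add[OF open_spacetime] bounded_Ck_on_mult[OF open_spacetime]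
    bounded_Ck_on_power[OF open_spacetime] bounded_Ck_on_const[OF open_spacetime] bounded_Ck_on_sigma
  have ih: "bounded_Ck_on k spacetime (a m)" "bounded_Ck_on k spacetime d" for m
    using Suc by auto
  have "bounded_Ck_on (Suc k) spacetime (a m)" for m
    by (rule bounded_Ck_on_SucI[OF open_spacetime bounded_a a_has_derivative]) (assumption, intro rules ih)
  moreover have "bounded_Ck_on (Suc k) spacetime d"
    by (rule bounded_Ck_on_SucI[OF open_spacetime bounded_d d_has_derivative]) (assumption, intro rules ih)
  ultimately show ?case by blast
qed

lemma profile_point_has_derivative:
  assumes "p \<in> spacetime"
  defines "a1 \<equiv> A 1 (subord (bounded_time r (fst p)) (Complex (snd p + c) e))"
  shows "((\<lambda>p. profile e (bounded_time r (fst p)) (snd p + c)) has_derivative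
    (\<lambda>v. (slowdown r (fst p))\<^sup>2 * fst v * Im (a1\<^sup>2) / (2 * pi\<^sup>2) - snd v * Im a1 / pi)) (at p)"
proof -
  have a1: "a1 = A 1 (w p)" by (simp add: a1_def w_def point_def)
  have "((\<lambda>q. potential (fst q) (snd q)) has_derivative
    (\<lambda>v. a1 * snd v - of_real (fst v / (2 * pi)) * a1\<^sup>2)) (at (point p))"
    using has_derivative_potential[of "fst (point p)" "snd (point p)"] point_in[OF assms(1)]
    by (simp add: a1 w_def)
  from has_derivative_compose[OF point_has_derivative[OF assms(1)] this]
  have "((\<lambda>p. Im (potential (fst (point p)) (snd (point p)))) has_derivative
     (\<lambda>v. Im (a1 * of_real (snd v) - of_real ((slowdown r (fst p))\<^sup>2 * fst v / (2 * pi)) * a1\<^sup>2))) (at p)"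
    by (intro has_derivative_Im) simp
  then have "((\<lambda>p. 1 - Im (potential (fst (point p)) (snd (point p))) / pi) has_derivative
     (\<lambda>v. 0 - Im (a1 * of_real (snd v) - of_real ((slowdown r (fst p))\<^sup>2 * fst v / (2 * pi)) * a1\<^sup>2) / pi)) (at p)"
    by (intro has_derivative_diff has_derivative_const bounded_linear.has_derivative[OF bounded_linear_divide])
  then show ?thesis
    unfolding profile_def point_def fst_conv snd_conv
    by (rule has_derivative_eq_rhs) (simp add: fun_eq_iff diff_divide_distrib power2_eq_square[of pi] mult_ac)
qed

lemma bounded_Ck_on_profile_point:
  "bounded_Ck_on k spacetime (\<lambda>p. profile e (bounded_time r (fst p)) (snd p + c))"
proof -
  have "bounded_Ck_on (Suc k) spacetime (\<lambda>p. profile e (bounded_time r (fst p)) (snd p + c))"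
  proof (rule bounded_Ck_on_SucI[OF open_spacetime _ profile_point_has_derivative])
    show "bounded ((\<lambda>p. profile e (bounded_time r (fst p)) (snd p + c)) ` spacetime)"
    proof (rule boundedI[where B = 2])
      fix y assume "y \<in> (\<lambda>p. profile e (bounded_time r (fst p)) (snd p + c)) ` spacetime"
      then obtain p where p: "p \<in> spacetime" "y = profile e (bounded_time r (fst p)) (snd p + c)" by auto
      then have "0 \<le> bounded_time r (fst p)" using bounded_time_bounds(1)[OF r, of "fst p"] by auto
      from profile_bounds[OF this e, of "snd p + c"] show "norm y \<le> 2"
        by (simp add: p(2))
    qed
    have a1: "A 1 (subord (bounded_time r (fst p)) (Complex (snd p + c) e)) = a 1 p" for p
      by (simp add: a_def w_def point_def)
    show "bounded_Ck_on k spacetime (\<lambda>p. (slowdown r (fst p))\<^sup>2 * fst v *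
        Im ((A 1 (subord (bounded_time r (fst p)) (Complex (snd p + c) e)))\<^sup>2) / (2 * pi\<^sup>2)
        - snd v * Im (A 1 (subord (bounded_time r (fst p)) (Complex (snd p + c) e))) / pi)" for v :: "real \<times> real"
      unfolding a1
      by (intro bounded_Ck_on_diff[OF open_spacetime] bounded_Ck_on_mult[OF open_spacetime]
          bounded_Ck_on_linear_compose[OF open_spacetime bounded_linear_divide]
          bounded_Ck_on_linear_compose[OF open_spacetime bounded_linear_Im]
          bounded_Ck_on_power[OF open_spacetime] bounded_Ck_on_const[OF open_spacetime]
          bounded_Ck_on_slowdown[OF r] bounded_Ck_on_a_d[THEN conjunct1, rule_format])
  qed
  then show ?thesis by (rule bounded_Ck_on_decr)
qed

end

lemma norm_potential_le:
  assumes t: "0 \<le> t" and e: "0 < e" "e \<le> Im z"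
  shows "norm (potential t z) \<le> 2 * sqrt (norm z) +
    (2 * sqrt (t / (pi * e)) + 2 * (\<integral>y. sqrt \<bar>y\<bar> \<partial>M) + inverse e + pi + t / (2 * pi) * (inverse e)\<^sup>2)"
proof -
  have z: "0 < Im z" using e by linarith
  define w where "w = subord t z"
  have w: "0 < Im w" "Im z \<le> Im w"
    using Im_subord_pos[OF t z] Im_subord_ge[OF t z] by (auto simp: w_def)
  have "t / (pi * Im z) \<le> t / (pi * e)"
    using t e z by (intro divide_left_mono mult_left_mono) auto
  then have "norm w \<le> norm z + t / (pi * e)"
    using norm_subord_diff_le[OF t z] norm_triangle_ineq2[of w z] by (simp add: w_def)
  then have "sqrt (norm w) \<le> sqrt (norm z + t / (pi * e))" by simp
  also have "\<dots> \<le> sqrt (norm z) + sqrt (t / (pi * e))"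
    using t e by (intro sqrt_add_le_add_sqrt) auto
  finally have 1: "sqrt (norm w) \<le> sqrt (norm z) + sqrt (t / (pi * e))" .
  have 2: "inverse (Im w) \<le> inverse e" using w e by (intro le_imp_inverse_le) auto
  have "norm (A 1 w) \<le> inverse e"
    using norm_cauchy_power_le[OF w(1), of 1] 2 by simp
  then have "t / (2 * pi) * (norm (A 1 w))\<^sup>2 \<le> t / (2 * pi) * (inverse e)\<^sup>2"
    using t by (intro mult_left_mono power_mono) auto
  then have 3: "norm (of_real (t / (2 * pi)) * (A 1 w)\<^sup>2) \<le> t / (2 * pi) * (inverse e)\<^sup>2"
    using t by (simp add: norm_mult norm_power norm_divide)
  have "norm (potential t z) \<le> norm (log_potential w) + norm (of_real (t / (2 * pi)) * (A 1 w)\<^sup>2)"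
    unfolding potential_def w_def by (rule norm_triangle_ineq)
  then show ?thesis
    using norm_log_potential_le[OF w(1)] 1 2 3 by linarith
qed

end

section \<open>Barriers\<close>

context sqrt_integrable_transforms
begin

text \<open>
  At \<open>(t0, x0)\<close> this will be a strict supersolution for \<open>s = 1\<close> and a strict subsolution for \<open>s = -1\<close>.
  The term with \<open>\<eta>\<close> increases in time and provides the strictness; the term with \<open>bump (r * snd p)\<close>
  keeps maximising sequences bounded; the last term makes the contact point \<open>(t0, x0)\<close> a strict maximum. The last two are of order \<open>r\<close> in the equation.
\<close>

definition barrier where
  "barrier r e c \<eta> b s t0 x0 p = profile e (bounded_time r (fst p)) (snd p + c)
     + s * (b + 6 * (1 - slowdown \<eta> (fst p)) + 6 * bump (r * snd p) + r * (bump (fst p - t0) + bump (snd p - x0)))"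

lemma bounded_smooth_on_barrier:
  assumes "0 < r" "0 < e" "0 < \<eta>"
  shows "bounded_smooth_on spacetime (barrier r e c \<eta> b s t0 x0)"
  unfolding bounded_smooth_on_def barrier_def[abs_def]
proof
  fix k
  have "bounded_Ck_on k spacetime (\<lambda>p. bump (r * snd p))"
    "bounded_Ck_on k spacetime (\<lambda>p. bump (fst p - t0))"
    "bounded_Ck_on k spacetime (\<lambda>p. bump (snd p - x0))"
    using bounded_Ck_on_bump[of k 0 r 0] bounded_Ck_on_bump[of k 1 0 "-t0"] bounded_Ck_on_bump[of k 0 1 "-x0"]
    by simp_all
  then show "bounded_Ck_on k spacetime (\<lambda>p. profile e (bounded_time r (fst p)) (snd p + c)
     + s * (b + 6 * (1 - slowdown \<eta> (fst p)) + 6 * bump (r * snd p) + r * (bump (fst p - t0) + bump (snd p - x0))))"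
    using assms
    by (intro bounded_Ck_on_add[OF open_spacetime] bounded_Ck_on_mult[OF open_spacetime]
        bounded_Ck_on_diff[OF open_spacetime] bounded_Ck_on_const[OF open_spacetime]
        bounded_Ck_on_profile_point bounded_Ck_on_slowdown)
qed

context
  fixes r e c \<eta> b s t0 x0 :: real
  assumes r: "0 < r" and e: "0 < e" and \<eta>: "0 < \<eta>" and t0: "0 < t0"
begin

private definition a1 where "a1 = A 1 (subord (bounded_time r t0) (Complex (x0 + c) e))"
private abbreviation \<phi> where "\<phi> \<equiv> barrier r e c \<eta> b s t0 x0"

private lemma deriv_t:
  "deriv (\<lambda>t. \<phi> (t, x0)) t0 = (slowdown r t0)\<^sup>2 * Im (a1\<^sup>2) / (2 * pi\<^sup>2) + s * (6 * \<eta> * (slowdown \<eta> t0)\<^sup>2)"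
proof (rule DERIV_imp_deriv)
  have "((\<lambda>t. (t, x0)) has_derivative (\<lambda>h. (h, 0))) (at t0)"
    by (auto intro!: derivative_eq_intros)
  from has_derivative_compose[OF this, OF profile_point_has_derivative[of r e "(t0, x0)" c]]
  have 1: "((\<lambda>t. profile e (bounded_time r t) (x0 + c)) has_real_derivative (slowdown r t0)\<^sup>2 * Im (a1\<^sup>2) / (2 * pi\<^sup>2)) (at t0)"
    using r e t0 by (simp add: a1_def has_field_derivative_def mult_ac)
      (erule has_derivative_eq_rhs, simp add: fun_eq_iff)
  have 2: "(slowdown \<eta> has_real_derivative - \<eta> * (slowdown \<eta> t0)\<^sup>2) (at t0)"
    using slowdown_has_derivative[of \<eta> t0] \<eta> t0 by simp
  have 3: "((\<lambda>t. bump (t - t0)) has_real_derivative 0) (at t0)"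
    using bump_has_derivative[of 0] DERIV_shift[of bump 0 t0 "- t0"] by simp
  show "((\<lambda>t. \<phi> (t, x0)) has_real_derivative
      (slowdown r t0)\<^sup>2 * Im (a1\<^sup>2) / (2 * pi\<^sup>2) + s * (6 * \<eta> * (slowdown \<eta> t0)\<^sup>2)) (at t0)"
    unfolding barrier_def fst_conv snd_conv
    by (rule derivative_eq_intros 1 2 3 refl | simp)+
qed

private lemma deriv_x:
  "deriv (\<lambda>x. \<phi> (t0, x)) x0 = - Im a1 / pi + s * (6 * r * (2 * (r * x0) / (1 + (r * x0)\<^sup>2)\<^sup>2))"
proof (rule DERIV_imp_deriv)
  have "((\<lambda>x. (t0, x)) has_derivative (\<lambda>h. (0, h))) (at x0)"
    by (auto intro!: derivative_eq_intros)
  from has_derivative_compose[OF this, OF profile_point_has_derivative[of r e "(t0, x0)" c]]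
  have 1: "((\<lambda>x. profile e (bounded_time r t0) (x + c)) has_real_derivative - Im a1 / pi) (at x0)"
    using r e t0 by (simp add: a1_def has_field_derivative_def mult_ac)
      (erule has_derivative_eq_rhs, simp add: fun_eq_iff)
  have "((\<lambda>x. r * x) has_real_derivative r) (at x0)"
    by (auto intro!: derivative_eq_intros)
  from DERIV_chain2[OF bump_has_derivative this]
  have 2: "((\<lambda>x. bump (r * x)) has_real_derivative 2 * (r * x0) / (1 + (r * x0)\<^sup>2)\<^sup>2 * r) (at x0)" .
  have 3: "((\<lambda>x. bump (x - x0)) has_real_derivative 0) (at x0)"
    using bump_has_derivative[of 0] DERIV_shift[of bump 0 x0 "- x0"] by simp
  show "((\<lambda>x. \<phi> (t0, x)) has_real_derivative
      - Im a1 / pi + s * (6 * r * (2 * (r * x0) / (1 + (r * x0)\<^sup>2)\<^sup>2))) (at x0)"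
    unfolding barrier_def fst_conv snd_conv
    by (rule derivative_eq_intros 1 2 3 refl | simp)+
qed

text \<open>
  On the line the barrier is the imaginary part of an explicit holomorphic function.
\<close>

private lemma half_laplacian_barrier:
  "half_laplacian (\<lambda>x. \<phi> (t0, x)) x0
     = Re a1 / pi + s * r * (6 * Re (1 / (of_real (r * x0) + \<i>)\<^sup>2) - 1)"
proof -
  define \<tau> where "\<tau> = bounded_time r t0"
  have \<tau>: "0 < \<tau>" using bounded_time_bounds[OF r, of t0] t0 by (simp add: \<tau>_def)
  define K where "K = 1 + s * (b + 6 * (1 - slowdown \<eta> t0) + 6 + r)"
  define W where "W z = \<i> * of_real K - potential \<tau> (z + (of_real c + \<i> * of_real e)) / of_real pi
      + of_real s * (6 * (1 / (of_real r * z + \<i>)) + of_real r * (1 / (z - of_real x0 + \<i>)))" for z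
  have W_eq: "Im (W (of_real x)) = \<phi> (t0, x)" for x
  proof -
    have "Im (1 / (of_real r * of_real x + \<i>)) = bump (r * x) - 1"
      using bump_eq_Im[of "r * x"] by simp
    moreover have "Im (1 / (of_real x - of_real x0 + \<i>)) = bump (x - x0) - 1"
      using bump_eq_Im[of "x - x0"] by simp
    moreover have "of_real x + (of_real c + \<i> * of_real e) = Complex (x + c) e"
      by (simp add: complex_eq_iff)
    moreover have "Im (\<i> * of_real K - P / of_real pi + of_real s * (6 * X + of_real r * Y))
        = K - Im P / pi + s * (6 * Im X + r * Im Y)" for P X Y
      by simp
    ultimately have "Im (W (of_real x)) = K - Im (potential \<tau> (Complex (x + c) e)) / pi
        + s * (6 * (bump (r * x) - 1) + r * (bump (x - x0) - 1))"
      unfolding W_def by (simp only:)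
    then show ?thesis
      unfolding barrier_def profile_def K_def \<tau>_def fst_conv snd_conv
      by (simp add: bump_0 algebra_simps)
  qed
  define m where "m = min e (min (1 / r) 1)"
  have m1: "m \<le> 1 / r" by (simp add: m_def)
  have m: "0 < m" "m \<le> e" "m * r \<le> 1" "m \<le> 1"
    using e r m1 pos_le_divide_eq[OF r, of m 1] by (auto simp: m_def)
  have nz: "of_real r * z + \<i> \<noteq> 0" "z - of_real x0 + \<i> \<noteq> 0" "0 < Im (z + (of_real c + \<i> * of_real e))"
    if z: "- m < Im z" for z
  proof -
    have "- (m * r) < Im z * r" using z r by (metis mult_minus_left mult_strict_right_mono)
    then have "0 < Im (of_real r * z + \<i>)" using m(3) by (simp add: mult.commute)
    then show "of_real r * z + \<i> \<noteq> 0" by (metis less_irrefl zero_complex.sel(2))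
    have "0 < Im (z - of_real x0 + \<i>)" using z m by simp
    then show "z - of_real x0 + \<i> \<noteq> 0" by (metis less_irrefl zero_complex.sel(2))
    show "0 < Im (z + (of_real c + \<i> * of_real e))" using z m by simp
  qed
  have dW: "(W has_field_derivative
      - A 1 (subord \<tau> (z + (of_real c + \<i> * of_real e))) / of_real pi
      + of_real s * (6 * (- of_real r * (1 / (of_real r * z + \<i>)\<^sup>2)) + of_real r * (- (1 / (z - of_real x0 + \<i>)\<^sup>2)))) (at z)"
    if z: "- m < Im z" for z
  proof -
    have 1: "((\<lambda>z. potential \<tau> (z + (of_real c + \<i> * of_real e))) has_field_derivative
        A 1 (subord \<tau> (z + (of_real c + \<i> * of_real e)))) (at z)"
      using has_field_derivative_potential[OF \<tau> nz(3)[OF z]] by (simp only: DERIV_shift)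
    have 2: "((\<lambda>z. 1 / (of_real r * z + \<i>)) has_field_derivative - of_real r * (1 / (of_real r * z + \<i>)\<^sup>2)) (at z)"
      using nz[OF z] by (auto intro!: derivative_eq_intros simp: power2_eq_square)
    have 3: "((\<lambda>z. 1 / (z - of_real x0 + \<i>)) has_field_derivative - (1 / (z - of_real x0 + \<i>)\<^sup>2)) (at z)"
      using nz[OF z] by (auto intro!: derivative_eq_intros simp: power2_eq_square)
    have "(W has_field_derivative 0
      - A 1 (subord \<tau> (z + (of_real c + \<i> * of_real e))) / of_real pi
      + of_real s * (6 * (- of_real r * (1 / (of_real r * z + \<i>)\<^sup>2)) + of_real r * (- (1 / (z - of_real x0 + \<i>)\<^sup>2)))) (at z)"
      unfolding W_def
      by (intro DERIV_add DERIV_diff DERIV_const DERIV_cdivide DERIV_cmult 1 2 3)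
    then show ?thesis by simp
  qed
  obtain B where B: "\<And>p. p \<in> spacetime \<Longrightarrow> \<bar>\<phi> p\<bar> \<le> B"
    using bounded_Ck_on_imp_bounded[of 0 spacetime \<phi>] bounded_smooth_on_barrier[OF r e \<eta>]
    unfolding bounded_smooth_on_def bounded_iff by (metis image_eqI real_norm_def)
  define K1 where "K1 = 2 * sqrt (\<tau> / (pi * e)) + 2 * (\<integral>y. sqrt \<bar>y\<bar> \<partial>M) + inverse e + pi + \<tau> / (2 * pi) * (inverse e)\<^sup>2"
  define K2 where "K2 = \<bar>K\<bar> + 2 * sqrt (norm (of_real c + \<i> * of_real e)) + \<bar>K1\<bar> + \<bar>s\<bar> * (6 + r)"
  have "half_laplacian (\<lambda>x. Im (W (of_real x))) x0 = - Re (deriv W (of_real x0))"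
  proof (rule half_laplacian_boundary_value[OF m(1)])
    show "W holomorphic_on {z. - m < Im z}"
      unfolding holomorphic_on_def field_differentiable_def
      using dW by (blast intro: has_field_derivative_at_within)
    show "\<bar>Im (W (of_real y))\<bar> \<le> B" for y
      unfolding W_eq using B t0 by simp
    fix z :: complex assume z: "0 \<le> Im z"
    have "norm (potential \<tau> (z + (of_real c + \<i> * of_real e)))
        \<le> 2 * sqrt (norm (z + (of_real c + \<i> * of_real e))) + K1"
      using norm_potential_le[of \<tau> e "z + (of_real c + \<i> * of_real e)"] \<tau> e z by (simp add: K1_def)
    also have "sqrt (norm (z + (of_real c + \<i> * of_real e))) \<le> sqrt (norm z + norm (of_real c + \<i> * of_real e))"
      using norm_triangle_ineq by (intro real_sqrt_le_mono)
    also have "\<dots> \<le> sqrt (norm z) + sqrt (norm (of_real c + \<i> * of_real e))"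
      by (intro sqrt_add_le_add_sqrt) auto
    finally have pot: "norm (potential \<tau> (z + (of_real c + \<i> * of_real e)))
        \<le> 2 * sqrt (norm z) + 2 * sqrt (norm (of_real c + \<i> * of_real e)) + \<bar>K1\<bar>"
      by simp
    have pot': "norm (potential \<tau> (z + (of_real c + \<i> * of_real e)) / of_real pi)
        \<le> 2 * sqrt (norm z) + 2 * sqrt (norm (of_real c + \<i> * of_real e)) + \<bar>K1\<bar>"
    proof -
      have "norm (potential \<tau> (z + (of_real c + \<i> * of_real e))) / pi
          \<le> norm (potential \<tau> (z + (of_real c + \<i> * of_real e))) / 1"
        using pi_gt3 by (intro divide_left_mono) auto
      then show ?thesis using pot by (simp add: norm_divide)
    qed
    have inv: "norm (1 / v) \<le> 1" if "1 \<le> Im v" for v :: complex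
      using abs_Im_le_cmod[of v] that by (simp add: norm_divide divide_le_eq_1)
    have i: "norm (1 / (of_real r * z + \<i>)) \<le> 1" "norm (1 / (z - of_real x0 + \<i>)) \<le> 1"
      using z r by (auto intro!: inv)
    have q: "norm (of_real s * (6 * (1 / (of_real r * z + \<i>)) + of_real r * (1 / (z - of_real x0 + \<i>)))) \<le> \<bar>s\<bar> * (6 + r)"
    proof -
      have "norm (6 * (1 / (of_real r * z + \<i>)) + of_real r * (1 / (z - of_real x0 + \<i>)))
          \<le> 6 * norm (1 / (of_real r * z + \<i>)) + r * norm (1 / (z - of_real x0 + \<i>))"
        using norm_triangle_ineq[of "6 * (1 / (of_real r * z + \<i>))" "of_real r * (1 / (z - of_real x0 + \<i>))"] r
        by (simp only: norm_mult norm_of_real norm_numeral abs_of_pos)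
      also have "\<dots> \<le> 6 * 1 + r * 1"
        using i r by (intro add_mono mult_left_mono) auto
      finally show ?thesis by (simp only: norm_mult norm_of_real) (simp add: mult_left_mono)
    qed
    have "norm (W z) \<le> \<bar>K\<bar> + norm (potential \<tau> (z + (of_real c + \<i> * of_real e)) / of_real pi)
       + norm (of_real s * (6 * (1 / (of_real r * z + \<i>)) + of_real r * (1 / (z - of_real x0 + \<i>))))"
      unfolding W_def
      by (rule order_trans[OF norm_triangle_ineq add_mono[OF order_trans[OF norm_triangle_ineq4] order_refl]])
        (simp add: norm_mult)
    also have "\<dots> \<le> 2 * sqrt (norm z) + K2"
      using pot' q by (simp add: K2_def)
    also have "\<dots> \<le> (2 + K2) * (1 + sqrt (norm z))"
    proof -
      have "0 \<le> K2" using r by (auto simp: K2_def intro!: add_nonneg_nonneg)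
      then have "0 \<le> K2 * sqrt (norm z)" by simp
      then show ?thesis by (simp add: algebra_simps)
    qed
    finally show "norm (W z) \<le> (2 + K2) * (1 + sqrt (norm z))" .
  qed
  moreover have "deriv W (of_real x0) = - a1 / of_real pi
      + of_real s * (6 * (- of_real r * (1 / (of_real r * of_real x0 + \<i>)\<^sup>2)) + of_real r * (- (1 / (of_real x0 - of_real x0 + \<i>)\<^sup>2)))"
  proof -
    have "of_real x0 + (of_real c + \<i> * of_real e) = Complex (x0 + c) e"
      by (simp add: complex_eq_iff)
    then show ?thesis
      using DERIV_imp_deriv[OF dW[of "of_real x0"]] m by (simp add: a1_def \<tau>_def)
  qed
  moreover have "- Re (- a1 / of_real pi + of_real s * (6 * (- of_real r * X) + of_real r * (- Y)))
      = Re a1 / pi + s * r * (6 * Re X + Re Y)" for X Y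
    by (simp add: algebra_simps)
  moreover have "Re (1 / (of_real x0 - of_real x0 + \<i>)\<^sup>2) = - 1"
    by simp
  ultimately have "half_laplacian (\<lambda>x. \<phi> (t0, x)) x0
      = Re a1 / pi + s * r * (6 * Re (1 / (of_real r * of_real x0 + \<i>)\<^sup>2) + - 1)"
    unfolding W_eq by (simp only:)
  then show ?thesis by simp
qed

text \<open>
  With \<open>u = \<partial>\<^sub>x profile\<close> and \<open>v = (-\<Delta>)\<^sup>1\<^sup>/\<^sup>2 profile\<close>, the smooth solution satisfies \<open>\<partial>\<^sub>t profile = - u v\<close>.
  What is left after this cancellation is the gain \<open>q \<ge> \<eta>\<close> from the increasing term and errors of order
  \<open>r\<close>, listed in \<open>expand\<close>.
\<close>

lemma barrier_strict_supersolution: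
  assumes s: "s = 1 \<or> s = -1" and t0': "\<eta> * t0 \<le> 1" and r1: "r \<le> 1"
    and small: "r * (2 * (inverse e)\<^sup>2 / \<eta> + 13 * inverse e + 42) < \<eta>"
  shows "0 < s * integrated_dyson_operator \<phi> t0 x0"
proof -
  define k where "k = inverse e"
  define u where "u = - Im a1 / pi"
  define v where "v = Re a1 / pi"
  define \<beta> where "\<beta> = 2 * (r * x0) / (1 + (r * x0)\<^sup>2)\<^sup>2"
  define \<gamma> where "\<gamma> = 6 * Re (1 / (of_real (r * x0) + \<i>)\<^sup>2) - 1"
  define \<sigma> where "\<sigma> = (slowdown r t0)\<^sup>2"
  define q where "q = 6 * \<eta> * (slowdown \<eta> t0)\<^sup>2"
  have op: "integrated_dyson_operator \<phi> t0 x0 = (- \<sigma> * (u * v) + s * q) + (u + s * (6 * r * \<beta>)) * (v + s * r * \<gamma>)"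
    unfolding integrated_dyson_operator_def deriv_t deriv_x half_laplacian_barrier
    by (simp add: u_def v_def \<beta>_def \<gamma>_def \<sigma>_def q_def power2_eq_square[of a1] power2_eq_square[of pi])
  have ss: "s * s = 1" using s by auto
  have expand: "s * integrated_dyson_operator \<phi> t0 x0 =
      q + s * ((1 - \<sigma>) * (u * v)) + r * (u * \<gamma>) + 6 * r * (\<beta> * v) + s * (6 * (r * r) * (\<beta> * \<gamma>))"
    unfolding op using s by (auto simp: algebra_simps)
  have k: "0 < k" using e by (simp add: k_def)
  have "norm a1 \<le> k"
    using norm_A_subord_le[of "bounded_time r t0" "Complex (x0 + c) e" 1] bounded_time_bounds[OF r, of t0] t0 e
    by (simp add: a1_def k_def)
  then have "norm a1 / pi \<le> k"
    using pi_gt3 divide_left_mono[of 1 pi "norm a1"] by simp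
  then have uv: "\<bar>u\<bar> \<le> k" "\<bar>v\<bar> \<le> k"
    using abs_Im_le_cmod[of a1] abs_Re_le_cmod[of a1]
    by (auto simp: u_def v_def abs_divide intro: order_trans[OF divide_right_mono])
  have \<beta>: "\<bar>\<beta>\<bar> \<le> 1" unfolding \<beta>_def by (rule bump_deriv_le)
  have \<gamma>: "\<bar>\<gamma>\<bar> \<le> 7"
  proof -
    have "1 \<le> norm (complex_of_real (r * x0) + \<i>)"
      using abs_Im_le_cmod[of "complex_of_real (r * x0) + \<i>"] by simp
    then have "1 \<le> (norm (complex_of_real (r * x0) + \<i>))\<^sup>2" by simp
    then have "norm (1 / (complex_of_real (r * x0) + \<i>)\<^sup>2) \<le> 1"
      by (simp only: norm_divide norm_power norm_one) (simp add: divide_le_eq)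
    then have "\<bar>Re (1 / (complex_of_real (r * x0) + \<i>)\<^sup>2)\<bar> \<le> 1"
      using abs_Re_le_cmod order_trans by blast
    then show ?thesis unfolding \<gamma>_def by linarith
  qed
  have \<sigma>: "\<bar>1 - \<sigma>\<bar> \<le> 2 * r / \<eta>"
  proof -
    define y where "y = slowdown r t0"
    have y: "0 < y" "y \<le> 1" using slowdown_bounds[OF r, of t0] t0 by (auto simp: y_def)
    have "1 - y = r * bounded_time r t0"
      using bounded_time_eq[OF r, of t0] r t0 by (simp add: y_def)
    also have "\<dots> \<le> r * t0"
      using r t0 by (intro mult_left_mono) (auto simp: bounded_time_def divide_le_eq)
    also have "\<dots> \<le> r * (1 / \<eta>)"
      using r t0' \<eta> by (intro mult_left_mono) (auto simp: field_simps)
    finally have "1 - y \<le> r / \<eta>" by simp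
    moreover have "1 - y\<^sup>2 = (1 - y) * (1 + y)" by (simp add: power2_eq_square algebra_simps)
    moreover have "(1 - y) * (1 + y) \<le> (1 - y) * 2" using y by (intro mult_left_mono) auto
    moreover have "0 \<le> (1 - y) * (1 + y)" using y by simp
    ultimately show ?thesis by (simp add: \<sigma>_def y_def[symmetric])
  qed
  have q: "\<eta> \<le> q"
  proof -
    have "1 / 2 \<le> slowdown \<eta> t0"
      using t0' mult_pos_pos[OF \<eta> t0] by (simp add: slowdown_def pos_le_divide_eq)
    then have "(1 / 2)\<^sup>2 \<le> (slowdown \<eta> t0)\<^sup>2" by (intro power_mono) auto
    then have "6 * \<eta> * (1 / 2)\<^sup>2 \<le> q" unfolding q_def using \<eta> by (intro mult_left_mono) auto
    then show ?thesis using \<eta> by (simp add: power2_eq_square)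
  qed
  have "\<bar>(1 - \<sigma>) * (u * v)\<bar> \<le> 2 * r / \<eta> * (k * k)"
    unfolding abs_mult using \<sigma> uv k r \<eta> by (intro mult_mono) auto
  moreover have "\<bar>r * (u * \<gamma>)\<bar> \<le> r * (k * 7)"
    unfolding abs_mult using uv \<gamma> k r by (intro mult_mono) auto
  moreover have "\<bar>6 * r * (\<beta> * v)\<bar> \<le> 6 * r * (1 * k)"
    unfolding abs_mult using uv \<beta> k r by (intro mult_mono) auto
  moreover have "\<bar>6 * (r * r) * (\<beta> * \<gamma>)\<bar> \<le> 6 * (r * 1) * (1 * 7)"
    unfolding abs_mult using \<gamma> \<beta> r r1 by (intro mult_mono) auto
  moreover have "r * (2 * k\<^sup>2 / \<eta> + 13 * k + 42) = 2 * r / \<eta> * (k * k) + r * (k * 7) + 6 * r * (1 * k) + 6 * (r * 1) * (1 * 7)"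
    by (simp add: algebra_simps power2_eq_square)
  moreover have "r * (2 * k\<^sup>2 / \<eta> + 13 * k + 42) < \<eta>" using small by (simp add: k_def)
  moreover have "- \<bar>y\<bar> \<le> s * y" for y using s by auto
  ultimately show ?thesis
    unfolding expand using q by (smt (verit) abs_ge_minus_self abs_le_iff)
qed

end

end

section \<open>Comparison with a viscosity solution\<close>

context sqrt_integrable_transforms
begin

lemma continuous_on_profile:
  assumes "0 < e"
  shows "continuous_on ({0..} \<times> UNIV) (\<lambda>p. profile e (fst p) (snd p))"
proof -
  have "continuous_on ({0..} \<times> UNIV) (\<lambda>p. (fst p, Complex (snd p) e))"
    unfolding Complex_eq by (intro continuous_intros)
  moreover have "(\<lambda>p. (fst p, Complex (snd p) e)) ` ({0..} \<times> UNIV) \<subseteq> {0..} \<times> {z. 0 < Im z}"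
    using assms by auto
  ultimately have "continuous_on ({0..} \<times> UNIV) (\<lambda>p. potential (fst p) (Complex (snd p) e))"
    using continuous_on_compose2[OF continuous_on_potential] by fastforce
  then show ?thesis
    unfolding profile_def by (intro continuous_intros) auto
qed

text \<open>
  Subsolutions (\<open>s = 1\<close>, \<open>f\<close> a distribution function) and supersolutions (\<open>s = -1\<close>, \<open>f\<close> minus a
  distribution function) are treated at once. If the conclusion failed, \<open>f\<close> minus the barrier without
  its last term would be positive somewhere. It is nonpositive at time \<open>0\<close> and outside the
  compact set \<open>Q\<close>, so it would have a maximum at a positive time, where the barrier is an admissible
  test function that violates the viscosity inequality. The parameter \<open>\<eta>\<close> is chosen first and \<open>r\<close> afterwards.
\<close>

theorem profile_comparison:
  fixes f :: "real \<times> real \<Rightarrow> real"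
  assumes e: "0 < e" and s: "s = 1 \<or> s = -1" and b: "0 \<le> b"
    and usc: "\<And>p \<delta>. p \<in> {0..} \<times> UNIV \<Longrightarrow> 0 < \<delta> \<Longrightarrow>
        eventually (\<lambda>q. f q < f p + \<delta>) (at p within {0..} \<times> UNIV)"
    and f1: "\<And>p. 0 \<le> fst p \<Longrightarrow> f p \<le> 1"
    and sub: "\<And>\<phi> t x. bounded_smooth_on spacetime \<phi> \<Longrightarrow>
        strict_global_max_on spacetime (\<lambda>p. f p - s * \<phi> p) (t, x) \<Longrightarrow> s * integrated_dyson_operator \<phi> t x \<le> 0"
    and init: "\<And>x. f (0, x) \<le> s * profile e 0 (x + c) + b"
    and t: "0 \<le> t"
  shows "f (t, x) \<le> s * profile e t (x + c) + b"
proof (rule ccontr)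
  assume neg: "\<not> f (t, x) \<le> s * profile e t (x + c) + b"
  define \<delta> where "\<delta> = f (t, x) - (s * profile e t (x + c) + b)"
  have \<delta>: "0 < \<delta>" using neg by (simp add: \<delta>_def)
  \<comment> \<open>The clock and the penalties in time and in space each cost at most \<open>\<delta> / 3\<close> at \<open>(t, x)\<close>.\<close>
  define \<eta> where "\<eta> = \<delta> / (18 * (t + 1))"
  have \<eta>: "0 < \<eta>" using \<delta> t by (simp add: \<eta>_def)
  have "\<eta> * (18 * (t + 1)) = \<delta>" using t by (simp add: \<eta>_def)
  then have \<eta>t: "18 * (\<eta> * t) < \<delta>" using \<eta> by (simp add: algebra_simps)
  have "eventually (\<lambda>r. 0 < r \<and> r \<le> 1 \<and> r * (2 * (inverse e)\<^sup>2 / \<eta> + 13 * inverse e + 42) < \<eta>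
      \<and> 6 * (r * x)\<^sup>2 < \<delta> / 3 \<and> \<bar>profile e (bounded_time r t) (x + c) - profile e t (x + c)\<bar> < \<delta> / 3) (at_right 0)"
  proof (intro eventually_conj)
    show "eventually (\<lambda>r. 0 < r) (at_right (0::real))" by (rule eventually_at_right_less)
    have lim: "((\<lambda>r. r) \<longlongrightarrow> 0) (at_right (0::real))" by (rule tendsto_ident_at)
    show "eventually (\<lambda>r. r \<le> 1) (at_right (0::real))"
      using order_tendstoD(2)[OF lim, of 1] by (auto elim: eventually_mono)
    have "((\<lambda>r. r * (2 * (inverse e)\<^sup>2 / \<eta> + 13 * inverse e + 42)) \<longlongrightarrow> 0 * (2 * (inverse e)\<^sup>2 / \<eta> + 13 * inverse e + 42)) (at_right 0)"
      by (intro tendsto_mult lim tendsto_const)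
    then show "eventually (\<lambda>r. r * (2 * (inverse e)\<^sup>2 / \<eta> + 13 * inverse e + 42) < \<eta>) (at_right 0)"
      using \<eta> by (intro order_tendstoD(2)) auto
    have "((\<lambda>r. 6 * (r * x)\<^sup>2) \<longlongrightarrow> 6 * (0 * x)\<^sup>2) (at_right 0)"
      by (intro tendsto_intros lim)
    then show "eventually (\<lambda>r. 6 * (r * x)\<^sup>2 < \<delta> / 3) (at_right 0)"
      using \<delta> by (intro order_tendstoD(2)) auto
    have "continuous_on {0..} (\<lambda>r. (bounded_time r t, x + c))"
      unfolding bounded_time_def
    proof (intro continuous_intros ballI)
      fix r :: real assume "r \<in> {0..}"
      then have "0 \<le> r * t" using t by simp
      then show "1 + r * t \<noteq> 0" by linarith
    qed
    moreover have "(\<lambda>r. (bounded_time r t, x + c)) ` {0..} \<subseteq> {0..} \<times> UNIV"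
      using t by (auto simp: bounded_time_def intro!: divide_nonneg_nonneg add_nonneg_nonneg)
    ultimately have "continuous_on {0..} (\<lambda>r. profile e (bounded_time r t) (x + c))"
      using continuous_on_compose2[OF continuous_on_profile[OF e]] by fastforce
    then have "((\<lambda>r. profile e (bounded_time r t) (x + c)) \<longlongrightarrow> profile e (bounded_time 0 t) (x + c)) (at 0 within {0..})"
      by (simp add: continuous_on_def)
    then have "((\<lambda>r. profile e (bounded_time r t) (x + c)) \<longlongrightarrow> profile e t (x + c)) (at_right 0)"
      by (rule tendsto_within_subset[THEN tendsto_eq_rhs]) (auto simp: bounded_time_def)
    from tendstoD[OF this, of "\<delta> / 3"]
    show "eventually (\<lambda>r. \<bar>profile e (bounded_time r t) (x + c) - profile e t (x + c)\<bar> < \<delta> / 3) (at_right 0)"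
      using \<delta> by (simp add: dist_real_def)
  qed
  then obtain r where r: "0 < r" "r \<le> 1" "r * (2 * (inverse e)\<^sup>2 / \<eta> + 13 * inverse e + 42) < \<eta>"
    "6 * (r * x)\<^sup>2 < \<delta> / 3" "\<bar>profile e (bounded_time r t) (x + c) - profile e t (x + c)\<bar> < \<delta> / 3"
    using eventually_happens'[OF trivial_limit_at_right_real] by blast
  define P where "P p = profile e (bounded_time r (fst p)) (snd p + c)" for p
  define pen where "pen p = 6 * (1 - slowdown \<eta> (fst p)) + 6 * bump (r * snd p)" for p
  define g where "g p = f p - (s * P p + b + pen p)" for p
  have sd: "0 \<le> 1 - slowdown \<eta> t" if "0 \<le> t" for t
    using slowdown_bounds[OF \<eta> that] by simp
  have sP: "- 2 \<le> s * P p" if "0 \<le> fst p" for p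
    using s profile_bounds[OF bounded_time_bounds(1)[OF r(1) that] e, of "snd p + c"] by (auto simp: P_def)
  define Q where "Q = {0..1 / \<eta>} \<times> {- 1 / r..1 / r}"
  have out: "g p \<le> 0" if p: "0 \<le> fst p" "p \<notin> Q" for p
  proof -
    have "3 \<le> pen p"
    proof (cases "fst p \<le> 1 / \<eta>")
      case True
      then have "snd p \<notin> {- 1 / r..1 / r}" using p by (cases p) (auto simp: Q_def)
      then have "1 \<le> \<bar>r * snd p\<bar>"
        using r(1) by (auto simp: field_simps abs_if)
      then show ?thesis using bump_ge_half[of "r * snd p"] sd[OF p(1)] by (simp add: pen_def)
    next
      case False
      then have "1 \<le> \<eta> * fst p" using \<eta> by (simp add: field_simps)
      then have "slowdown \<eta> (fst p) \<le> 1 / 2" by (simp add: slowdown_def field_simps)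
      then show ?thesis using bump_nonneg[of "r * snd p"] by (simp add: pen_def)
    qed
    then show ?thesis using f1[OF p(1)] sP[OF p(1)] b by (simp add: g_def)
  qed
  have start: "g (0, y) \<le> 0" for y
    using init[of y] bump_nonneg[of "r * y"] by (simp add: g_def P_def pen_def bounded_time_def slowdown_def)
  have gpos: "0 < g (t, x)"
  proof -
    have "1 - slowdown \<eta> t = \<eta> * bounded_time \<eta> t"
      using bounded_time_eq[OF \<eta> t] \<eta> by simp
    also have "bounded_time \<eta> t \<le> t"
      using slowdown_bounds(2)[OF \<eta> t] t mult_left_mono[of "slowdown \<eta> t" 1 t]
      by (simp add: bounded_time_def slowdown_def)
    finally have "6 * (1 - slowdown \<eta> t) < \<delta> / 3" using \<eta>t \<eta> by simp
    moreover have "6 * bump (r * x) < \<delta> / 3" using bump_le[of "r * x"] r(4) by linarith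
    ultimately have "pen (t, x) < 2 * \<delta> / 3" by (simp add: pen_def)
    moreover have "s * P (t, x) \<le> s * profile e t (x + c) + \<delta> / 3"
      using s r(5) unfolding abs_less_iff by (auto simp: P_def)
    ultimately show ?thesis unfolding g_def \<delta>_def by argo
  qed
  have cont: "continuous_on ({0..} \<times> UNIV) (\<lambda>p. s * P p + b + pen p)"
  proof -
    have nz: "1 + k * fst p \<noteq> 0" if "0 < k" "p \<in> {0..} \<times> (UNIV :: real set)" for k and p :: "real \<times> real"
    proof -
      have "0 \<le> k * fst p" using that by auto
      then show ?thesis by linarith
    qed
    have "continuous_on ({0..} \<times> UNIV) (\<lambda>p :: real \<times> real. (bounded_time r (fst p), snd p + c))"
      unfolding bounded_time_def using nz[OF r(1)] by (intro continuous_intros) auto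
    moreover have "(\<lambda>p :: real \<times> real. (bounded_time r (fst p), snd p + c)) ` ({0..} \<times> UNIV) \<subseteq> {0..} \<times> UNIV"
      using bounded_time_bounds(1)[OF r(1)] by (intro image_subsetI) (simp add: mem_Times_iff)
    ultimately have "continuous_on ({0..} \<times> UNIV)
        (\<lambda>p. profile e (fst (bounded_time r (fst p), snd p + c)) (snd (bounded_time r (fst p), snd p + c)))"
      by (rule continuous_on_compose2[OF continuous_on_profile[OF e]])
    then have "continuous_on ({0..} \<times> UNIV) P"
      by (simp add: P_def[abs_def])
    moreover have "continuous_on ({0..} \<times> UNIV) pen"
      unfolding pen_def[abs_def] slowdown_def using nz[OF \<eta>] by (intro continuous_intros) auto
    ultimately show ?thesis by (intro continuous_intros)
  qed
  have Qsub: "Q \<subseteq> {0..} \<times> UNIV" by (auto simp: Q_def)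
  have "\<exists>p0\<in>Q. \<forall>q\<in>Q. g q \<le> g p0"
  proof -
    have Qc: "compact Q" unfolding Q_def by (intro compact_Times) auto
    have Qn: "Q \<noteq> {}" using \<eta> r(1) by (auto simp: Q_def)
    have Qu: "eventually (\<lambda>q. g q < g p + k) (at p within Q)" if "p \<in> Q" "0 < k" for p k
    proof -
      have pS: "p \<in> {0..} \<times> UNIV" using that Qsub by blast
      have "((\<lambda>q. s * P q + b + pen q) \<longlongrightarrow> s * P p + b + pen p) (at p within {0..} \<times> UNIV)"
        using cont pS by (auto simp: continuous_on_def)
      then have "eventually (\<lambda>q. dist (s * P q + b + pen q) (s * P p + b + pen p) < k / 2) (at p within {0..} \<times> UNIV)"
        using that(2) by (intro tendstoD) auto
      moreover have "eventually (\<lambda>q. f q < f p + k / 2) (at p within {0..} \<times> UNIV)"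
        using that(2) by (intro usc[OF pS]) auto
      ultimately have "eventually (\<lambda>q. g q < g p + k) (at p within {0..} \<times> UNIV)"
        by eventually_elim (unfold g_def dist_real_def abs_less_iff, linarith)
      then show ?thesis
        using Qsub by (meson at_le filter_leD)
    qed
    have Qb: "g p \<le> 3" if "p \<in> Q" for p
    proof -
      have p: "0 \<le> fst p" using that by (auto simp: Q_def)
      then show ?thesis
        using f1[OF p] sP[OF p] b sd[OF p] bump_nonneg[of "r * snd p"] by (simp add: g_def pen_def)
    qed
    show ?thesis
    proof (rule usc_attains_max[of Q g 3, OF Qc Qn Qu Qb])
      fix p assume "p \<in> Q" "\<And>q. q \<in> Q \<Longrightarrow> g q \<le> g p"
      then show ?thesis by blast
    qed
  qed
  then obtain t0 x0 where Q0: "(t0, x0) \<in> Q" and max: "\<And>q. q \<in> Q \<Longrightarrow> g q \<le> g (t0, x0)"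
    by (metis surj_pair)
  have "(t, x) \<in> Q" using out[of "(t, x)"] gpos t by fastforce
  then have g0: "0 < g (t0, x0)" using max gpos by fastforce
  have t0: "0 < t0" using start[of x0] g0 Q0 by (cases "t0 = 0") (auto simp: Q_def)
  have gmax: "g p \<le> g (t0, x0)" if "0 \<le> fst p" for p
    using that out[of p] max[of p] g0 by fastforce
  have strict: "strict_global_max_on spacetime (\<lambda>p. f p - s * barrier r e c \<eta> b s t0 x0 p) (t0, x0)"
  proof -
    have eq: "f p - s * barrier r e c \<eta> b s t0 x0 p
        = g p - r * (bump (fst p - t0) + bump (snd p - x0))" for p
      using s by (auto simp: barrier_def g_def P_def pen_def)
    have "f q - s * barrier r e c \<eta> b s t0 x0 q < f (t0, x0) - s * barrier r e c \<eta> b s t0 x0 (t0, x0)"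
      if q: "q \<in> spacetime" "q \<noteq> (t0, x0)" for q
    proof -
      have "fst q - t0 \<noteq> 0 \<or> snd q - x0 \<noteq> 0" using q(2) by (auto simp: prod_eq_iff)
      then have "0 < bump (fst q - t0) + bump (snd q - x0)"
        using bump_nonneg[of "fst q - t0"] bump_nonneg[of "snd q - x0"]
          bump_eq_0_iff[of "fst q - t0"] bump_eq_0_iff[of "snd q - x0"] by linarith
      from mult_pos_pos[OF r(1) this]
      have "g q - r * (bump (fst q - t0) + bump (snd q - x0)) < g q" by simp
      also have "g q \<le> g (t0, x0)" using gmax q by auto
      finally show ?thesis unfolding eq by (simp add: bump_0)
    qed
    then show ?thesis using t0 by (auto simp: strict_global_max_on_def)
  qed
  have "\<eta> * t0 \<le> 1" using Q0 \<eta> by (simp add: Q_def field_simps)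
  from barrier_strict_supersolution[OF r(1) e \<eta> t0 s this r(2,3)]
    sub[OF bounded_smooth_on_barrier[OF r(1) e \<eta>] strict]
  show False by (meson not_less)
qed

end

section \<open>Semicontinuity of distribution functions\<close>

text \<open>
  A continuous cutoff between the indicators of \<open>{..a}\<close> and \<open>{..<b}\<close>.
\<close>

definition ramp :: "real \<Rightarrow> real \<Rightarrow> real \<Rightarrow> real" where
  "ramp a b y = max 0 (min 1 ((b - y) / (b - a)))"

lemma continuous_on_ramp: "continuous_on UNIV (ramp a b)"
  unfolding ramp_def by (cases "a = b") (simp_all, intro continuous_intros, auto)

lemma bounded_ramp: "bounded (range (ramp a b))"
  by (intro boundedI[where B = 1]) (auto simp: ramp_def)

lemma (in real_distribution) cdf_le_ramp_le_cdf:
  assumes "a < b"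
  shows "measure M {..a} \<le> (\<integral>y. ramp a b y \<partial>M)" "(\<integral>y. ramp a b y \<partial>M) \<le> measure M {..<b}"
proof -
  have int: "integrable M (ramp a b)"
    by (rule integrable_const_bound[where B = 1])
      (auto simp: ramp_def cong: measurable_cong_sets intro!: borel_measurable_continuous_onI continuous_on_ramp[unfolded ramp_def[abs_def]])
  have ind: "(\<integral>y. indicator S y \<partial>M) = measure M S" "integrable M (indicat_real S)" if "S \<in> sets borel" for S
    using that by (auto simp: emeasure_eq_measure)
  have "measure M {..a} = (\<integral>y. indicator {..a} y \<partial>M)" using ind by simp
  also have "\<dots> \<le> (\<integral>y. ramp a b y \<partial>M)"
    using assms by (intro integral_mono int ind) (auto simp: ramp_def indicator_def field_simps)
  finally show "measure M {..a} \<le> (\<integral>y. ramp a b y \<partial>M)" .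
  have "(\<integral>y. ramp a b y \<partial>M) \<le> (\<integral>y. indicator {..<b} y \<partial>M)"
    using assms by (intro integral_mono int ind) (auto simp: ramp_def indicator_def field_simps max_def min_def)
  also have "\<dots> = measure M {..<b}" using ind by simp
  finally show "(\<integral>y. ramp a b y \<partial>M) \<le> measure M {..<b}" .
qed

lemma eventually_ramp_integral:
  fixes p :: "real \<times> real"
  assumes u: "weakly_continuous_curve u" and p: "p \<in> {0..} \<times> UNIV" and \<delta>: "0 < \<delta>"
  shows "eventually (\<lambda>q. \<bar>(\<integral>y. ramp a b y \<partial>u (fst q)) - (\<integral>y. ramp a b y \<partial>u (fst p))\<bar> < \<delta>) (at p within {0..} \<times> UNIV)"
proof -
  have "continuous_on {0..} (\<lambda>t. \<integral>y. ramp a b y \<partial>u t)"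
    using u continuous_on_ramp bounded_ramp by (auto simp: weakly_continuous_curve_def)
  from continuous_on_compose2[OF this continuous_on_fst[OF continuous_on_id], of "{0..} \<times> UNIV"]
  have "continuous_on ({0..} \<times> (UNIV :: real set)) (\<lambda>p. \<integral>y. ramp a b y \<partial>u (fst p))"
    by auto
  then have "((\<lambda>q. \<integral>y. ramp a b y \<partial>u (fst q)) \<longlongrightarrow> (\<integral>y. ramp a b y \<partial>u (fst p))) (at p within {0..} \<times> UNIV)"
    using p by (auto simp: continuous_on_def)
  from tendstoD[OF this \<delta>] show ?thesis by (simp add: dist_real_def)
qed

lemma eventually_snd_near:
  fixes p :: "real \<times> real"
  assumes "0 < d"
  shows "eventually (\<lambda>q. \<bar>snd q - snd p\<bar> < d) (at p within S)"
proof -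
  have "(snd \<longlongrightarrow> snd p) (at p within S)" by (intro tendsto_intros)
  from tendstoD[OF this assms] show ?thesis by (simp add: dist_real_def)
qed

lemma eventually_mem_within: "eventually (\<lambda>q. q \<in> S) (at p within S)"
  by (simp add: eventually_at_filter)

text \<open>
  A portmanteau argument with a moving end point: squeeze a ramp between \<open>snd p\<close> and a slightly larger
  point at which, by right continuity, the distribution function has hardly increased.
\<close>

lemma upper_cdf_usc:
  assumes u: "weakly_continuous_curve u" and p: "p \<in> {0..} \<times> UNIV" and \<delta>: "0 < \<delta>"
  shows "eventually (\<lambda>q. upper_cdf u q < upper_cdf u p + \<delta>) (at p within {0..} \<times> UNIV)"
proof -
  obtain t x where tx: "p = (t, x)" "0 \<le> t" using p by (cases p) auto
  have rd: "real_distribution (u t)" if "0 \<le> t" for t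
    using u that by (auto simp: weakly_continuous_curve_def)
  interpret real_distribution "u t" by (rule rd[OF tx(2)])
  have "(cdf (u t) \<longlongrightarrow> cdf (u t) x) (at_right x)"
    using cdf_is_right_cont by (simp add: continuous_within)
  from order_tendstoD(2)[OF this, of "cdf (u t) x + \<delta> / 2"] \<delta>
  obtain y where y: "x < y" "cdf (u t) y < cdf (u t) x + \<delta> / 2"
    by (auto simp: eventually_at_right_field) (meson dense)
  define z where "z = (x + y) / 2"
  have z: "x < z" "z < y" using y by (auto simp: z_def)
  have "eventually (\<lambda>q. \<bar>snd q - snd p\<bar> < z - x) (at p within {0..} \<times> UNIV)"
    using z by (intro eventually_snd_near) auto
  moreover have "eventually (\<lambda>q. \<bar>(\<integral>w. ramp z y w \<partial>u (fst q)) - (\<integral>w. ramp z y w \<partial>u (fst p))\<bar> < \<delta> / 2) (at p within {0..} \<times> UNIV)"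
    using \<delta> by (intro eventually_ramp_integral[OF u p]) auto
  ultimately show ?thesis
    using eventually_mem_within[of "{0..} \<times> UNIV" p]
  proof eventually_elim
    case (elim q)
    interpret q: real_distribution "u (fst q)" using rd elim(3) by auto
    have "upper_cdf u q = measure (u (fst q)) {..snd q}" by (simp add: upper_cdf_def split_beta)
    also have "\<dots> \<le> measure (u (fst q)) {..z}"
      using elim(1) by (intro q.finite_measure_mono) (auto simp: tx)
    also have "\<dots> \<le> (\<integral>w. ramp z y w \<partial>u (fst q))" by (rule q.cdf_le_ramp_le_cdf[OF z(2)])
    also have "\<dots> < (\<integral>w. ramp z y w \<partial>u t) + \<delta> / 2" using elim(2) unfolding tx fst_conv abs_less_iff by linarith
    also have "(\<integral>w. ramp z y w \<partial>u t) \<le> measure (u t) {..<y}" by (rule cdf_le_ramp_le_cdf[OF z(2)])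
    also have "\<dots> \<le> measure (u t) {..y}" by (intro finite_measure_mono) auto
    also have "\<dots> < upper_cdf u p + \<delta> / 2" using y by (simp add: upper_cdf_def tx cdf_def)
    finally show ?case by simp
  qed
qed

lemma lower_cdf_lsc:
  assumes u: "weakly_continuous_curve u" and p: "p \<in> {0..} \<times> UNIV" and \<delta>: "0 < \<delta>"
  shows "eventually (\<lambda>q. - lower_cdf u q < - lower_cdf u p + \<delta>) (at p within {0..} \<times> UNIV)"
proof -
  obtain t x where tx: "p = (t, x)" "0 \<le> t" using p by (cases p) auto
  have rd: "real_distribution (u t)" if "0 \<le> t" for t
    using u that by (auto simp: weakly_continuous_curve_def)
  interpret real_distribution "u t" by (rule rd[OF tx(2)])
  have "(cdf (u t) \<longlongrightarrow> measure (u t) {..<x}) (at_left x)"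
    by (rule cdf_at_left)
  from order_tendstoD(1)[OF this, of "measure (u t) {..<x} - \<delta> / 2"] \<delta>
  obtain y where y: "y < x" "measure (u t) {..<x} - \<delta> / 2 < cdf (u t) y"
    by (auto simp: eventually_at_left_field) (meson dense)
  define z where "z = (x + y) / 2"
  have z: "z < x" "y < z" using y by (auto simp: z_def)
  have "eventually (\<lambda>q. \<bar>snd q - snd p\<bar> < x - z) (at p within {0..} \<times> UNIV)"
    using z by (intro eventually_snd_near) auto
  moreover have "eventually (\<lambda>q. \<bar>(\<integral>w. ramp y z w \<partial>u (fst q)) - (\<integral>w. ramp y z w \<partial>u (fst p))\<bar> < \<delta> / 2) (at p within {0..} \<times> UNIV)"
    using \<delta> by (intro eventually_ramp_integral[OF u p]) auto
  ultimately show ?thesis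
    using eventually_mem_within[of "{0..} \<times> UNIV" p]
  proof eventually_elim
    case (elim q)
    interpret q: real_distribution "u (fst q)" using rd elim(3) by auto
    have "lower_cdf u p - \<delta> / 2 < measure (u t) {..y}" using y by (simp add: lower_cdf_def tx cdf_def)
    also have "\<dots> \<le> (\<integral>w. ramp y z w \<partial>u t)" by (rule cdf_le_ramp_le_cdf[OF z(2)])
    also have "\<dots> < (\<integral>w. ramp y z w \<partial>u (fst q)) + \<delta> / 2" using elim(2) unfolding tx fst_conv abs_less_iff by linarith
    also have "(\<integral>w. ramp y z w \<partial>u (fst q)) \<le> measure (u (fst q)) {..<z}" by (rule q.cdf_le_ramp_le_cdf[OF z(2)])
    also have "\<dots> \<le> measure (u (fst q)) {..<snd q}"
      using elim(1) by (intro q.finite_measure_mono) (auto simp: tx)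
    also have "\<dots> = lower_cdf u q" by (simp add: lower_cdf_def split_beta)
    finally show ?case by simp
  qed
qed

section \<open>Hoelder regularity of the density\<close>

text \<open>
  The equicontinuity of the \<open>\<rho> n\<close> makes first-order Taylor expansions of the \<open>\<Phi> n\<close> uniform in \<open>n\<close>.
  Hence \<open>\<rho> n x\<close> is uniformly close to difference quotients that converge, so it is a Cauchy sequence, and
  its limit is the derivative of the limiting distribution function.
\<close>

lemma density_of_cdf_limit:
  fixes \<Phi> \<rho> :: "nat \<Rightarrow> real \<Rightarrow> real"
  assumes \<mu>: "real_distribution \<mu>" and L: "0 \<le> L"
    and der: "\<And>n x. (\<Phi> n has_real_derivative \<rho> n x) (at x)"
    and nonneg: "\<And>n x. 0 \<le> \<rho> n x"
    and hol: "\<And>n x y. \<bar>\<rho> n x - \<rho> n y\<bar> \<le> root 3 (L * \<bar>x - y\<bar>)"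
    and lim: "\<And>x. (\<lambda>n. \<Phi> n x) \<longlonglongrightarrow> cdf \<mu> x"
  obtains f where "is_lebesgue_density \<mu> f" "\<And>x y. \<bar>f x - f y\<bar> \<le> root 3 (L * \<bar>x - y\<bar>)"
proof -
  interpret real_distribution \<mu> by fact
  define F where "F = cdf \<mu>"
  have taylor: "\<bar>\<Phi> n y - \<Phi> n x - \<rho> n x * (y - x)\<bar> \<le> root 3 (L * \<bar>y - x\<bar>) * \<bar>y - x\<bar>" for n x y
  proof -
    have "norm ((\<Phi> n y - \<rho> n x * y) - (\<Phi> n x - \<rho> n x * x)) \<le> root 3 (L * \<bar>y - x\<bar>) * norm (y - x)"
    proof (rule field_differentiable_bound[where S = "cball x \<bar>y - x\<bar>"])
      fix z assume z: "z \<in> cball x \<bar>y - x\<bar>"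
      show "((\<lambda>y. \<Phi> n y - \<rho> n x * y) has_field_derivative \<rho> n z - \<rho> n x) (at z within cball x \<bar>y - x\<bar>)"
        by (rule has_field_derivative_at_within) (auto intro!: derivative_eq_intros der)
      have "\<bar>\<rho> n z - \<rho> n x\<bar> \<le> root 3 (L * \<bar>z - x\<bar>)" by (rule hol)
      also have "\<dots> \<le> root 3 (L * \<bar>y - x\<bar>)"
        using z L by (auto simp: dist_real_def intro!: mult_left_mono)
      finally show "norm (\<rho> n z - \<rho> n x) \<le> root 3 (L * \<bar>y - x\<bar>)" by simp
    qed (auto simp: dist_real_def)
    then show ?thesis by (simp add: algebra_simps)
  qed
  have root_lim: "((\<lambda>s. root 3 (L * \<bar>s\<bar>)) \<longlongrightarrow> 0) (at (0::real))"
    by (auto intro!: tendsto_eq_intros)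
  have "Cauchy (\<lambda>n. \<rho> n x)" for x
  proof (rule metric_CauchyI)
    fix k :: real assume k: "0 < k"
    have "eventually (\<lambda>s. root 3 (L * \<bar>s\<bar>) < k / 3) (at_right 0)"
      using order_tendstoD(2)[OF root_lim, of "k / 3"] k
      by (auto simp: eventually_at_split)
    then have "eventually (\<lambda>s. 0 < s \<and> root 3 (L * \<bar>s\<bar>) < k / 3) (at_right (0::real))"
      by (intro eventually_conj eventually_at_right_less)
    then obtain s where s: "0 < s" "root 3 (L * \<bar>s\<bar>) < k / 3"
      using eventually_happens'[OF trivial_limit_at_right_real] by blast
    define q where "q n = (\<Phi> n (x + s) - \<Phi> n x) / s" for n
    have near: "\<bar>\<rho> n x - q n\<bar> < k / 3" for n
    proof -
      have "\<bar>\<rho> n x - q n\<bar> * s = \<bar>\<Phi> n (x + s) - \<Phi> n x - \<rho> n x * (x + s - x)\<bar>"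
        using s by (simp add: q_def abs_mult_pos[symmetric] field_simps abs_minus_commute)
      also have "\<dots> \<le> root 3 (L * \<bar>s\<bar>) * s" using taylor[of n "x + s" x] s by simp
      finally have "\<bar>\<rho> n x - q n\<bar> \<le> root 3 (L * \<bar>s\<bar>)" using s by simp
      then show ?thesis using s(2) by linarith
    qed
    have "q \<longlonglongrightarrow> (cdf \<mu> (x + s) - cdf \<mu> x) / s"
      unfolding q_def by (intro tendsto_intros lim) (use s in auto)
    then have "Cauchy q" by (rule LIMSEQ_imp_Cauchy)
    then obtain N where N: "\<And>m n. N \<le> m \<Longrightarrow> N \<le> n \<Longrightarrow> \<bar>q m - q n\<bar> < k / 3"
      using metric_CauchyD[of q "k / 3"] k by (auto simp: dist_real_def)
    have "dist (\<rho> m x) (\<rho> n x) < k" if "N \<le> m" "N \<le> n" for m n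
      using near[of m] near[of n] N[OF that] unfolding dist_real_def by linarith
    then show "\<exists>N. \<forall>m\<ge>N. \<forall>n\<ge>N. dist (\<rho> m x) (\<rho> n x) < k" by blast
  qed
  then have "\<exists>l. (\<lambda>n. \<rho> n x) \<longlonglongrightarrow> l" for x
    by (simp add: Cauchy_convergent_iff convergent_def)
  then obtain f where f: "\<And>x. (\<lambda>n. \<rho> n x) \<longlonglongrightarrow> f x" by metis
  have f_nonneg: "0 \<le> f x" for x
    by (rule LIMSEQ_le_const[OF f]) (use nonneg in auto)
  have f_hol: "\<bar>f x - f y\<bar> \<le> root 3 (L * \<bar>x - y\<bar>)" for x y
    by (rule LIMSEQ_le_const2[OF tendsto_rabs[OF tendsto_diff[OF f f]]]) (use hol in auto)
  have F_taylor: "\<bar>F y - F x - f x * (y - x)\<bar> \<le> root 3 (L * \<bar>y - x\<bar>) * \<bar>y - x\<bar>" for x y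
    unfolding F_def
    by (rule LIMSEQ_le_const2[of "\<lambda>n. \<bar>\<Phi> n y - \<Phi> n x - \<rho> n x * (y - x)\<bar>"])
      (use taylor in \<open>auto intro!: tendsto_intros lim f\<close>)
  have shift: "((\<lambda>y. root 3 (L * \<bar>y - x\<bar>)) \<longlongrightarrow> 0) (at x)" for x
    by (auto intro!: tendsto_eq_intros)
  have F_der: "(F has_real_derivative f x) (at x)" for x
  proof -
    have "((\<lambda>y. (F y - F x) / (y - x) - f x) \<longlongrightarrow> 0) (at x)"
    proof (rule Lim_null_comparison[OF _ shift[of x]])
      have "norm ((F y - F x) / (y - x) - f x) \<le> root 3 (L * \<bar>y - x\<bar>)" if "y \<noteq> x" for y
      proof -
        have "norm ((F y - F x) / (y - x) - f x) * \<bar>y - x\<bar> = \<bar>((F y - F x) / (y - x) - f x) * (y - x)\<bar>"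
          by (simp add: abs_mult)
        also have "\<dots> = \<bar>F y - F x - f x * (y - x)\<bar>"
          unfolding left_diff_distrib[of _ "f x"] using that by simp
        finally have "norm ((F y - F x) / (y - x) - f x) * \<bar>y - x\<bar> \<le> root 3 (L * \<bar>y - x\<bar>) * \<bar>y - x\<bar>"
          using F_taylor by simp
        then show ?thesis using that by simp
      qed
      then show "eventually (\<lambda>y. norm ((F y - F x) / (y - x) - f x) \<le> root 3 (L * \<bar>y - x\<bar>)) (at x)"
        by (simp add: eventually_at_filter)
    qed
    then show ?thesis
      by (simp add: has_field_derivative_iff LIM_zero_cancel)
  qed
  have f_cont: "continuous_on UNIV f"
  proof (intro continuous_at_imp_continuous_on ballI)
    fix x
    have "((\<lambda>y. f y - f x) \<longlongrightarrow> 0) (at x)"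
      by (rule Lim_null_comparison[OF _ shift[of x]]) (use f_hol in auto)
    then show "isCont f x" by (simp add: isCont_def LIM_zero_cancel)
  qed
  then have f_meas: "f \<in> borel_measurable borel" by (rule borel_measurable_continuous_onI)
  have "\<mu> = density lborel (\<lambda>x. ennreal (f x))"
  proof (rule measure_eqI_generator_eq[where \<Omega> = UNIV])
    fix X assume "X \<in> range (\<lambda>(a, b). {a<..b::real})"
    then obtain a b where X: "X = {a<..b}" by auto
    show "emeasure \<mu> X = emeasure (density lborel (\<lambda>x. ennreal (f x))) X"
    proof (cases "a \<le> b")
      case True
      have "emeasure (density lborel (\<lambda>x. ennreal (f x))) X = (\<integral>\<^sup>+x. ennreal (f x) * indicator {a<..b} x \<partial>lborel)"
        using f_meas by (simp add: X emeasure_density)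
      also have "\<dots> = (\<integral>\<^sup>+x. ennreal (f x) * indicator {a..b} x \<partial>lborel)"
      proof (rule nn_integral_cong_AE)
        show "AE x in lborel. ennreal (f x) * indicator {a<..b} x = ennreal (f x) * indicator {a..b} x"
          using AE_lborel_singleton[of a] by eventually_elim (auto simp: indicator_def)
      qed
      also have "\<dots> = ennreal (F b - F a)"
        by (rule nn_integral_FTC_Icc) (use f_meas f_nonneg F_der True in \<open>auto\<close>)
      also have "\<dots> = emeasure \<mu> X"
        using finite_borel_measure.emeasure_Ioc[OF finite_borel_measure_M True] by (simp add: X F_def)
      finally show ?thesis by simp
    next
      case False
      then show ?thesis by (simp add: X)
    qed
  next
    show "sets \<mu> = sigma_sets UNIV (range (\<lambda>(a, b). {a<..b::real}))"
      "sets (density lborel (\<lambda>x. ennreal (f x))) = sigma_sets UNIV (range (\<lambda>(a, b). {a<..b::real}))"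
      by (simp_all add: borel_sigma_sets_Ioc)
  next
    show "Int_stable (range (\<lambda>(a, b). {a<..b::real}))"
      by (auto simp: Int_stable_def)
  next
    show "range (\<lambda>i. {- real i<..real i}) \<subseteq> range (\<lambda>(a, b). {a<..b::real})" by auto
    show "(\<Union>i. {- real i<..real i}) = UNIV"
      by (rule UN_Ioc_eq_UNIV)
    show "emeasure \<mu> {- real i<..real i} \<noteq> \<infinity>" for i by simp
  qed auto
  then have "is_lebesgue_density \<mu> f"
    using f_meas f_nonneg by (simp add: is_lebesgue_density_def)
  then show ?thesis using that f_hol by blast
qed

lemma abs_diff_cube_le:
  fixes a b :: real
  assumes "0 \<le> a" "0 \<le> b"
  shows "\<bar>a - b\<bar> ^ 3 \<le> \<bar>a ^ 3 - b ^ 3\<bar>"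
proof -
  have *: "(a - b) ^ 3 \<le> a ^ 3 - b ^ 3" if "0 \<le> b" "b \<le> a" for a b :: real
  proof -
    have "0 \<le> 3 * (a * b * (a - b))" using that by simp
    also have "\<dots> = a ^ 3 - b ^ 3 - (a - b) ^ 3"
      by (simp add: power3_eq_cube algebra_simps)
    finally show ?thesis by simp
  qed
  have "b ^ 3 \<le> a ^ 3" if "b \<le> a" "0 \<le> b" for a b :: real using that by (rule power_mono)
  then show ?thesis
    using *[of a b] *[of b a] assms by (cases "b \<le> a") (auto simp: abs_if)
qed

lemma sqrt_integrable_of_second_moment:
  assumes "real_distribution M" "finite_second_moment M"
  shows "sqrt_integrable_transforms M"
proof -
  interpret upper_half_transforms M
    using assms(1) by (simp add: upper_half_transforms_def)
  show ?thesis
  proof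
    show "integrable M (\<lambda>y. sqrt \<bar>y\<bar>)"
    proof (rule Bochner_Integration.integrable_bound)
      show "integrable M (\<lambda>y. 1 + y\<^sup>2)"
        using assms(2) by (simp add: finite_second_moment_def)
      show "(\<lambda>y. sqrt \<bar>y\<bar>) \<in> borel_measurable M" by (intro borel_meas) measurable
      have "sqrt \<bar>y\<bar> \<le> 1 + y\<^sup>2" for y :: real
      proof (rule real_le_lsqrt)
        have "\<bar>y\<bar> \<le> 1 + y\<^sup>2" using sum_squares_bound[of 1 "\<bar>y\<bar>"] by simp
        also have "\<dots> \<le> (1 + y\<^sup>2)\<^sup>2" using self_le_power[of "1 + y\<^sup>2" 2] by simp
        finally show "\<bar>y\<bar> \<le> (1 + y\<^sup>2)\<^sup>2" .
      qed auto
      then show "AE y in M. norm (sqrt \<bar>y\<bar>) \<le> norm (1 + y\<^sup>2)" by simp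
    qed
  qed
qed

text \<open>
  Compare with the smooth solution of width \<open>e = a\<^sup>2\<close>, shifted by \<open>\<plusminus>a\<close>: then \<open>a / e \<rightarrow> \<infinity>\<close>, so
  the additive error tends to \<open>0\<close>, and the shift costs at most \<open>C a\<close> because the profiles are uniformly
  Lipschitz at time \<open>t\<close>.
\<close>

theorem dyson_solution_holder_density:
  assumes u0: "real_distribution u\<^sub>0" "finite_second_moment u\<^sub>0" and sol: "dyson_solution u\<^sub>0 u" and t: "0 < t"
  obtains f where "is_lebesgue_density (u t) f"
    "\<And>x y. \<bar>f x - f y\<bar> \<le> root 3 (3 / (2 * pi * t\<^sup>2) * \<bar>x - y\<bar>)"
proof -
  interpret sqrt_integrable_transforms u\<^sub>0 by (rule sqrt_integrable_of_second_moment[OF u0])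
  have u: "weakly_continuous_curve u" "u 0 = u\<^sub>0" "cdf_viscosity_solution u"
    using sol by (auto simp: dyson_solution_def)
  have rd: "real_distribution (u t)" if "0 \<le> t" for t
    using u(1) that by (auto simp: weakly_continuous_curve_def)
  interpret ut: real_distribution "u t" using rd t by simp
  define b where "b e a = 1 / 2 - arctan (a / e) / pi" for e a :: real
  have b: "0 \<le> b e a" for e a using arctan_bounded[of "a / e"] by (simp add: b_def field_simps)
  have up: "upper_cdf u (t, x) \<le> 1 * profile e t (x + a) + b e a" if e: "0 < e" and a: "0 < a" for e a x
  proof (rule profile_comparison[OF e _ b])
    show "upper_cdf u p \<le> 1" if "0 \<le> fst p" for p
      using prob_space.prob_le_1[of "u (fst p)"] rd[OF that]
      by (simp add: upper_cdf_def split_beta real_distribution_def)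
    show "upper_cdf u (0, x) \<le> 1 * profile e 0 (x + a) + b e a" for x
      using cdf_le_profile_0[OF e a, of x] by (simp add: upper_cdf_def u(2) b_def)
    show "1 * integrated_dyson_operator \<phi> t x \<le> 0"
      if "bounded_smooth_on spacetime \<phi>" "strict_global_max_on spacetime (\<lambda>p. upper_cdf u p - 1 * \<phi> p) (t, x)" for \<phi> t x
      using u(3) that by (simp add: cdf_viscosity_solution_def)
  qed (use upper_cdf_usc[OF u(1)] t in auto)
  have lo: "- lower_cdf u (t, x) \<le> (- 1) * profile e t (x + - a) + b e a" if e: "0 < e" and a: "0 < a" for e a x
  proof (rule profile_comparison[OF e _ b])
    show "- lower_cdf u p \<le> 1" if "0 \<le> fst p" for p
      by (simp add: lower_cdf_def split_beta) (rule order_trans[of _ 0], simp_all)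
    show "- lower_cdf u (0, x) \<le> (- 1) * profile e 0 (x + - a) + b e a" for x
      using profile_0_le_cdf[OF e a, of x] by (simp add: lower_cdf_def u(2) b_def)
    show "(- 1) * integrated_dyson_operator \<phi> t x \<le> 0"
      if "bounded_smooth_on spacetime \<phi>" "strict_global_max_on spacetime (\<lambda>p. - lower_cdf u p - (- 1) * \<phi> p) (t, x)" for \<phi> t x
    proof -
      have "strict_global_min_on spacetime (\<lambda>p. lower_cdf u p - \<phi> p) (t, x)"
        unfolding strict_global_min_on_def
      proof (intro conjI ballI impI)
        show "(t, x) \<in> spacetime" using that(2) by (simp add: strict_global_max_on_def)
        fix q assume "q \<in> spacetime" "q \<noteq> (t, x)"
        then have "- lower_cdf u q - (- 1) * \<phi> q < - lower_cdf u (t, x) - (- 1) * \<phi> (t, x)"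
          using that(2) unfolding strict_global_max_on_def by blast
        then show "lower_cdf u (t, x) - \<phi> (t, x) < lower_cdf u q - \<phi> q" by simp
      qed
      then show ?thesis using u(3) that(1) by (simp add: cdf_viscosity_solution_def)
    qed
  qed (use lower_cdf_lsc[OF u(1)] t in auto)
  define a where "a n = 1 / real (Suc n)" for n
  \<comment> \<open>The width is much smaller than the shift.\<close>
  define e where "e n = (a n)\<^sup>2" for n
  have ae: "0 < a n" "0 < e n" "a n / e n = real (Suc n)" for n
    by (auto simp: a_def e_def power2_eq_square)
  define C where "C = 1 / sqrt (pi * t)"
  have lip: "\<bar>profile (e n) t y - profile (e n) t x\<bar> \<le> C * \<bar>y - x\<bar>" for n x y
  proof -
    have "norm (profile (e n) t y - profile (e n) t x) \<le> C * norm (y - x)"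
    proof (rule field_differentiable_bound[where S = UNIV])
      fix x
      show "(profile (e n) t has_field_derivative profile_density (e n) t x) (at x within UNIV)"
        using profile_has_derivative[OF t ae(2)] by simp
      show "norm (profile_density (e n) t x) \<le> C"
        using profile_density_le[OF t ae(2)] profile_density_nonneg[OF t ae(2)] by (simp add: C_def)
    qed auto
    then show ?thesis by simp
  qed
  define k where "k n = C * a n + (1 / 2 - arctan (real (Suc n)) / pi)" for n
  have near: "\<bar>profile (e n) t x - cdf (u t) x\<bar> \<le> k n" for n x
  proof -
    have bn: "b (e n) (a n) = 1 / 2 - arctan (real (Suc n)) / pi" by (simp add: b_def ae)
    have "cdf (u t) x \<le> profile (e n) t (x + a n) + b (e n) (a n)"
      using up[OF ae(2,1), of x n n] by (simp add: upper_cdf_def cdf_def)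
    moreover have "profile (e n) t (x + - a n) - b (e n) (a n) \<le> measure (u t) {..<x}"
      using lo[OF ae(2,1), of x n n] by (simp add: lower_cdf_def)
    moreover have "measure (u t) {..<x} \<le> cdf (u t) x"
      unfolding cdf_def by (intro ut.finite_measure_mono) auto
    ultimately show ?thesis
      using lip[of n "x + a n" x] lip[of n "x + - a n" x] ae(1)[of n] bn by (simp add: k_def)
  qed
  have "(\<lambda>n. C * a n + (1 / 2 - arctan (real (Suc n)) / pi)) \<longlonglongrightarrow> C * 0 + (1 / 2 - (pi / 2) / pi)"
    unfolding a_def
    by (intro tendsto_intros LIMSEQ_Suc[OF lim_1_over_n] LIMSEQ_Suc[where f = "\<lambda>n. arctan (real n)"]
        filterlim_compose[OF tendsto_arctan_at_top filterlim_real_sequentially]) auto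
  then have k: "k \<longlonglongrightarrow> 0" by (simp add: k_def[abs_def])
  show ?thesis
  proof (rule density_of_cdf_limit[of "u t" "3 / (2 * pi * t\<^sup>2)" "\<lambda>n. profile (e n) t" "\<lambda>n. profile_density (e n) t"])
    show "(\<lambda>n. profile (e n) t x) \<longlonglongrightarrow> cdf (u t) x" for x
    proof (rule LIM_zero_cancel, rule Lim_null_comparison[OF _ k])
      show "eventually (\<lambda>n. norm (profile (e n) t x - cdf (u t) x) \<le> k n) sequentially"
        using near by simp
    qed
    show "\<bar>profile_density (e n) t x - profile_density (e n) t y\<bar> \<le> root 3 (3 / (2 * pi * t\<^sup>2) * \<bar>x - y\<bar>)" for n x y
    proof -
      have "\<bar>profile_density (e n) t x - profile_density (e n) t y\<bar> ^ 3 \<le> 3 / (2 * pi * t\<^sup>2) * \<bar>x - y\<bar>"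
        using abs_diff_cube_le[OF profile_density_nonneg[OF t ae(2)] profile_density_nonneg[OF t ae(2)]] profile_density_cube_lipschitz[OF t ae(2)]
        by (rule order_trans)
      then have "root 3 (\<bar>profile_density (e n) t x - profile_density (e n) t y\<bar> ^ 3) \<le> root 3 (3 / (2 * pi * t\<^sup>2) * \<bar>x - y\<bar>)"
        by simp
      then show ?thesis by (simp add: real_root_power_cancel)
    qed
  qed (use rd t that profile_density_nonneg[OF t ae(2)] profile_has_derivative[OF t ae(2)] in auto)
qed

lemma holder_seminorm_le:
  assumes "0 \<le> L" "\<And>x y. \<bar>f x - f y\<bar> \<le> root 3 (L * \<bar>x - y\<bar>)"
  shows "holder_seminorm (1 / 3) f \<le> ennreal (root 3 L)"
  unfolding holder_seminorm_def
proof (intro SUP_least, clarsimp)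
  fix x y :: real assume "x \<noteq> y"
  then have "root 3 (L * \<bar>x - y\<bar>) = root 3 L * \<bar>x - y\<bar> powr (1 / 3)"
    by (simp add: real_root_mult root_powr_inverse)
  then show "ennreal (\<bar>f x - f y\<bar> / \<bar>x - y\<bar> powr (1 / 3)) \<le> ennreal (root 3 L)"
    using assms(2)[of x y] \<open>x \<noteq> y\<close> by (intro ennreal_leI) (simp add: divide_le_eq)
qed

theorem corollary2p7:
  fixes u\<^sub>0 :: "real measure" and u :: "real \<Rightarrow> real measure"
  assumes "real_distribution u\<^sub>0" and "finite_second_moment u\<^sub>0"
    and "dyson_solution u\<^sub>0 u"
  shows "(\<forall>t T. 0 < t \<and> t \<le> T \<longrightarrow>
            (\<integral>\<^sup>+s\<in>{t..T}. (density_holder_seminorm (1/3) (u s)) ^ 3 \<partial>lborel) < \<infinity>) \<and>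
         (AE s in lborel. 0 < s \<longrightarrow> density_in_holder (1/3) (u s))"
proof -
  have key: "\<exists>f. is_lebesgue_density (u s) f \<and> holder_seminorm (1/3) f \<le> ennreal (root 3 (3 / (2 * pi * s\<^sup>2)))"
    if s: "0 < s" for s
  proof -
    obtain f where "is_lebesgue_density (u s) f"
      "\<And>x y. \<bar>f x - f y\<bar> \<le> root 3 (3 / (2 * pi * s\<^sup>2) * \<bar>x - y\<bar>)"
      using dyson_solution_holder_density[OF assms s] by blast
    then show ?thesis using holder_seminorm_le[of "3 / (2 * pi * s\<^sup>2)" f] by auto
  qed
  have "density_in_holder (1/3) (u s)" if "0 < s" for s
    using key[OF that] unfolding density_in_holder_def
    by (metis ennreal_less_top le_less_trans infinity_ennreal_def)
  moreover have "(\<integral>\<^sup>+s\<in>{t..T}. (density_holder_seminorm (1/3) (u s)) ^ 3 \<partial>lborel) < \<infinity>"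
    if t: "0 < t" "t \<le> T" for t T
  proof -
    have "(density_holder_seminorm (1/3) (u s)) ^ 3 \<le> ennreal (3 / (2 * pi * t\<^sup>2))" if s: "t \<le> s" for s
    proof -
      have s0: "0 < s" using s t by simp
      obtain f where f: "is_lebesgue_density (u s) f"
        "holder_seminorm (1/3) f \<le> ennreal (root 3 (3 / (2 * pi * s\<^sup>2)))"
        using key[OF s0] by blast
      have "density_holder_seminorm (1/3) (u s) \<le> ennreal (root 3 (3 / (2 * pi * s\<^sup>2)))"
        unfolding density_holder_seminorm_def by (rule INF_lower2[of f]) (use f in auto)
      then have "(density_holder_seminorm (1/3) (u s)) ^ 3 \<le> ennreal (root 3 (3 / (2 * pi * s\<^sup>2))) ^ 3"
        by (intro power_mono) auto
      also have "\<dots> = ennreal (3 / (2 * pi * s\<^sup>2))"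
        by (simp add: ennreal_power)
      also have "\<dots> \<le> ennreal (3 / (2 * pi * t\<^sup>2))"
        using s t by (intro ennreal_leI divide_left_mono mult_left_mono power_mono) auto
      finally show ?thesis .
    qed
    then have "(\<integral>\<^sup>+s\<in>{t..T}. (density_holder_seminorm (1/3) (u s)) ^ 3 \<partial>lborel)
        \<le> (\<integral>\<^sup>+s. ennreal (3 / (2 * pi * t\<^sup>2)) * indicator {t..T} s \<partial>lborel)"
      by (intro nn_integral_mono) (auto simp: indicator_def)
    also have "\<dots> = ennreal (3 / (2 * pi * t\<^sup>2)) * ennreal (T - t)"
      using t by (simp add: nn_integral_cmult)
    also have "\<dots> < \<infinity>" by (simp add: ennreal_mult_less_top)
    finally show ?thesis .
  qed
  ultimately show ?thesis by auto
qed

end
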